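(* Let $M\in D^b(\mathbb{Z}_p)$ be such that $M[\frac1p]$ is a perfect complex of $\mathbb{Q}_p$-vector spaces. Let $\theta:M\to M$ be a map in $D^b(\mathbb{Z}_p)$ such that $\mathrm{fib}(\theta)$ is a perfect complex over $\mathbb{Z}_p$. Then $\chi^l(\mathrm{Bock}^\bullet(M,\theta^r))$ exists for all $r\gg0$. Moreover, $$\lim_{r\to\infty}\frac{\chi^l(\mathrm{Bock}^\bullet(M,\theta^r))}{r}$$ exists and is an integer.
   Context: $D^b(\mathbb{Z}_p)$ is the bounded derived ($\infty$-)category of $\mathbb{Z}_p$-modules. **Bockstein complex.** For $N\in D^b(\mathbb{Z}_p)$ and $\theta:N\to N$, let $R:=\mathrm{fib}(\theta)$. The composite of natural maps $\mathrm{fib}(\theta)\to N\xrightarrow{1}N\to\mathrm{cofib}(\theta)\simeq R[1]$ is a map $\beta:R\to R[1]$. Then $\mathrm{Bock}^\bullet(N,\theta)$ is the complex $\cdots\to H^{i-1}(R)\to H^i(R)\to H^{i+1}(R)\to\cdots$ with differentials induced by $\beta$ and $H^0(R)$ in degree $0$. **Length Euler characteristic.** For $P\in D^b(\mathbb{Z}_p)$ such that every $H^i(P)$ has finite length over $\mathbb{Z}_p$, $\chi^l(P):=\sum_i(-1)^i\mathrm{length}_{\mathbb{Z}_p}H^i(P)$. One says that $\chi^l(\mathrm{Bock}^\bullet(N,\theta))$ exists if all cohomology groups of the complex $\mathrm{Bock}^\bullet(N,\theta)$ have finite length. *)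

theory Defs
  imports Complex_Main "HOL-Library.Extended_Nat" "HOL-Computational_Algebra.Primes" "HOL-Algebra.Module" "HOL-Algebra.AbelCoset"
begin

text \<open>
  Modules are those of \<^theory>\<open>HOL-Algebra.Module\<close>. Their record type inherits the fields
  \<^const>\<open>mult\<close> and \<^const>\<open>one\<close> from rings; these carry no meaning for a module, and
  the constructions below leave them undefined.
\<close>

section \<open>Modules\<close>

definition mod_hom ::
  "('r, 'c) ring_scheme \<Rightarrow> ('r, 'm, 'd) module_scheme \<Rightarrow> ('r, 'n, 'e) module_scheme \<Rightarrow> ('m \<Rightarrow> 'n) set"
  where "mod_hom R M N =
    {f. f \<in> carrier M \<rightarrow> carrier N
      \<and> (\<forall>x \<in> carrier M. \<forall>y \<in> carrier M. f (x \<oplus>\<^bsub>M\<^esub> y) = f x \<oplus>\<^bsub>N\<^esub> f y)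
      \<and> (\<forall>r \<in> carrier R. \<forall>x \<in> carrier M. f (r \<odot>\<^bsub>M\<^esub> x) = r \<odot>\<^bsub>N\<^esub> f x)}"

definition dsum_mod :: "('r, 'm) module \<Rightarrow> ('r, 'n) module \<Rightarrow> ('r, 'm \<times> 'n) module"
  where "dsum_mod M N =
    \<lparr>carrier = carrier M \<times> carrier N, mult = undefined, one = undefined,
     zero = (\<zero>\<^bsub>M\<^esub>, \<zero>\<^bsub>N\<^esub>),
     add = (\<lambda>(x, y) (x', y'). (x \<oplus>\<^bsub>M\<^esub> x', y \<oplus>\<^bsub>N\<^esub> y')),
     smult = (\<lambda>r (x, y). (r \<odot>\<^bsub>M\<^esub> x, r \<odot>\<^bsub>N\<^esub> y))\<rparr>"

definition quot_mod :: "('r, 'm) module \<Rightarrow> 'm set \<Rightarrow> ('r, 'm set) module"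
  where "quot_mod M B =
    \<lparr>carrier = a_rcosets\<^bsub>M\<^esub> B, mult = undefined, one = undefined,
     zero = B,
     add = (\<lambda>X Y. X <+>\<^bsub>M\<^esub> Y),
     smult = (\<lambda>r X. \<Union>x\<in>X. B +>\<^bsub>M\<^esub> (r \<odot>\<^bsub>M\<^esub> x))\<rparr>"

definition free_mod :: "'r ring \<Rightarrow> 'i set \<Rightarrow> ('r, 'i \<Rightarrow> 'r) module"
  where "free_mod R I =
    \<lparr>carrier = {f. (\<forall>i \<in> I. f i \<in> carrier R) \<and> (\<forall>i. i \<notin> I \<longrightarrow> f i = \<zero>\<^bsub>R\<^esub>)
                  \<and> finite {i. f i \<noteq> \<zero>\<^bsub>R\<^esub>}},
     mult = undefined, one = undefined,
     zero = (\<lambda>_. \<zero>\<^bsub>R\<^esub>),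
     add = (\<lambda>f g i. f i \<oplus>\<^bsub>R\<^esub> g i),
     smult = (\<lambda>r f i. r \<otimes>\<^bsub>R\<^esub> f i)\<rparr>"

text \<open>
  A projective module is a direct summand of a free module. Restricting the index set of the free
  module to the type of elements of \<open>P\<close> loses nothing: if \<open>P\<close> is a summand of any
  free module, then it is one of the free module on the set \<open>carrier P\<close>.
\<close>

definition projective :: "'r ring \<Rightarrow> ('r, 'm) module \<Rightarrow> bool"
  where "projective R P \<longleftrightarrow> module R P \<and>
    (\<exists>(I :: 'm set). \<exists>s \<in> mod_hom R P (free_mod R I). \<exists>q \<in> mod_hom R (free_mod R I) P.
       \<forall>x \<in> carrier P. q (s x) = x)"

definition fin_generated :: "'r ring \<Rightarrow> ('r, 'm) module \<Rightarrow> bool"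
  where "fin_generated R M \<longleftrightarrow>
    (\<exists>S. finite S \<and> S \<subseteq> carrier M \<and> (\<forall>N. submodule N R M \<and> S \<subseteq> N \<longrightarrow> N = carrier M))"

text \<open>The length is the supremum of the lengths of strict chains of submodules.\<close>

definition mod_length :: "'r ring \<Rightarrow> ('r, 'm) module \<Rightarrow> enat"
  where "mod_length R M =
    (SUP n \<in> {n :: nat. \<exists>N. (\<forall>k\<le>n. submodule (N k) R M) \<and> (\<forall>k<n. N k \<subset> N (Suc k))}. enat n)"

section \<open>Cochain complexes\<close>

record ('r, 'm) cochain =
  cmodule :: "int \<Rightarrow> ('r, 'm) module"
  cdiff :: "int \<Rightarrow> 'm \<Rightarrow> 'm"

definition cochain_complex :: "'r ring \<Rightarrow> ('r, 'm) cochain \<Rightarrow> bool"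
  where "cochain_complex R C \<longleftrightarrow>
    (\<forall>n. module R (cmodule C n)) \<and>
    (\<forall>n. cdiff C n \<in> mod_hom R (cmodule C n) (cmodule C (n + 1))) \<and>
    (\<forall>n. \<forall>x \<in> carrier (cmodule C n). cdiff C (n + 1) (cdiff C n x) = \<zero>\<^bsub>cmodule C (n + 1 + 1)\<^esub>)"

definition chain_map ::
  "'r ring \<Rightarrow> ('r, 'm) cochain \<Rightarrow> ('r, 'n) cochain \<Rightarrow> (int \<Rightarrow> 'm \<Rightarrow> 'n) \<Rightarrow> bool"
  where "chain_map R C D f \<longleftrightarrow>
    (\<forall>n. f n \<in> mod_hom R (cmodule C n) (cmodule D n)) \<and>
    (\<forall>n. \<forall>x \<in> carrier (cmodule C n). f (n + 1) (cdiff C n x) = cdiff D n (f n x))"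

definition chain_comp :: "(int \<Rightarrow> 'n \<Rightarrow> 'k) \<Rightarrow> (int \<Rightarrow> 'm \<Rightarrow> 'n) \<Rightarrow> int \<Rightarrow> 'm \<Rightarrow> 'k"
  where "chain_comp g f n = g n \<circ> f n"

primrec chain_pow :: "(int \<Rightarrow> 'm \<Rightarrow> 'm) \<Rightarrow> nat \<Rightarrow> int \<Rightarrow> 'm \<Rightarrow> 'm"
  where
    "chain_pow f 0 = (\<lambda>n x. x)"
  | "chain_pow f (Suc r) = chain_comp f (chain_pow f r)"

definition cocycles :: "('r, 'm) cochain \<Rightarrow> int \<Rightarrow> 'm set"
  where "cocycles C n = {x \<in> carrier (cmodule C n). cdiff C n x = \<zero>\<^bsub>cmodule C (n + 1)\<^esub>}"

definition coboundaries :: "('r, 'm) cochain \<Rightarrow> int \<Rightarrow> 'm set"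
  where "coboundaries C n = cdiff C (n - 1) ` carrier (cmodule C (n - 1))"

definition cohomology :: "('r, 'm) cochain \<Rightarrow> int \<Rightarrow> ('r, 'm set) module"
  where "cohomology C n = quot_mod ((cmodule C n)\<lparr>carrier := cocycles C n\<rparr>) (coboundaries C n)"

text \<open>The map on cohomology induced by a chain map with target \<open>D\<close>.\<close>

definition coh_map :: "('r, 'n) cochain \<Rightarrow> (int \<Rightarrow> 'm \<Rightarrow> 'n) \<Rightarrow> int \<Rightarrow> 'm set \<Rightarrow> 'n set"
  where "coh_map D f n X = (\<Union>x\<in>X. coboundaries D n +>\<^bsub>cmodule D n\<^esub> f n x)"

definition quasi_iso ::
  "'r ring \<Rightarrow> ('r, 'm) cochain \<Rightarrow> ('r, 'n) cochain \<Rightarrow> (int \<Rightarrow> 'm \<Rightarrow> 'n) \<Rightarrow> bool"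
  where "quasi_iso R C D f \<longleftrightarrow> chain_map R C D f \<and>
    (\<forall>n. bij_betw (coh_map D f n) (carrier (cohomology C n)) (carrier (cohomology D n)))"

section \<open>The bounded derived category\<close>

text \<open>
  \<open>D\<^sup>-(R)\<close> is the differential graded nerve of the category of bounded above cochain
  complexes of projective \<open>R\<close>-modules, and \<open>D\<^sup>b(R)\<close> is its full subcategory
  of objects whose cohomology is bounded. So the objects of \<open>D\<^sup>b(R)\<close> are the complexes
  singled out by \<open>in_Db\<close>, its morphisms are the chain maps between them, and composition is
  composition of chain maps; there is no need to invert quasi-isomorphisms.
\<close>

definition in_Db :: "'r ring \<Rightarrow> ('r, 'm) cochain \<Rightarrow> bool"
  where "in_Db R C \<longleftrightarrow> cochain_complex R C \<and>
    (\<forall>n. projective R (cmodule C n)) \<and>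
    (\<exists>b. \<forall>n>b. carrier (cmodule C n) = {\<zero>\<^bsub>cmodule C n\<^esub>}) \<and>
    (\<exists>a. \<forall>n<a. carrier (cohomology C n) = {\<zero>\<^bsub>cohomology C n\<^esub>})"

text \<open>
  A complex is perfect if it is isomorphic in the derived category to a bounded complex \<open>Q\<close>
  of finitely generated projective modules; as such a \<open>Q\<close> is K-projective, the isomorphism
  is given by a quasi-isomorphism out of \<open>Q\<close>. The terms of \<open>Q\<close> are summands of
  some \<open>R\<^sup>k\<close>, hence up to isomorphism have their elements in \<open>nat \<Rightarrow> 'r\<close>.
\<close>

definition perfect :: "'r ring \<Rightarrow> ('r, 'm) cochain \<Rightarrow> bool"
  where "perfect R C \<longleftrightarrow>
    (\<exists>(Q :: ('r, nat \<Rightarrow> 'r) cochain) f a b.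
       cochain_complex R Q \<and>
       (\<forall>n. projective R (cmodule Q n) \<and> fin_generated R (cmodule Q n)) \<and>
       (\<forall>n. n < a \<or> n > b \<longrightarrow> carrier (cmodule Q n) = {\<zero>\<^bsub>cmodule Q n\<^esub>}) \<and>
       quasi_iso R Q C f)"

definition shift :: "('r, 'm) cochain \<Rightarrow> ('r, 'm) cochain"
  where "shift C =
    \<lparr>cmodule = (\<lambda>n. cmodule C (n + 1)),
     cdiff = (\<lambda>n x. \<ominus>\<^bsub>cmodule C (n + 1 + 1)\<^esub> cdiff C (n + 1) x)\<rparr>"

definition cofib ::
  "('r, 'm) cochain \<Rightarrow> ('r, 'n) cochain \<Rightarrow> (int \<Rightarrow> 'm \<Rightarrow> 'n) \<Rightarrow> ('r, 'm \<times> 'n) cochain"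
  where "cofib C D f =
    \<lparr>cmodule = (\<lambda>n. dsum_mod (cmodule C (n + 1)) (cmodule D n)),
     cdiff = (\<lambda>n (x, y). (\<ominus>\<^bsub>cmodule C (n + 1 + 1)\<^esub> cdiff C (n + 1) x,
                          f (n + 1) x \<oplus>\<^bsub>cmodule D (n + 1)\<^esub> cdiff D n y))\<rparr>"

definition fib ::
  "('r, 'm) cochain \<Rightarrow> ('r, 'n) cochain \<Rightarrow> (int \<Rightarrow> 'm \<Rightarrow> 'n) \<Rightarrow> ('r, 'm \<times> 'n) cochain"
  where "fib C D f =
    \<lparr>cmodule = (\<lambda>n. dsum_mod (cmodule C n) (cmodule D (n - 1))),
     cdiff = (\<lambda>n (x, y). (cdiff C n x, f n x \<ominus>\<^bsub>cmodule D n\<^esub> cdiff D (n - 1) y))\<rparr>"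

section \<open>The Bockstein complex\<close>

definition fib_to_source :: "int \<Rightarrow> 'm \<times> 'n \<Rightarrow> 'm"
  where "fib_to_source n = fst"

definition target_to_cofib :: "('r, 'm) cochain \<Rightarrow> int \<Rightarrow> 'n \<Rightarrow> 'm \<times> 'n"
  where "target_to_cofib C n y = (\<zero>\<^bsub>cmodule C (n + 1)\<^esub>, y)"

text \<open>
  The isomorphism from \<open>cofib C D f\<close> to \<open>shift (fib C D f)\<close>. The terms of the two
  complexes agree, but with the signs above the differentials do not, whence the sign here.
\<close>

definition cofib_to_shift_fib :: "('r, 'm) cochain \<Rightarrow> int \<Rightarrow> 'm \<times> 'n \<Rightarrow> 'm \<times> 'n"
  where "cofib_to_shift_fib C n = (\<lambda>(x, y). (\<ominus>\<^bsub>cmodule C (n + 1)\<^esub> x, y))"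

definition bockstein_map :: "('r, 'm) cochain \<Rightarrow> int \<Rightarrow> 'm \<times> 'm \<Rightarrow> 'm \<times> 'm"
  where "bockstein_map N =
    chain_comp (cofib_to_shift_fib N) (chain_comp (target_to_cofib N) fib_to_source)"

text \<open>
  For \<open>R = fib N N \<theta>\<close> the differential in degree \<open>i\<close> is the map from
  \<open>H\<^sup>i(R)\<close> to \<open>H\<^sup>i(shift R)\<close> induced by the Bockstein map; the elements of
  \<open>H\<^sup>i(shift R)\<close> and those of \<open>H\<^sup>i\<^sup>+\<^sup>1(R)\<close> are the same cosets.
\<close>

definition Bock :: "('r, 'm) cochain \<Rightarrow> (int \<Rightarrow> 'm \<Rightarrow> 'm) \<Rightarrow> ('r, ('m \<times> 'm) set) cochain"
  where "Bock N \<theta> =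
    \<lparr>cmodule = cohomology (fib N N \<theta>),
     cdiff = coh_map (shift (fib N N \<theta>)) (bockstein_map N)\<rparr>"

section \<open>The length Euler characteristic\<close>

definition chi_l_exists :: "'r ring \<Rightarrow> ('r, 'm) cochain \<Rightarrow> bool"
  where "chi_l_exists R P \<longleftrightarrow> (\<forall>i. mod_length R (cohomology P i) \<noteq> \<infinity>)"

text \<open>
  The sum runs over the degrees with nonzero cohomology, which are finitely many
  for a complex with bounded cohomology.
\<close>

definition chi_l :: "'r ring \<Rightarrow> ('r, 'm) cochain \<Rightarrow> int"
  where "chi_l R P =
    (\<Sum>i | mod_length R (cohomology P i) \<noteq> 0.
       (if even i then 1 else - 1) * int (the_enat (mod_length R (cohomology P i))))"

section \<open>Localization at an element\<close>

definition frac_rel ::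
  "'r ring \<Rightarrow> 'r \<Rightarrow> ('r, 'm) module \<Rightarrow> (('m \<times> nat) \<times> ('m \<times> nat)) set"
  where "frac_rel R s M =
    {((m, k), (m', k')). m \<in> carrier M \<and> m' \<in> carrier M \<and>
       (\<exists>j::nat. (s [^]\<^bsub>R\<^esub> (j + k')) \<odot>\<^bsub>M\<^esub> m = (s [^]\<^bsub>R\<^esub> (j + k)) \<odot>\<^bsub>M\<^esub> m')}"

text \<open>\<open>fraction R s M m k\<close> is the fraction with numerator \<open>m\<close> and denominator \<open>s\<^sup>k\<close>.\<close>

definition fraction :: "'r ring \<Rightarrow> 'r \<Rightarrow> ('r, 'm) module \<Rightarrow> 'm \<Rightarrow> nat \<Rightarrow> ('m \<times> nat) set"
  where "fraction R s M m k = frac_rel R s M `` {(m, k)}"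

definition loc_mod ::
  "'r ring \<Rightarrow> 'r \<Rightarrow> ('r, 'm) module \<Rightarrow> (('r \<times> nat) set, ('m \<times> nat) set) module"
  where "loc_mod R s M =
    \<lparr>carrier = {fraction R s M m k | m k. m \<in> carrier M}, mult = undefined, one = undefined,
     zero = fraction R s M \<zero>\<^bsub>M\<^esub> 0,
     add = (\<lambda>X Y. \<Union>(m, k)\<in>X. \<Union>(m', k')\<in>Y.
       fraction R s M ((s [^]\<^bsub>R\<^esub> k') \<odot>\<^bsub>M\<^esub> m \<oplus>\<^bsub>M\<^esub> (s [^]\<^bsub>R\<^esub> k) \<odot>\<^bsub>M\<^esub> m') (k + k')),
     smult = (\<lambda>A X. \<Union>(a, j)\<in>A. \<Union>(m, k)\<in>X. fraction R s M (a \<odot>\<^bsub>M\<^esub> m) (j + k))\<rparr>"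

definition regular_mod :: "'r ring \<Rightarrow> ('r, 'r) module"
  where "regular_mod R = \<lparr>carrier = carrier R, mult = mult R, one = one R,
     zero = zero R, add = add R, smult = mult R\<rparr>"

definition loc_ring :: "'r ring \<Rightarrow> 'r \<Rightarrow> ('r \<times> nat) set ring"
  where "loc_ring R s = (let L = loc_mod R s (regular_mod R) in
    \<lparr>carrier = carrier L, mult = smult L, one = fraction R s (regular_mod R) \<one>\<^bsub>R\<^esub> 0,
     zero = zero L, add = add L\<rparr>)"

definition loc_cochain ::
  "'r ring \<Rightarrow> 'r \<Rightarrow> ('r, 'm) cochain \<Rightarrow> (('r \<times> nat) set, ('m \<times> nat) set) cochain"
  where "loc_cochain R s C =
    \<lparr>cmodule = (\<lambda>n. loc_mod R s (cmodule C n)),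
     cdiff = (\<lambda>n X. \<Union>(m, k)\<in>X. fraction R s (cmodule C (n + 1)) (cdiff C n m) k)\<rparr>"

section \<open>The p-adic integers and numbers\<close>

text \<open>
  The inverse limit of the rings of integers modulo \<open>p\<^sup>n\<close>, the latter with
  elements \<open>0, \<dots>, p\<^sup>n - 1\<close>.
\<close>

definition Zp :: "nat \<Rightarrow> (nat \<Rightarrow> int) ring"
  where "Zp p =
    \<lparr>carrier = {x. \<forall>n. x n \<in> {0..<int p ^ n} \<and> x (Suc n) mod int p ^ n = x n},
     mult = (\<lambda>x y n. (x n * y n) mod int p ^ n),
     one = (\<lambda>n. 1 mod int p ^ n),
     zero = (\<lambda>n. 0),
     add = (\<lambda>x y n. (x n + y n) mod int p ^ n)\<rparr>"

definition Zp_p :: "nat \<Rightarrow> nat \<Rightarrow> int"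
  where "Zp_p p = (\<lambda>n. int p mod int p ^ n)"

definition Qp :: "nat \<Rightarrow> ((nat \<Rightarrow> int) \<times> nat) set ring"
  where "Qp p = loc_ring (Zp p) (Zp_p p)"

definition invert_p ::
  "nat \<Rightarrow> (nat \<Rightarrow> int, 'm) cochain \<Rightarrow> (((nat \<Rightarrow> int) \<times> nat) set, ('m \<times> nat) set) cochain"
  where "invert_p p M = loc_cochain (Zp p) (Zp_p p) M"

end

theory Submission
  imports Defs "HOL-Number_Theory.Cong"
begin

text \<open>
  Write \<open>A\<^sup>i\<close> for \<open>H\<^sup>i(M)\<close> and \<open>T\<close> for the endomorphism of \<open>A\<^sup>i\<close> that \<open>\<theta>\<close> induces. The fibre of \<open>\<theta>\<^sup>r\<close> has as \<open>i\<close>-th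
  cohomology an extension of the kernel of \<open>T\<^sup>r\<close> on \<open>A\<^sup>i\<close> by the cokernel of \<open>T\<^sup>r\<close> on \<open>A\<^sup>i\<^sup>-\<^sup>1\<close>, and the Bockstein
  differential is induced by the composite \<open>ker T\<^sup>r \<rightarrow> A\<^sup>i \<rightarrow> coker T\<^sup>r\<close>. So the cohomology of the Bockstein complex in
  degree \<open>i\<close> is an extension of \<open>ker T\<^sup>r \<inter> T\<^sup>r A\<^sup>i\<close> by \<open>A\<^sup>i\<^sup>-\<^sup>1 / (ker T\<^sup>r + T\<^sup>r A\<^sup>i\<^sup>-\<^sup>1)\<close> (lemma \<open>Bock_length\<close>), and its length
  Euler characteristic is the alternating sum over \<open>i\<close> of
  \<open>length (ker T\<^sup>r \<inter> T\<^sup>r A\<^sup>i) - length (A\<^sup>i / (ker T\<^sup>r + T\<^sup>r A\<^sup>i))\<close>.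

  Fix \<open>A = A\<^sup>i\<close>. As \<open>T\<^sup>r\<close> identifies \<open>A / (ker T\<^sup>r + T\<^sup>r A)\<close> with \<open>T\<^sup>r A / T\<^sup>2\<^sup>r A\<close>, this difference is the index, the length of
  the kernel minus the length of the cokernel, of \<open>T\<^sup>r\<close> on the submodule \<open>T\<^sup>r A\<close>. The index of \<open>T\<^sup>r\<close> is \<open>r\<close> times
  that of \<open>T\<close>, and the index of \<open>T\<close> on \<open>T\<^sup>r A\<close> is the same for all \<open>r\<close> from which on it is defined: passing
  from \<open>T\<^sup>r A\<close> to \<open>T\<^sup>r\<^sup>+\<^sup>1 A\<close>, kernel and cokernel lose the same length. Hence the Euler characteristic is \<open>r\<close> times a
  fixed integer for all large \<open>r\<close> (theorem \<open>index_of_power\<close>).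

  It remains to see that \<open>ker T \<inter> T\<^sup>r A\<close> and \<open>T\<^sup>r A / T\<^sup>r\<^sup>+\<^sup>1 A\<close> have finite length for large \<open>r\<close>. They are
  subquotients of \<open>ker T\<close> and \<open>A / T A\<close>, thus of the cohomology of the fibre of \<open>\<theta>\<close>, which is perfect; and a
  subquotient of a finitely generated \<open>\<int>\<^sub>p\<close>-module has finite length as soon as it is torsion (theorem
  \<open>fin_generated_torsion_finite\<close>). They are torsion for large \<open>r\<close>, because after inverting \<open>p\<close> the module \<open>A\<close> becomes a
  finite-dimensional vector space, in which the chains of the \<open>ker T\<^sup>r\<close> and of the \<open>T\<^sup>r A\<close> become stationary
  (lemmas \<open>ascending_torsion\<close> and \<open>descending_torsion\<close>).

  The cohomology of the Bockstein complex is an iterated subquotient. To avoid cosets of cosets, lengths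
  are taken of intervals of submodules of a fixed module, and isomorphisms of subquotients are given by maps
  on representatives (locale \<open>subquot_iso\<close>).
\<close>

section \<open>Submodules\<close>

lemma (in abelian_group) minus_cancel:
  assumes "x \<in> carrier G" "y \<in> carrier G"
  shows "(x \<ominus> y) \<oplus> y = x" "y \<oplus> (x \<ominus> y) = x" "(x \<oplus> y) \<ominus> y = x" "(y \<oplus> x) \<ominus> y = x"
proof -
  show 1: "(x \<ominus> y) \<oplus> y = x" using assms by (simp add: a_minus_def a_assoc l_neg)
  then show "y \<oplus> (x \<ominus> y) = x" using assms a_comm[of y "x \<ominus> y"] by simp
  show 2: "(x \<oplus> y) \<ominus> y = x" using assms by (simp add: a_minus_def a_assoc r_neg)
  then show "(y \<oplus> x) \<ominus> y = x" using assms a_comm[of x y] by simp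
qed

text \<open>Closure under negation comes for free, as \<open>- x = (- 1) x\<close>.\<close>

lemma submodule_iff:
  fixes M (structure)
  assumes "module R M"
  shows "submodule N R M \<longleftrightarrow> N \<subseteq> carrier M \<and> \<zero> \<in> N \<and>
    (\<forall>x\<in>N. \<forall>y\<in>N. x \<oplus> y \<in> N) \<and> (\<forall>r\<in>carrier R. \<forall>x\<in>N. r \<odot> x \<in> N)"
    (is "_ \<longleftrightarrow> ?P")
proof
  interpret module R M by fact
  show ?P if N: "submodule N R M"
    using submoduleE[OF N] subgroup.one_closed[OF submodule.axioms(1)[OF N]] by auto
  show "submodule N R M" if P: ?P
  proof (rule submoduleI)
    fix x assume "x \<in> N"
    with P have "x \<in> carrier M" by auto
    then have "\<ominus> x = (\<ominus>\<^bsub>R\<^esub> \<one>\<^bsub>R\<^esub>) \<odot> x" by (simp add: smult_l_minus)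
    then show "\<ominus> x \<in> N" using P \<open>x \<in> N\<close> by auto
  qed (use P in auto)
qed

lemma submoduleD:
  fixes M (structure)
  assumes "module R M" "submodule N R M"
  shows "N \<subseteq> carrier M" "\<zero> \<in> N" "\<And>x. x \<in> N \<Longrightarrow> x \<in> carrier M"
    "\<And>x y. x \<in> N \<Longrightarrow> y \<in> N \<Longrightarrow> x \<oplus> y \<in> N"
    "\<And>x y. x \<in> N \<Longrightarrow> y \<in> N \<Longrightarrow> x \<ominus> y \<in> N"
    "\<And>x. x \<in> N \<Longrightarrow> \<ominus> x \<in> N"
    "\<And>r x. r \<in> carrier R \<Longrightarrow> x \<in> N \<Longrightarrow> r \<odot> x \<in> N"
  using assms submodule_iff[OF assms(1), of N] module.submoduleE(3)[OF assms]
  by (auto simp: a_minus_def)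

lemma submodule_zero: "module R M \<Longrightarrow> submodule {\<zero>\<^bsub>M\<^esub>} R M"
proof -
  assume M: "module R M"
  then interpret module R M .
  show ?thesis by (simp add: submodule_iff[OF M])
qed

lemma submodule_carrier: "module R M \<Longrightarrow> submodule (carrier M) R M"
  by (rule module.carrier_is_submodule)

lemma submodule_Int:
  assumes "module R M" "submodule N R M" "submodule N' R M"
  shows "submodule (N \<inter> N') R M"
  using assms(2,3) by (auto simp: submodule_iff[OF assms(1)])

lemma mem_set_add: "x \<in> K <+>\<^bsub>M\<^esub> N \<longleftrightarrow> (\<exists>k\<in>K. \<exists>n\<in>N. x = k \<oplus>\<^bsub>M\<^esub> n)"
  by (auto simp: set_add_def')

lemma submodule_set_add:
  fixes M (structure)
  assumes "module R M" "submodule N R M" "submodule N' R M"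
  shows "submodule (N <+>\<^bsub>M\<^esub> N') R M"
proof -
  interpret module R M by fact
  note D = submoduleD[OF assms(1,2)] and D' = submoduleD[OF assms(1,3)]
  show ?thesis unfolding submodule_iff[OF assms(1)]
  proof (intro conjI ballI subsetI)
    show "x \<in> carrier M" if "x \<in> N <+>\<^bsub>M\<^esub> N'" for x
      using that by (auto simp: mem_set_add D(3) D'(3))
    show "\<zero> \<in> N <+>\<^bsub>M\<^esub> N'"
      unfolding mem_set_add using D(2) D'(2) M.l_zero[OF M.zero_closed] by force
    show "x \<oplus> y \<in> N <+>\<^bsub>M\<^esub> N'" if xy: "x \<in> N <+>\<^bsub>M\<^esub> N'" "y \<in> N <+>\<^bsub>M\<^esub> N'" for x y
    proof -
      obtain a b c d where e: "x = a \<oplus> b" "y = c \<oplus> d" "a \<in> N" "b \<in> N'" "c \<in> N" "d \<in> N'"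
        using xy by (auto simp: mem_set_add)
      then have "x \<oplus> y = (a \<oplus> c) \<oplus> (b \<oplus> d)"
        by (simp add: M.a_ac D(3) D'(3))
      then show ?thesis using e D(4) D'(4) unfolding mem_set_add by blast
    qed
    show "r \<odot> x \<in> N <+>\<^bsub>M\<^esub> N'" if xy: "r \<in> carrier R" "x \<in> N <+>\<^bsub>M\<^esub> N'" for r x
    proof -
      obtain a b where e: "x = a \<oplus> b" "a \<in> N" "b \<in> N'"
        using xy by (auto simp: mem_set_add)
      then have "r \<odot> x = r \<odot> a \<oplus> r \<odot> b"
        using xy(1) by (simp add: smult_r_distr D(3) D'(3))
      then show ?thesis using e D(7) D'(7) xy unfolding mem_set_add by blast
    qed
  qed
qed

lemma set_add_upper:
  fixes M (structure)
  assumes "module R M" "submodule N R M" "submodule N' R M"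
  shows "N \<subseteq> N <+>\<^bsub>M\<^esub> N'" "N' \<subseteq> N <+>\<^bsub>M\<^esub> N'"
proof -
  interpret module R M by fact
  note D = submoduleD[OF assms(1,2)] and D' = submoduleD[OF assms(1,3)]
  show "N \<subseteq> N <+>\<^bsub>M\<^esub> N'"
  proof
    fix x assume x: "x \<in> N"
    then have "x = x \<oplus> \<zero>" using D(3) by simp
    then show "x \<in> N <+>\<^bsub>M\<^esub> N'" unfolding mem_set_add using x D'(2) by blast
  qed
  show "N' \<subseteq> N <+>\<^bsub>M\<^esub> N'"
  proof
    fix x assume x: "x \<in> N'"
    then have "x = \<zero> \<oplus> x" using D'(3) by simp
    then show "x \<in> N <+>\<^bsub>M\<^esub> N'" unfolding mem_set_add using x D(2) by blast
  qed
qed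

lemma set_add_least:
  assumes "module R M" "submodule L R M" "N \<subseteq> L" "N' \<subseteq> L"
  shows "N <+>\<^bsub>M\<^esub> N' \<subseteq> L"
  using submoduleD(4)[OF assms(1,2)] subsetD[OF assms(3)] subsetD[OF assms(4)]
  by (auto simp: mem_set_add)

section \<open>Homomorphisms on submodules\<close>

abbreviation restr :: "('r, 'm) module \<Rightarrow> 'm set \<Rightarrow> ('r, 'm) module" (infixl "\<restriction>" 90)
  where "M \<restriction> Z \<equiv> M\<lparr>carrier := Z\<rparr>"

lemma module_restr: "module R M \<Longrightarrow> submodule Z R M \<Longrightarrow> module R (M \<restriction> Z)"
  by (rule submodule.submodule_is_module)

lemma mod_homD:
  assumes "g \<in> mod_hom R M M'"
  shows "\<And>x. x \<in> carrier M \<Longrightarrow> g x \<in> carrier M'"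
    "\<And>x y. x \<in> carrier M \<Longrightarrow> y \<in> carrier M \<Longrightarrow> g (x \<oplus>\<^bsub>M\<^esub> y) = g x \<oplus>\<^bsub>M'\<^esub> g y"
    "\<And>r x. r \<in> carrier R \<Longrightarrow> x \<in> carrier M \<Longrightarrow> g (r \<odot>\<^bsub>M\<^esub> x) = r \<odot>\<^bsub>M'\<^esub> g x"
  using assms by (auto simp: mod_hom_def)

lemma mod_hom_zero_minus:
  fixes M (structure)
  assumes "module R M" "module R M'" "g \<in> mod_hom R M M'"
  shows "g \<zero> = \<zero>\<^bsub>M'\<^esub>"
    "\<And>x. x \<in> carrier M \<Longrightarrow> g (\<ominus> x) = \<ominus>\<^bsub>M'\<^esub> g x"
    "\<And>x y. x \<in> carrier M \<Longrightarrow> y \<in> carrier M \<Longrightarrow> g (x \<ominus> y) = g x \<ominus>\<^bsub>M'\<^esub> g y"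
proof -
  interpret M: module R M by fact
  interpret M': module R M' by fact
  note g = mod_homD[OF assms(3)]
  have "\<zero> = \<zero>\<^bsub>R\<^esub> \<odot> \<zero>" by simp
  then have "g \<zero> = \<zero>\<^bsub>R\<^esub> \<odot>\<^bsub>M'\<^esub> g \<zero>"
    using g(3)[of "\<zero>\<^bsub>R\<^esub>" "\<zero>"] by simp
  then show "g \<zero> = \<zero>\<^bsub>M'\<^esub>" by (simp add: g(1))
  have m: "g (\<ominus> x) = \<ominus>\<^bsub>M'\<^esub> g x" if "x \<in> carrier M" for x
  proof -
    have "\<ominus> x = (\<ominus>\<^bsub>R\<^esub> \<one>\<^bsub>R\<^esub>) \<odot> x" using that by (simp add: M.smult_l_minus)
    then show ?thesis using that by (simp add: M'.smult_l_minus g)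
  qed
  then show "\<And>x. x \<in> carrier M \<Longrightarrow> g (\<ominus> x) = \<ominus>\<^bsub>M'\<^esub> g x" .
  show "g (x \<ominus> y) = g x \<ominus>\<^bsub>M'\<^esub> g y" if "x \<in> carrier M" "y \<in> carrier M" for x y
    using that by (simp add: a_minus_def g m)
qed

lemma mod_hom_on:
  fixes M (structure)
  assumes "module R M" "module R M'" "submodule Z R M" "g \<in> mod_hom R (M \<restriction> Z) M'"
  shows "\<And>x. x \<in> Z \<Longrightarrow> g x \<in> carrier M'"
    "\<And>x y. x \<in> Z \<Longrightarrow> y \<in> Z \<Longrightarrow> g (x \<oplus> y) = g x \<oplus>\<^bsub>M'\<^esub> g y"
    "\<And>r x. r \<in> carrier R \<Longrightarrow> x \<in> Z \<Longrightarrow> g (r \<odot> x) = r \<odot>\<^bsub>M'\<^esub> g x"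
    "g \<zero> = \<zero>\<^bsub>M'\<^esub>"
    "\<And>x. x \<in> Z \<Longrightarrow> g (\<ominus> x) = \<ominus>\<^bsub>M'\<^esub> g x"
    "\<And>x y. x \<in> Z \<Longrightarrow> y \<in> Z \<Longrightarrow> g (x \<ominus> y) = g x \<ominus>\<^bsub>M'\<^esub> g y"
proof -
  interpret M: module R M by fact
  interpret M': module R M' by fact
  note D = submoduleD[OF assms(1,3)]
  show 1: "\<And>x. x \<in> Z \<Longrightarrow> g x \<in> carrier M'"
    and 2: "\<And>x y. x \<in> Z \<Longrightarrow> y \<in> Z \<Longrightarrow> g (x \<oplus> y) = g x \<oplus>\<^bsub>M'\<^esub> g y"
    and 3: "\<And>r x. r \<in> carrier R \<Longrightarrow> x \<in> Z \<Longrightarrow> g (r \<odot> x) = r \<odot>\<^bsub>M'\<^esub> g x"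
    using mod_homD[OF assms(4)] by auto
  show "g \<zero> = \<zero>\<^bsub>M'\<^esub>"
    using mod_hom_zero_minus(1)[OF module_restr[OF assms(1,3)] assms(2,4)] by simp
  show m: "g (\<ominus> x) = \<ominus>\<^bsub>M'\<^esub> g x" if "x \<in> Z" for x
  proof -
    have "\<ominus> x = (\<ominus>\<^bsub>R\<^esub> \<one>\<^bsub>R\<^esub>) \<odot> x" using that by (simp add: M.smult_l_minus D(3))
    then show ?thesis using that by (simp add: M'.smult_l_minus 1 3)
  qed
  show "g (x \<ominus> y) = g x \<ominus>\<^bsub>M'\<^esub> g y" if "x \<in> Z" "y \<in> Z" for x y
    using that by (simp add: a_minus_def 2 m D(6))
qed

lemma submodule_image:
  assumes "module R M" "module R M'" "submodule Z R M" "g \<in> mod_hom R (M \<restriction> Z) M'"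
    "submodule N R M" "N \<subseteq> Z"
  shows "submodule (g ` N) R M'"
proof -
  note D = submoduleD[OF assms(1,5)] and g = mod_hom_on[OF assms(1-4)]
  note N = subsetD[OF assms(6)]
  have "\<zero>\<^bsub>M'\<^esub> \<in> g ` N" using g(4) D(2) by (metis imageI)
  moreover have "g x \<oplus>\<^bsub>M'\<^esub> g y \<in> g ` N" if "x \<in> N" "y \<in> N" for x y
    using that g(2)[of x y] D(4)[of x y] N by (metis imageI)
  moreover have "r \<odot>\<^bsub>M'\<^esub> g x \<in> g ` N" if "x \<in> N" "r \<in> carrier R" for r x
    using that g(3)[of r x] D(7)[of r x] N by (metis imageI)
  ultimately show ?thesis using g(1) N by (auto simp: submodule_iff[OF assms(2)])
qed

lemma submodule_preimage:
  assumes "module R M" "module R M'" "submodule Z R M" "g \<in> mod_hom R (M \<restriction> Z) M'"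
    "submodule N R M'"
  shows "submodule {x \<in> Z. g x \<in> N} R M"
proof -
  note D = submoduleD[OF assms(1,3)] and D' = submoduleD[OF assms(2,5)] and g = mod_hom_on[OF assms(1-4)]
  show ?thesis
    by (auto simp: submodule_iff[OF assms(1)] g D' D)
qed

lemma mod_hom_restrict:
  "g \<in> mod_hom R (M \<restriction> Z) M' \<Longrightarrow> N \<subseteq> Z \<Longrightarrow> g \<in> mod_hom R (M \<restriction> N) M'"
  by (auto simp: mod_hom_def subset_iff Pi_iff)

lemma mod_hom_restrict_full:
  "g \<in> mod_hom R M M' \<Longrightarrow> N \<subseteq> carrier M \<Longrightarrow> g \<in> mod_hom R (M \<restriction> N) M'"
  by (auto simp: mod_hom_def subset_iff Pi_iff)

lemma mod_hom_id: "N \<subseteq> carrier M \<Longrightarrow> (\<lambda>x. x) \<in> mod_hom R (M \<restriction> N) M"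
  by (auto simp: mod_hom_def)

section \<open>Relative length\<close>

text \<open>
  The length of \<open>Z / K\<close>. Taking chains in the interval from \<open>K\<close> to \<open>Z\<close> keeps the lengths of iterated subquotients
  inside one module.
\<close>

definition rlen :: "'r ring \<Rightarrow> ('r, 'm) module \<Rightarrow> 'm set \<Rightarrow> 'm set \<Rightarrow> enat"
  where "rlen R M K Z =
    (SUP n \<in> {n :: nat. \<exists>N. (\<forall>k\<le>n. submodule (N k) R M \<and> K \<subseteq> N k \<and> N k \<subseteq> Z) \<and>
       (\<forall>k<n. N k \<subset> N (Suc k))}. enat n)"

lemma rlen_leI:
  assumes "\<And>n N. (\<And>k. k \<le> n \<Longrightarrow> submodule (N k) R M \<and> K \<subseteq> N k \<and> N k \<subseteq> Z) \<Longrightarrow>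
    (\<And>k. k < n \<Longrightarrow> N k \<subset> N (Suc k)) \<Longrightarrow> enat n \<le> b"
  shows "rlen R M K Z \<le> b"
  unfolding rlen_def
proof (rule SUP_least, clarify)
  fix n N assume "\<forall>k\<le>n. submodule (N k) R M \<and> K \<subseteq> N k \<and> N k \<subseteq> Z" "\<forall>k<n. N k \<subset> N (Suc k)"
  then show "enat n \<le> b" by (intro assms[of n N]) auto
qed

lemma le_rlenI:
  assumes "\<And>k. k \<le> n \<Longrightarrow> submodule (N k) R M \<and> K \<subseteq> N k \<and> N k \<subseteq> Z"
    "\<And>k. k < n \<Longrightarrow> N k \<subset> N (Suc k)"
  shows "enat n \<le> rlen R M K Z"
  unfolding rlen_def
proof (rule SUP_upper2[where i=n])
  show "n \<in> {n. \<exists>N. (\<forall>k\<le>n. submodule (N k) R M \<and> K \<subseteq> N k \<and> N k \<subseteq> Z) \<and> (\<forall>k<n. N k \<subset> N (Suc k))}"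
    by (rule CollectI, rule exI[of _ N]) (simp add: assms)
qed simp

text \<open>A chain of length at least \<open>n\<close> can be cut off after \<open>n\<close> steps; this also covers an infinite supremum.\<close>

lemma rlen_chain:
  assumes "submodule K R M" "K \<subseteq> Z" "enat n \<le> rlen R M K Z"
  obtains N where "\<And>k. k \<le> n \<Longrightarrow> submodule (N k) R M \<and> K \<subseteq> N k \<and> N k \<subseteq> Z"
    "\<And>k. k < n \<Longrightarrow> N k \<subset> N (Suc k)"
proof -
  let ?S = "{n :: nat. \<exists>N. (\<forall>k\<le>n. submodule (N k) R M \<and> K \<subseteq> N k \<and> N k \<subseteq> Z) \<and>
       (\<forall>k<n. N k \<subset> N (Suc k))}"
  have "\<exists>m\<in>?S. n \<le> m"
  proof (cases n)
    case 0
    then show ?thesis using assms by (intro bexI[of _ 0]) (auto intro!: exI[of _ "\<lambda>_. K"])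
  next
    case (Suc n')
    then have "enat n' < rlen R M K Z" using assms(3)
      by (metis Suc_ile_eq)
    then obtain m where "m \<in> ?S" "enat n' < enat m" unfolding rlen_def less_SUP_iff by blast
    then show ?thesis using Suc by (intro bexI[of _ m]) auto
  qed
  then obtain m N where "n \<le> m" "\<forall>k\<le>m. submodule (N k) R M \<and> K \<subseteq> N k \<and> N k \<subseteq> Z"
    "\<forall>k<m. N k \<subset> N (Suc k)" by blast
  then show ?thesis using that[of N] by simp
qed

lemma rlen_le_map:
  assumes "\<And>N. submodule N R M \<Longrightarrow> K \<subseteq> N \<Longrightarrow> N \<subseteq> Z \<Longrightarrow>
      submodule (\<phi> N) S M' \<and> K' \<subseteq> \<phi> N \<and> \<phi> N \<subseteq> Z'"
    and "\<And>N N'. submodule N R M \<Longrightarrow> K \<subseteq> N \<Longrightarrow> submodule N' R M \<Longrightarrow> N' \<subseteq> Z \<Longrightarrow> N \<subset> N' \<Longrightarrow>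
      \<phi> N \<subset> \<phi> N'"
  shows "rlen R M K Z \<le> rlen S M' K' Z'"
proof (rule rlen_leI)
  fix n N assume 1: "\<And>k. k \<le> n \<Longrightarrow> submodule (N k) R M \<and> K \<subseteq> N k \<and> N k \<subseteq> Z"
    and 2: "\<And>k. k < n \<Longrightarrow> N k \<subset> N (Suc k)"
  show "enat n \<le> rlen S M' K' Z'"
  proof (rule le_rlenI[where N="\<lambda>k. \<phi> (N k)"])
    show "\<phi> (N k) \<subset> \<phi> (N (Suc k))" if "k < n" for k
      using 1[of k] 1[of "Suc k"] 2[of k] that by (intro assms(2)) auto
  qed (use 1 assms(1) in auto)
qed

lemma rlen_mono:
  "K' \<subseteq> K \<Longrightarrow> Z \<subseteq> Z' \<Longrightarrow> rlen R M K Z \<le> rlen R M K' Z'"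
  by (rule rlen_le_map[where \<phi>="\<lambda>N. N"]) auto

lemma rlen_self: "rlen R M K K = 0"
proof -
  have "rlen R M K K \<le> 0"
  proof (rule rlen_leI)
    fix n N assume 1: "\<And>k. k \<le> n \<Longrightarrow> submodule (N k) R M \<and> K \<subseteq> N k \<and> N k \<subseteq> K"
      and 2: "\<And>k. k < n \<Longrightarrow> N k \<subset> N (Suc k)"
    have "n = 0"
    proof (rule ccontr)
      assume "n \<noteq> 0"
      with 1[of 0] 1[of 1] 2[of 0] show False by auto
    qed
    then show "enat n \<le> 0" by (simp add: zero_enat_def)
  qed
  then show ?thesis by simp
qed

lemma rlen_eq_0D:
  assumes "submodule K R M" "submodule Z R M" "K \<subseteq> Z" "rlen R M K Z = 0"
  shows "K = Z"
proof (rule ccontr)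
  assume "K \<noteq> Z"
  then have "enat 1 \<le> rlen R M K Z"
    using assms by (intro le_rlenI[where N="\<lambda>k. if k = 0 then K else Z"]) auto
  with assms(4) show False by (simp add: one_enat_def zero_enat_def)
qed

text \<open>A strict step \<open>N < N'\<close> between \<open>K\<close> and \<open>Z\<close> stays strict in \<open>[K, L]\<close> or in \<open>[L, Z]\<close>, by the
  modular law; so a chain splits into a chain below \<open>L\<close> and one above \<open>L\<close>.\<close>

lemma modular_step:
  fixes M (structure)
  assumes M: "module R M" and N: "submodule N R M" "submodule N' R M" "submodule L R M"
    and lt: "N \<subset> N'" and eq: "N \<inter> L = N' \<inter> L"
  shows "N <+>\<^bsub>M\<^esub> L \<subset> N' <+>\<^bsub>M\<^esub> L"
proof
  interpret module R M by fact
  note D = submoduleD[OF M N(1)] and D' = submoduleD[OF M N(2)] and DL = submoduleD[OF M N(3)]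
  show "N <+>\<^bsub>M\<^esub> L \<subseteq> N' <+>\<^bsub>M\<^esub> L" using lt unfolding mem_set_add subset_iff by blast
  show "N <+>\<^bsub>M\<^esub> L \<noteq> N' <+>\<^bsub>M\<^esub> L"
  proof
    assume e: "N <+>\<^bsub>M\<^esub> L = N' <+>\<^bsub>M\<^esub> L"
    obtain x where x: "x \<in> N'" "x \<notin> N" using lt by auto
    have "x \<in> N <+>\<^bsub>M\<^esub> L" using e set_add_upper[OF M N(2,3)] x by auto
    then obtain y l where yl: "y \<in> N" "l \<in> L" "x = y \<oplus> l" by (auto simp: mem_set_add)
    have "y \<in> N'" using yl lt by auto
    then have "x \<ominus> y \<in> N'" using x D'(5) by blast
    moreover have "x \<ominus> y = l"
      using D(3)[OF yl(1)] DL(3)[OF yl(2)] unfolding yl(3)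
      by (simp add: M.minus_cancel)
    ultimately have "l \<in> N" using eq yl by auto
    then show False using yl x D(4) by auto
  qed
qed

lemma rlen_add_ge:
  assumes K: "submodule K R M" and L: "submodule L R M" "K \<subseteq> L" "L \<subseteq> Z"
  shows "rlen R M K L + rlen R M L Z \<le> rlen R M K Z"
proof (cases "rlen R M K L = \<infinity> \<or> rlen R M L Z = \<infinity>")
  case True
  then show ?thesis using rlen_mono[of K K L Z R M] rlen_mono[of K L Z Z R M] L by auto
next
  case False
  then obtain a b where a: "rlen R M K L = enat a" and b: "rlen R M L Z = enat b" by auto
  obtain X where X: "\<And>k. k \<le> a \<Longrightarrow> submodule (X k) R M \<and> K \<subseteq> X k \<and> X k \<subseteq> L"
      "\<And>k. k < a \<Longrightarrow> X k \<subset> X (Suc k)"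
    using rlen_chain[OF K L(2), of a] a by (metis order_refl)
  obtain Y where Y: "\<And>k. k \<le> b \<Longrightarrow> submodule (Y k) R M \<and> L \<subseteq> Y k \<and> Y k \<subseteq> Z"
      "\<And>k. k < b \<Longrightarrow> Y k \<subset> Y (Suc k)"
    using rlen_chain[OF L(1,3), of b] b by (metis order_refl)
  have "enat (a + b) \<le> rlen R M K Z"
  proof (rule le_rlenI[where N="\<lambda>k. if k \<le> a then X k else Y (k - a)"])
    fix k assume k: "k \<le> a + b"
    show "submodule (if k \<le> a then X k else Y (k - a)) R M \<and> K \<subseteq> (if k \<le> a then X k else Y (k - a)) \<and>
      (if k \<le> a then X k else Y (k - a)) \<subseteq> Z"
    proof (cases "k \<le> a")
      case True then show ?thesis using X(1)[OF True] L by auto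
    next
      case False
      then have "k - a \<le> b" using k by simp
      then show ?thesis using Y(1)[of "k - a"] False L by auto
    qed
  next
    fix k assume k: "k < a + b"
    consider "Suc k \<le> a" | "k = a" | "a < k" by linarith
    then show "(if k \<le> a then X k else Y (k - a)) \<subset> (if Suc k \<le> a then X (Suc k) else Y (Suc k - a))"
    proof cases
      case 1 then show ?thesis using X(2)[of k] by auto
    next
      case 2 then show ?thesis using X(1)[of a] Y(1)[of 0] Y(2)[of 0] k by auto
    next
      case 3 then show ?thesis using Y(2)[of "k - a"] k by (auto simp: Suc_diff_le)
    qed
  qed
  then show ?thesis using a b by simp
qed

lemma rlen_add_le:
  assumes M: "module R M" and K: "submodule K R M" and L: "submodule L R M" "K \<subseteq> L" "L \<subseteq> Z"
    and Z: "submodule Z R M"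
  shows "rlen R M K Z \<le> rlen R M K L + rlen R M L Z"
proof (rule rlen_leI)
  fix n N assume 1: "\<And>k. k \<le> n \<Longrightarrow> submodule (N k) R M \<and> K \<subseteq> N k \<and> N k \<subseteq> Z"
    and 2: "\<And>k. k < n \<Longrightarrow> N k \<subset> N (Suc k)"
  have step: "rlen R M A B + 1 \<le> rlen R M A C"
    if "submodule A R M" "A \<subseteq> B" "submodule B R M" "submodule C R M" "B \<subset> C" for A B C
  proof -
    have "rlen R M B C \<noteq> 0" using rlen_eq_0D[of B R M C] that by auto
    then have "1 \<le> rlen R M B C" by (metis ileI1 not_gr_zero one_eSuc)
    from add_left_mono[OF this] have "rlen R M A B + 1 \<le> rlen R M A B + rlen R M B C" .
    also have "\<dots> \<le> rlen R M A C" using that by (intro rlen_add_ge) auto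
    finally show ?thesis .
  qed
  have "m \<le> n \<Longrightarrow> enat m \<le> rlen R M K (N m \<inter> L) + rlen R M L (N m <+>\<^bsub>M\<^esub> L)" for m
  proof (induction m)
    case 0
    then show ?case by (simp add: zero_enat_def[symmetric])
  next
    case (Suc m)
    have sub: "submodule (N m) R M" "submodule (N (Suc m)) R M" "K \<subseteq> N m"
      using 1[of m] 1[of "Suc m"] Suc.prems by auto
    have lt: "N m \<subset> N (Suc m)" using 2 Suc.prems by auto
    have KN: "rlen R M K (N m \<inter> L) \<le> rlen R M K (N (Suc m) \<inter> L)"
      using lt by (intro rlen_mono) auto
    have LN: "rlen R M L (N m <+>\<^bsub>M\<^esub> L) \<le> rlen R M L (N (Suc m) <+>\<^bsub>M\<^esub> L)"
    proof (rule rlen_mono)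
      show "N m <+>\<^bsub>M\<^esub> L \<subseteq> N (Suc m) <+>\<^bsub>M\<^esub> L" using lt unfolding mem_set_add subset_iff by blast
    qed simp
    have "rlen R M K (N m \<inter> L) + rlen R M L (N m <+>\<^bsub>M\<^esub> L) + 1
      \<le> rlen R M K (N (Suc m) \<inter> L) + rlen R M L (N (Suc m) <+>\<^bsub>M\<^esub> L)"
    proof (cases "N m \<inter> L = N (Suc m) \<inter> L")
      case True
      have "rlen R M L (N m <+>\<^bsub>M\<^esub> L) + 1 \<le> rlen R M L (N (Suc m) <+>\<^bsub>M\<^esub> L)"
        using modular_step[OF M sub(1,2) L(1) lt True] set_add_upper(2)[OF M sub(1) L(1)]
        by (intro step L submodule_set_add[OF M] sub)
      from add_mono[OF KN this] show ?thesis by (simp only: add.assoc)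
    next
      case False
      have "rlen R M K (N m \<inter> L) + 1 \<le> rlen R M K (N (Suc m) \<inter> L)"
        using False lt sub L by (intro step K submodule_Int[OF M]) auto
      from add_mono[OF this LN] show ?thesis by (simp only: add.assoc add.commute[of 1])
    qed
    moreover have "enat (Suc m) = enat m + 1" by (simp add: one_enat_def)
    moreover have "enat m + 1 \<le> rlen R M K (N m \<inter> L) + rlen R M L (N m <+>\<^bsub>M\<^esub> L) + 1"
      using Suc by (intro add_right_mono) simp
    ultimately show ?case by (simp only: order_trans)
  qed
  from this[of n] have "enat n \<le> rlen R M K (N n \<inter> L) + rlen R M L (N n <+>\<^bsub>M\<^esub> L)" by simp
  also have "\<dots> \<le> rlen R M K L + rlen R M L Z"
    using 1[of n] L Z by (intro add_mono rlen_mono set_add_least[OF M]) auto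
  finally show "enat n \<le> rlen R M K L + rlen R M L Z" .
qed

lemma rlen_add:
  assumes "module R M" "submodule K R M" "submodule L R M" "submodule Z R M" "K \<subseteq> L" "L \<subseteq> Z"
  shows "rlen R M K Z = rlen R M K L + rlen R M L Z"
  using rlen_add_le[OF assms(1,2,3,5,6,4)] rlen_add_ge[OF assms(2,3,5,6)] by (rule antisym)

section \<open>Isomorphic subquotients\<close>

text \<open>
  The map \<open>g\<close> induces an isomorphism \<open>Z / K \<cong> Z' / K'\<close>, which matches the submodules between \<open>K\<close> and \<open>Z\<close> with
  those between \<open>K'\<close> and \<open>Z'\<close>. That \<open>g\<close> is only surjective modulo \<open>K'\<close> makes inclusions such as that of
  \<open>X\<close> in \<open>N + X\<close> instances, as in the second isomorphism theorem.
\<close>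

locale subquot_iso =
  fixes R :: "'r ring" and M :: "('r, 'm) module" and K Z :: "'m set"
    and M' :: "('r, 'n) module" and K' Z' :: "'n set" and g :: "'m \<Rightarrow> 'n"
  assumes M: "module R M" and M': "module R M'"
    and sK: "submodule K R M" and sZ: "submodule Z R M" and KZ: "K \<subseteq> Z"
    and sK': "submodule K' R M'" and sZ': "submodule Z' R M'" and KZ': "K' \<subseteq> Z'"
    and hom: "g \<in> mod_hom R (M \<restriction> Z) M'"
    and into: "\<And>x. x \<in> Z \<Longrightarrow> g x \<in> Z'"
    and ker: "\<And>x. x \<in> Z \<Longrightarrow> g x \<in> K' \<longleftrightarrow> x \<in> K"
    and onto: "\<And>y. y \<in> Z' \<Longrightarrow> \<exists>x\<in>Z. \<exists>k\<in>K'. y = g x \<oplus>\<^bsub>M'\<^esub> k"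
begin

interpretation M: module R M by (rule M)
interpretation M': module R M' by (rule M')

definition "pull N = {x \<in> Z. g x \<in> N}"
definition "push N = g ` N <+>\<^bsub>M'\<^esub> K'"

lemmas DZ = submoduleD[OF M sZ] and DK' = submoduleD[OF M' sK'] and DZ' = submoduleD[OF M' sZ']
lemmas gD = mod_hom_on[OF M M' sZ hom]

lemma pull_submodule: "submodule N R M' \<Longrightarrow> submodule (pull N) R M"
  unfolding pull_def by (rule submodule_preimage[OF M M' sZ hom])

lemma pull_bounds: "K' \<subseteq> N \<Longrightarrow> K \<subseteq> pull N" "pull N \<subseteq> Z"
  using ker KZ unfolding pull_def by auto

lemma push_submodule: "submodule N R M \<Longrightarrow> N \<subseteq> Z \<Longrightarrow> submodule (push N) R M'"
  unfolding push_def by (intro submodule_set_add[OF M'] submodule_image[OF M M' sZ hom] sK')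

lemma push_bounds:
  assumes "submodule N R M" "N \<subseteq> Z"
  shows "K' \<subseteq> push N" "push N \<subseteq> Z'" "x \<in> N \<Longrightarrow> g x \<in> push N"
proof -
  note s = submodule_image[OF M M' sZ hom assms]
  show "K' \<subseteq> push N" "x \<in> N \<Longrightarrow> g x \<in> push N"
    using set_add_upper[OF M' s sK'] by (auto simp: push_def)
  show "push N \<subseteq> Z'" unfolding push_def
    using assms into KZ' by (intro set_add_least[OF M' sZ']) auto
qed

lemma push_ker:
  assumes N: "submodule N R M" "K \<subseteq> N" "N \<subseteq> Z" and x: "x \<in> Z" "g x \<in> push N"
  shows "x \<in> N"
proof -
  note DN = submoduleD[OF M N(1)]
  obtain n k where nk: "n \<in> N" "k \<in> K'" "g x = g n \<oplus>\<^bsub>M'\<^esub> k"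
    using x by (auto simp: push_def mem_set_add)
  have n: "n \<in> Z" using nk N by auto
  have "g (x \<ominus>\<^bsub>M\<^esub> n) = g x \<ominus>\<^bsub>M'\<^esub> g n" using gD(6)[OF x(1) n] .
  also have "\<dots> = k"
    using gD(1)[OF n] DK'(3)[OF nk(2)] unfolding nk(3) by (simp add: M'.minus_cancel)
  finally have "x \<ominus>\<^bsub>M\<^esub> n \<in> K" using ker[of "x \<ominus>\<^bsub>M\<^esub> n"] DZ(5)[OF x(1) n] nk by auto
  then have "(x \<ominus>\<^bsub>M\<^esub> n) \<oplus>\<^bsub>M\<^esub> n \<in> N" using N nk DN(4) by auto
  moreover have "(x \<ominus>\<^bsub>M\<^esub> n) \<oplus>\<^bsub>M\<^esub> n = x"
    using DZ(3)[OF x(1)] DZ(3)[OF n] by (simp add: M.minus_cancel)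
  ultimately show ?thesis by simp
qed

lemma pull_onto:
  assumes N: "submodule N R M'" "K' \<subseteq> N" "N \<subseteq> Z'" and y: "y \<in> N"
  shows "\<exists>x\<in>pull N. \<exists>k\<in>K'. y = g x \<oplus>\<^bsub>M'\<^esub> k"
proof -
  note DN = submoduleD[OF M' N(1)]
  obtain x k where xk: "x \<in> Z" "k \<in> K'" "y = g x \<oplus>\<^bsub>M'\<^esub> k" using onto y N by blast
  have "g x = y \<ominus>\<^bsub>M'\<^esub> k"
    using gD(1)[OF xk(1)] DK'(3)[OF xk(2)] unfolding xk(3)
    by (simp add: M'.minus_cancel)
  moreover have "k \<in> N" using xk N by auto
  ultimately have "g x \<in> N" using DN(5)[OF y] by simp
  then show ?thesis using xk unfolding pull_def by blast
qed

lemma iso_pull: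
  assumes "submodule N\<^sub>1 R M'" "submodule N\<^sub>2 R M'" "K' \<subseteq> N\<^sub>1" "N\<^sub>1 \<subseteq> N\<^sub>2" "N\<^sub>2 \<subseteq> Z'"
  shows "subquot_iso R M (pull N\<^sub>1) (pull N\<^sub>2) M' N\<^sub>1 N\<^sub>2 g"
proof (intro subquot_iso.intro M M' pull_submodule assms)
  show "pull N\<^sub>1 \<subseteq> pull N\<^sub>2" using assms by (auto simp: pull_def)
  show "g \<in> mod_hom R (M \<restriction> pull N\<^sub>2) M'" using mod_hom_restrict[OF hom pull_bounds(2)] .
  show "\<exists>x\<in>pull N\<^sub>2. \<exists>k\<in>N\<^sub>1. y = g x \<oplus>\<^bsub>M'\<^esub> k" if "y \<in> N\<^sub>2" for y
    using pull_onto[OF assms(2) _ _ that] assms by blast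
qed (auto simp: pull_def)

lemma iso_push:
  assumes N: "submodule N\<^sub>1 R M" "submodule N\<^sub>2 R M" "K \<subseteq> N\<^sub>1" "N\<^sub>1 \<subseteq> N\<^sub>2" "N\<^sub>2 \<subseteq> Z"
  shows "subquot_iso R M N\<^sub>1 N\<^sub>2 M' (push N\<^sub>1) (push N\<^sub>2) g"
proof -
  have N1: "N\<^sub>1 \<subseteq> Z" using N by auto
  show ?thesis
  proof (intro subquot_iso.intro M M' push_submodule assms N1)
    show "push N\<^sub>1 \<subseteq> push N\<^sub>2" using N unfolding push_def mem_set_add subset_iff by blast
    show "g \<in> mod_hom R (M \<restriction> N\<^sub>2) M'" using mod_hom_restrict[OF hom N(5)] .
    show "g x \<in> push N\<^sub>2" if "x \<in> N\<^sub>2" for x using push_bounds(3)[OF N(2,5) that] .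
    show "g x \<in> push N\<^sub>1 \<longleftrightarrow> x \<in> N\<^sub>1" if "x \<in> N\<^sub>2" for x
      using push_ker[OF N(1,3) N1] push_bounds(3)[OF N(1) N1] that N by blast
    show "\<exists>x\<in>N\<^sub>2. \<exists>k\<in>push N\<^sub>1. y = g x \<oplus>\<^bsub>M'\<^esub> k" if "y \<in> push N\<^sub>2" for y
      using that push_bounds(1)[OF N(1) N1] unfolding push_def[of N\<^sub>2] mem_set_add by blast
  qed
qed

lemma rlen_eq: "rlen R M K Z = rlen R M' K' Z'"
proof (rule antisym)
  show "rlen R M K Z \<le> rlen R M' K' Z'"
  proof (rule rlen_le_map[where \<phi>=push])
    fix N N' assume N: "submodule N R M" "K \<subseteq> N" "submodule N' R M" "N' \<subseteq> Z" "N \<subset> N'"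
    then interpret S: subquot_iso R M N N' M' "push N" "push N'" g by (intro iso_push) auto
    show "push N \<subset> push N'" using S.KZ' N push_ker[OF N(1,2)] push_bounds(3)[OF N(3,4)] by blast
  next
    fix N assume "submodule N R M" "K \<subseteq> N" "N \<subseteq> Z"
    then show "submodule (push N) R M' \<and> K' \<subseteq> push N \<and> push N \<subseteq> Z'"
      using push_submodule push_bounds(1,2) by simp
  qed
  show "rlen R M' K' Z' \<le> rlen R M K Z"
  proof (rule rlen_le_map[where \<phi>=pull])
    fix N N' assume N: "submodule N R M'" "K' \<subseteq> N" "submodule N' R M'" "N' \<subseteq> Z'" "N \<subset> N'"
    then interpret S: subquot_iso R M "pull N" "pull N'" M' N N' g by (intro iso_pull) auto
    obtain y where y: "y \<in> N'" "y \<notin> N" using N by auto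
    then obtain x k where "x \<in> pull N'" "k \<in> N" "y = g x \<oplus>\<^bsub>M'\<^esub> k" using S.onto by blast
    then have "x \<notin> pull N" using y submoduleD(4)[OF M' N(1)] S.ker by blast
    then show "pull N \<subset> pull N'" using \<open>x \<in> pull N'\<close> S.KZ by auto
  next
    fix N assume "submodule N R M'" "K' \<subseteq> N" "N \<subseteq> Z'"
    then show "submodule (pull N) R M \<and> K \<subseteq> pull N \<and> pull N \<subseteq> Z"
      using pull_submodule pull_bounds by simp
  qed
qed

end

text \<open>For a homomorphism \<open>h\<close>, \<open>Z / K\<close> is an extension of \<open>h Z / h K\<close> by the part of \<open>Z / K\<close> that \<open>h\<close> kills.\<close>

lemma rlen_hom:
  assumes M: "module R M" and M': "module R M'" and K: "submodule K R M" and Z: "submodule Z R M"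
    and KZ: "K \<subseteq> Z" and h: "h \<in> mod_hom R (M \<restriction> Z) M'"
  shows "rlen R M K Z = rlen R M' (h ` K) (h ` Z) +
    rlen R M {x \<in> K. h x = \<zero>\<^bsub>M'\<^esub>} {x \<in> Z. h x = \<zero>\<^bsub>M'\<^esub>}"
proof -
  interpret M: module R M by fact
  interpret M': module R M' by fact
  note DK = submoduleD[OF M K] and DZ = submoduleD[OF M Z] and hD = mod_hom_on[OF M M' Z h]
  define Z0 where "Z0 = {x \<in> Z. h x = \<zero>\<^bsub>M'\<^esub>}"
  have sZ0: "submodule Z0 R M"
    using submodule_preimage[OF M M' Z h submodule_zero[OF M']] by (simp add: Z0_def)
  have K0: "{x \<in> K. h x = \<zero>\<^bsub>M'\<^esub>} = K \<inter> Z0" using KZ by (auto simp: Z0_def)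
  have s: "submodule (K <+>\<^bsub>M\<^esub> Z0) R M" using submodule_set_add[OF M K sZ0] .
  have up: "K \<subseteq> K <+>\<^bsub>M\<^esub> Z0" "Z0 \<subseteq> K <+>\<^bsub>M\<^esub> Z0" "K <+>\<^bsub>M\<^esub> Z0 \<subseteq> Z"
    using set_add_upper[OF M K sZ0] set_add_least[OF M Z KZ, of Z0] by (auto simp: Z0_def)
  interpret A: subquot_iso R M "K <+>\<^bsub>M\<^esub> Z0" Z M' "h ` K" "h ` Z" h
  proof (intro subquot_iso.intro M M' s Z up h submodule_image[OF M M' Z h] K KZ order_refl)
    show "h ` K \<subseteq> h ` Z" using KZ by auto
    show "h x \<in> h ` K \<longleftrightarrow> x \<in> K <+>\<^bsub>M\<^esub> Z0" if x: "x \<in> Z" for x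
    proof
      assume "h x \<in> h ` K"
      then obtain k where k: "k \<in> K" "h x = h k" by auto
      then have kZ: "k \<in> Z" using KZ by auto
      have "h (x \<ominus>\<^bsub>M\<^esub> k) = \<zero>\<^bsub>M'\<^esub>"
        using hD(6)[OF x kZ] k hD(1)[OF kZ] by (simp add: a_minus_def M'.r_neg)
      then have "x \<ominus>\<^bsub>M\<^esub> k \<in> Z0" using DZ(5)[OF x kZ] by (simp add: Z0_def)
      moreover have "x = k \<oplus>\<^bsub>M\<^esub> (x \<ominus>\<^bsub>M\<^esub> k)"
        using DZ(3)[OF x] DZ(3)[OF kZ] by (simp add: M.minus_cancel)
      ultimately show "x \<in> K <+>\<^bsub>M\<^esub> Z0" using k unfolding mem_set_add by blast
    next
      assume "x \<in> K <+>\<^bsub>M\<^esub> Z0"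
      then obtain k z where kz: "k \<in> K" "z \<in> Z" "h z = \<zero>\<^bsub>M'\<^esub>" "x = k \<oplus>\<^bsub>M\<^esub> z"
        by (auto simp: mem_set_add Z0_def)
      then have "h x = h k" using KZ hD(1)[of k] hD(2)[of k z] by auto
      then show "h x \<in> h ` K" using kz by auto
    qed
    show "\<exists>x\<in>Z. \<exists>k\<in>h ` K. y = h x \<oplus>\<^bsub>M'\<^esub> k" if y: "y \<in> h ` Z" for y
    proof -
      obtain x where x: "x \<in> Z" "y = h x" using y by auto
      have "h \<zero>\<^bsub>M\<^esub> \<in> h ` K" using DK(2) by blast
      moreover have "y = h x \<oplus>\<^bsub>M'\<^esub> h \<zero>\<^bsub>M\<^esub>" using x hD(1)[OF x(1)] hD(4) by simp
      ultimately show ?thesis using x(1) by blast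
    qed
  qed auto
  interpret B: subquot_iso R M "K \<inter> Z0" Z0 M K "K <+>\<^bsub>M\<^esub> Z0" "\<lambda>x. x"
  proof (intro subquot_iso.intro M K s sZ0 up submodule_Int[OF M K sZ0] mod_hom_id)
    show "Z0 \<subseteq> carrier M" using submoduleD(1)[OF M sZ0] .
    show "\<exists>x\<in>Z0. \<exists>k\<in>K. y = x \<oplus>\<^bsub>M\<^esub> k" if "y \<in> K <+>\<^bsub>M\<^esub> Z0" for y
      using that unfolding mem_set_add by (metis DK(3) submoduleD(3)[OF M sZ0] M.a_comm)
    show "x \<in> K <+>\<^bsub>M\<^esub> Z0" if "x \<in> Z0" for x using that up by auto
  qed auto
  show ?thesis
    using rlen_add[OF M K s Z up(1,3)] A.rlen_eq B.rlen_eq unfolding K0 Z0_def[symmetric]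
    by (simp add: add.commute)
qed


section \<open>Torsion and finite length\<close>

definition torsion_over :: "'r ring \<Rightarrow> 'r \<Rightarrow> ('r, 'm) module \<Rightarrow> 'm set \<Rightarrow> 'm set \<Rightarrow> bool"
  where "torsion_over R s M K Z \<longleftrightarrow> (\<forall>x\<in>Z. \<exists>k::nat. (s [^]\<^bsub>R\<^esub> k) \<odot>\<^bsub>M\<^esub> x \<in> K)"

text \<open>
  A substitute for being noetherian that is inherited by subquotients by its very form and
  that can be checked for finitely generated modules by adding one generator at a time.
\<close>

definition torsion_finite :: "'r ring \<Rightarrow> 'r \<Rightarrow> ('r, 'm) module \<Rightarrow> 'm set \<Rightarrow> 'm set \<Rightarrow> bool"
  where "torsion_finite R s M K Z \<longleftrightarrow>
    (\<forall>N N'. submodule N R M \<and> submodule N' R M \<and> K \<subseteq> N \<and> N \<subseteq> N' \<and> N' \<subseteq> Z \<and>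
       torsion_over R s M N N' \<longrightarrow> rlen R M N N' \<noteq> \<infinity>)"

lemma torsion_finiteD:
  assumes "torsion_finite R s M K Z" "submodule N R M" "submodule N' R M" "K \<subseteq> N" "N \<subseteq> N'" "N' \<subseteq> Z"
    "torsion_over R s M N N'"
  shows "rlen R M N N' \<noteq> \<infinity>"
  using assms unfolding torsion_finite_def by blast

lemma torsion_finite_mono:
  "torsion_finite R s M K Z \<Longrightarrow> K \<subseteq> K' \<Longrightarrow> Z' \<subseteq> Z \<Longrightarrow> torsion_finite R s M K' Z'"
  unfolding torsion_finite_def by (meson order_trans)

context subquot_iso
begin

lemma torsion_over_iff:
  assumes s: "s \<in> carrier R"
  shows "torsion_over R s M K Z \<longleftrightarrow> torsion_over R s M' K' Z'"
proof -
  interpret M: module R M by (rule M)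
  interpret M': module R M' by (rule M')
  have p: "s [^]\<^bsub>R\<^esub> (k::nat) \<in> carrier R" for k using s by simp
  have 1: "(s [^]\<^bsub>R\<^esub> (k::nat)) \<odot>\<^bsub>M\<^esub> x \<in> K \<longleftrightarrow> (s [^]\<^bsub>R\<^esub> k) \<odot>\<^bsub>M'\<^esub> g x \<in> K'" if "x \<in> Z" for x k
    using ker[OF DZ(7)[OF p that]] gD(3)[OF p that] by simp
  show ?thesis
  proof
    assume t: "torsion_over R s M K Z"
    show "torsion_over R s M' K' Z'" unfolding torsion_over_def
    proof
      fix y assume "y \<in> Z'"
      then obtain x k where x: "x \<in> Z" "k \<in> K'" "y = g x \<oplus>\<^bsub>M'\<^esub> k" using onto by blast
      obtain n :: nat where "(s [^]\<^bsub>R\<^esub> n) \<odot>\<^bsub>M\<^esub> x \<in> K" using t x(1) unfolding torsion_over_def by blast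
      then have "(s [^]\<^bsub>R\<^esub> n) \<odot>\<^bsub>M'\<^esub> g x \<in> K'" using 1[OF x(1)] by simp
      moreover have "(s [^]\<^bsub>R\<^esub> n) \<odot>\<^bsub>M'\<^esub> y = (s [^]\<^bsub>R\<^esub> n) \<odot>\<^bsub>M'\<^esub> g x \<oplus>\<^bsub>M'\<^esub> (s [^]\<^bsub>R\<^esub> n) \<odot>\<^bsub>M'\<^esub> k"
        unfolding x(3) by (intro M'.smult_r_distr p gD(1) x(1) DK'(3) x(2))
      ultimately show "\<exists>n::nat. (s [^]\<^bsub>R\<^esub> n) \<odot>\<^bsub>M'\<^esub> y \<in> K'"
        using DK'(4) DK'(7)[OF p x(2)] by (intro exI[of _ n]) simp
    qed
  next
    assume "torsion_over R s M' K' Z'"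
    then show "torsion_over R s M K Z" unfolding torsion_over_def using 1 into by blast
  qed
qed

lemma torsion_finite_iff:
  assumes s: "s \<in> carrier R"
  shows "torsion_finite R s M K Z \<longleftrightarrow> torsion_finite R s M' K' Z'"
proof
  assume t: "torsion_finite R s M K Z"
  show "torsion_finite R s M' K' Z'" unfolding torsion_finite_def
  proof (intro allI impI; elim conjE)
    fix N N' assume N: "submodule N R M'" "submodule N' R M'" "K' \<subseteq> N" "N \<subseteq> N'" "N' \<subseteq> Z'"
      and to: "torsion_over R s M' N N'"
    interpret S: subquot_iso R M "pull N" "pull N'" M' N N' g by (rule iso_pull[OF N])
    show "rlen R M' N N' \<noteq> \<infinity>"
      using torsion_finiteD[OF t S.sK S.sZ pull_bounds(1)[OF N(3)] S.KZ pull_bounds(2)]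
        S.torsion_over_iff[OF s] S.rlen_eq to by simp
  qed
next
  assume t: "torsion_finite R s M' K' Z'"
  show "torsion_finite R s M K Z" unfolding torsion_finite_def
  proof (intro allI impI; elim conjE)
    fix N N' assume N: "submodule N R M" "submodule N' R M" "K \<subseteq> N" "N \<subseteq> N'" "N' \<subseteq> Z"
      and to: "torsion_over R s M N N'"
    interpret S: subquot_iso R M N N' M' "push N" "push N'" g by (rule iso_push[OF N])
    show "rlen R M N N' \<noteq> \<infinity>"
      using torsion_finiteD[OF t S.sK' S.sZ' push_bounds(1) S.KZ' push_bounds(2)] N
        S.torsion_over_iff[OF s] S.rlen_eq to by simp
  qed
qed

end

section \<open>Quotient modules\<close>

lemma coset_restr: "a_r_coset (M \<restriction> Z) = a_r_coset M"
  by (intro ext) (simp add: a_r_coset_def')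

lemma quot_restr_simps:
  "carrier (quot_mod (M \<restriction> Z) K) = (\<lambda>x. K +>\<^bsub>M\<^esub> x) ` Z"
  "zero (quot_mod (M \<restriction> Z) K) = K"
  "X \<oplus>\<^bsub>quot_mod (M \<restriction> Z) K\<^esub> Y = X <+>\<^bsub>M\<^esub> Y"
  "r \<odot>\<^bsub>quot_mod (M \<restriction> Z) K\<^esub> X = (\<Union>x\<in>X. K +>\<^bsub>M\<^esub> (r \<odot>\<^bsub>M\<^esub> x))"
  by (auto simp: quot_mod_def A_RCOSETS_def' coset_restr set_add_def')

context
  fixes R :: "'r ring" and M :: "('r, 'm) module" (structure) and K :: "'m set"
  assumes M: "module R M" and K: "submodule K R M"
begin

interpretation module R M by (rule M)
interpretation K: abelian_subgroup K M
  by (intro abelian_subgroupI3 additive_subgroup.intro submodule.axioms(1)[OF K] M.abelian_group_axioms)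

lemma coset_eq_iff:
  assumes "x \<in> carrier M" "y \<in> carrier M"
  shows "K +> x = K +> y \<longleftrightarrow> x \<ominus> y \<in> K"
proof -
  have "x \<in> K +> y \<longleftrightarrow> x \<ominus> y \<in> K"
    using K.a_rcos_module[OF assms(2,1)] by (simp add: a_minus_def)
  then show ?thesis
    using assms K.a_rcos_self[OF assms(1)] M.a_repr_independence[OF _ assms(2) submodule.axioms(1)[OF K]]
    by metis
qed

lemma coset_zero_iff:
  assumes "x \<in> carrier M"
  shows "K +> x = K \<longleftrightarrow> x \<in> K"
  using assms M.a_coset_join1 M.a_coset_join2 submodule.axioms(1)[OF K] by blast

lemma mem_coset: "y \<in> K +> x \<longleftrightarrow> (\<exists>k\<in>K. y = k \<oplus> x)"
  by (auto simp: a_r_coset_def')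

lemma coset_self: "x \<in> carrier M \<Longrightarrow> x \<in> K +> x"
  by (rule K.a_rcos_self)

lemma coset_sum:
  "x \<in> carrier M \<Longrightarrow> y \<in> carrier M \<Longrightarrow> (K +> x) <+>\<^bsub>M\<^esub> (K +> y) = K +> (x \<oplus> y)"
  by (rule K.a_rcos_sum)

text \<open>A map of submodules \<open>Z \<rightarrow> Z'\<close> that carries \<open>K\<close> into \<open>K'\<close> is constant modulo \<open>K'\<close> on each coset of \<open>K\<close>,
  so that the union in \<^const>\<open>coh_map\<close> and in the scalar multiplication of \<^const>\<open>quot_mod\<close> is a single coset.\<close>

lemma coset_map:
  fixes M' :: "('r, 'n) module"
  assumes M': "module R M'" and K': "submodule K' R M'" and Z: "submodule Z R M" "K \<subseteq> Z" and x: "x \<in> Z"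
    and f: "\<And>x. x \<in> Z \<Longrightarrow> f x \<in> carrier M'"
    and add: "\<And>x y. x \<in> Z \<Longrightarrow> y \<in> Z \<Longrightarrow> f (x \<oplus> y) = f x \<oplus>\<^bsub>M'\<^esub> f y"
    and fK: "\<And>x. x \<in> K \<Longrightarrow> f x \<in> K'"
  shows "(\<Union>z\<in>K +> x. K' +>\<^bsub>M'\<^esub> f z) = K' +>\<^bsub>M'\<^esub> f x"
proof -
  interpret M': module R M' by (rule M')
  have "K' +>\<^bsub>M'\<^esub> f z = K' +>\<^bsub>M'\<^esub> f x" if z: "z \<in> K +> x" for z
  proof -
    obtain k where k: "k \<in> K" "z = k \<oplus> x" using z by (auto simp: mem_coset)
    have kZ: "k \<in> Z" using k Z by auto
    have "f z = f k \<oplus>\<^bsub>M'\<^esub> f x" using add[OF kZ x] k by simp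
    then have "f z \<in> K' +>\<^bsub>M'\<^esub> f x" using fK[OF k(1)] by (auto simp: a_r_coset_def')
    then show ?thesis
      using M'.a_repr_independence[OF _ f[OF x] submodule.axioms(1)[OF K']] by simp
  qed
  moreover have "x \<in> K +> x" using coset_self submoduleD(3)[OF M Z(1) x] by simp
  ultimately show ?thesis by blast
qed

lemma coset_smult:
  assumes "r \<in> carrier R" "x \<in> carrier M"
  shows "(\<Union>z\<in>K +> x. K +> (r \<odot> z)) = K +> (r \<odot> x)"
  using assms submoduleD[OF M K]
  by (intro coset_map[OF M K submodule_carrier[OF M]]) (auto simp: smult_r_distr)

lemma module_quot:
  assumes Z: "submodule Z R M" "K \<subseteq> Z"
  shows "module R (quot_mod (M \<restriction> Z) K)"
proof -
  let ?Q = "quot_mod (M \<restriction> Z) K"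
  note DZ = submoduleD[OF M Z(1)]
  have c: "K +> x \<in> (\<lambda>x. K +> x) ` Z" if "x \<in> Z" for x using that by simp
  have K0: "K = K +> \<zero>"
    using coset_zero_iff[of "\<zero>"] submoduleD(2)[OF M K] by simp
  show ?thesis
  proof (rule moduleI)
    show "cring R" by (rule R.cring_axioms)
    show "abelian_group (?Q)"
    proof (rule abelian_groupI, unfold quot_restr_simps)
      show "K \<in> (\<lambda>x. K +> x) ` Z" using K0 DZ(2) by blast
      fix X assume "X \<in> (\<lambda>x. K +> x) ` Z"
      then obtain x where x: "x \<in> Z" "X = K +> x" by auto
      have xc: "x \<in> carrier M" using DZ(3) x(1) .
      show "K <+>\<^bsub>M\<^esub> X = X"
        using coset_sum[of "\<zero>" x] xc x(2) K0 by simp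
      have "(K +> (\<ominus> x)) <+>\<^bsub>M\<^esub> X = K"
        using coset_sum[of "\<ominus> x" x] xc x(2) K0 by (simp add: M.l_neg)
      then show "\<exists>Y\<in>(\<lambda>x. K +> x) ` Z. Y <+>\<^bsub>M\<^esub> X = K" using c[OF DZ(6)[OF x(1)]] by blast
      fix Y assume "Y \<in> (\<lambda>x. K +> x) ` Z"
      then obtain y where y: "y \<in> Z" "Y = K +> y" by auto
      have yc: "y \<in> carrier M" using DZ(3) y(1) .
      show "X <+>\<^bsub>M\<^esub> Y \<in> (\<lambda>x. K +> x) ` Z"
        using c[OF DZ(4)[OF x(1) y(1)]] coset_sum[OF xc yc] x y by simp
      show "X <+>\<^bsub>M\<^esub> Y = Y <+>\<^bsub>M\<^esub> X"
        using coset_sum[OF xc yc] coset_sum[OF yc xc] x y xc yc by (simp add: M.a_comm)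
      fix W assume "W \<in> (\<lambda>x. K +> x) ` Z"
      then obtain w where w: "w \<in> Z" "W = K +> w" by auto
      have wc: "w \<in> carrier M" using DZ(3) w(1) .
      show "X <+>\<^bsub>M\<^esub> Y <+>\<^bsub>M\<^esub> W = X <+>\<^bsub>M\<^esub> (Y <+>\<^bsub>M\<^esub> W)"
        using xc yc wc by (simp add: x(2) y(2) w(2) coset_sum M.a_assoc)
    qed
    fix a X assume a: "a \<in> carrier R" and "X \<in> carrier (?Q)"
    then obtain x where x: "x \<in> Z" "X = K +> x" by (auto simp: quot_restr_simps)
    have xc: "x \<in> carrier M" using DZ(3) x(1) .
    have ax: "a \<odot>\<^bsub>?Q\<^esub> X = K +> (a \<odot> x)"
      using coset_smult[OF a xc] x by (simp add: quot_restr_simps)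
    show "a \<odot>\<^bsub>?Q\<^esub> X \<in> carrier (?Q)"
      using ax c[OF DZ(7)[OF a x(1)]] by (simp add: quot_restr_simps)
    show "a \<odot>\<^bsub>?Q\<^esub> (X \<oplus>\<^bsub>?Q\<^esub> Y) =
        a \<odot>\<^bsub>?Q\<^esub> X \<oplus>\<^bsub>?Q\<^esub> a \<odot>\<^bsub>?Q\<^esub> Y"
      if Y: "Y \<in> carrier (?Q)" for Y
    proof -
      obtain y where y: "y \<in> Z" "Y = K +> y" using Y by (auto simp: quot_restr_simps)
      have yc: "y \<in> carrier M" using DZ(3) y(1) .
      show ?thesis using xc yc a
        by (simp add: quot_restr_simps x(2) y(2) coset_sum coset_smult smult_r_distr)
    qed
    fix b assume b: "b \<in> carrier R"
    show "(a \<oplus>\<^bsub>R\<^esub> b) \<odot>\<^bsub>?Q\<^esub> X =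
        a \<odot>\<^bsub>?Q\<^esub> X \<oplus>\<^bsub>?Q\<^esub> b \<odot>\<^bsub>?Q\<^esub> X"
      using xc a b by (simp add: quot_restr_simps x(2) coset_sum coset_smult smult_l_distr)
    show "(a \<otimes>\<^bsub>R\<^esub> b) \<odot>\<^bsub>?Q\<^esub> X =
        a \<odot>\<^bsub>?Q\<^esub> (b \<odot>\<^bsub>?Q\<^esub> X)"
      using xc a b by (simp add: quot_restr_simps x(2) coset_smult smult_assoc1)
  next
    fix X assume "X \<in> carrier (?Q)"
    then obtain x where x: "x \<in> Z" "X = K +> x" by (auto simp: quot_restr_simps)
    have xc: "x \<in> carrier M" using DZ(3) x(1) .
    show "\<one>\<^bsub>R\<^esub> \<odot>\<^bsub>?Q\<^esub> X = X"
      using xc by (simp add: quot_restr_simps x(2) coset_smult)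
  qed
qed

lemma quot_iso:
  assumes Z: "submodule Z R M" "K \<subseteq> Z"
  shows "subquot_iso R M K Z (quot_mod (M \<restriction> Z) K)
    {zero (quot_mod (M \<restriction> Z) K)} (carrier (quot_mod (M \<restriction> Z) K)) (\<lambda>x. K +> x)"
proof -
  let ?Q = "quot_mod (M \<restriction> Z) K"
  note DZ = submoduleD[OF M Z(1)]
  interpret Q: module R "?Q" by (rule module_quot[OF Z])
  show ?thesis
  proof (intro subquot_iso.intro M K Z module_quot submodule_zero submodule_carrier)
    show "(\<lambda>x. K +> x) \<in> mod_hom R (M \<restriction> Z) (?Q)"
      by (auto simp: mod_hom_def quot_restr_simps coset_sum coset_smult DZ(3))
    show "K +> x \<in> {zero (?Q)} \<longleftrightarrow> x \<in> K" if "x \<in> Z" for x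
      using coset_zero_iff[OF DZ(3)[OF that]] by (simp add: quot_restr_simps)
    show "\<exists>x\<in>Z. \<exists>k\<in>{zero (?Q)}. y = (K +> x) \<oplus>\<^bsub>?Q\<^esub> k"
      if y: "y \<in> carrier (?Q)" for y
    proof -
      obtain x where "x \<in> Z" "y = K +> x" using y by (auto simp: quot_restr_simps(1))
      then show ?thesis using Q.M.r_zero[OF y] by auto
    qed
    show "{zero (?Q)} \<subseteq> carrier (?Q)"
      using Q.M.zero_closed by simp
  qed (auto simp: quot_restr_simps(1))
qed

end

lemma mod_length_rlen:
  assumes "module R M"
  shows "mod_length R M = rlen R M {\<zero>\<^bsub>M\<^esub>} (carrier M)"
proof -
  have "submodule N R M \<longleftrightarrow> submodule N R M \<and> {\<zero>\<^bsub>M\<^esub>} \<subseteq> N \<and> N \<subseteq> carrier M" for N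
    using submoduleD(1,2)[OF assms] by auto
  then show ?thesis unfolding mod_length_def rlen_def by presburger
qed

lemma mod_length_quot:
  assumes "module R M" "submodule K R M" "submodule Z R M" "K \<subseteq> Z"
  shows "mod_length R (quot_mod (M \<restriction> Z) K) = rlen R M K Z"
  using mod_length_rlen[OF module_quot[OF assms]] subquot_iso.rlen_eq[OF quot_iso[OF assms]] by simp

lemma induced_hom:
  fixes R :: "'r ring" and M :: "('r, 'm) module" and M' :: "('r, 'n) module"
  assumes M: "module R M" "submodule K R M" "submodule Z R M" "K \<subseteq> Z"
    and M': "module R M'" "submodule K' R M'" "submodule Z' R M'" "K' \<subseteq> Z'"
    and f: "f \<in> mod_hom R (M \<restriction> Z) M'" "f ` Z \<subseteq> Z'" "f ` K \<subseteq> K'"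
  shows "(\<lambda>X. \<Union>x\<in>X. K' +>\<^bsub>M'\<^esub> f x) \<in> mod_hom R (quot_mod (M \<restriction> Z) K) (quot_mod (M' \<restriction> Z') K')"
    and "x \<in> Z \<Longrightarrow> (\<Union>z\<in>K +>\<^bsub>M\<^esub> x. K' +>\<^bsub>M'\<^esub> f z) = K' +>\<^bsub>M'\<^esub> f x"
proof -
  interpret module R M by (rule M)
  note DZ = submoduleD[OF M(1,3)] and DZ' = submoduleD[OF M'(1,3)]
    and fD = mod_hom_on[OF M(1) M'(1) M(3) f(1)]
  show eq: "(\<Union>z\<in>K +>\<^bsub>M\<^esub> x. K' +>\<^bsub>M'\<^esub> f z) = K' +>\<^bsub>M'\<^esub> f x" if "x \<in> Z" for x
    using f(3) by (intro coset_map[OF M(1,2) M'(1,2) M(3,4) that] fD) auto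
  have fZ: "f x \<in> Z'" if "x \<in> Z" for x using f(2) that by auto
  show "(\<lambda>X. \<Union>x\<in>X. K' +>\<^bsub>M'\<^esub> f x) \<in> mod_hom R (quot_mod (M \<restriction> Z) K) (quot_mod (M' \<restriction> Z') K')"
    using fD DZ DZ' fZ
    by (auto simp: mod_hom_def quot_restr_simps coset_sum[OF M(1,2)] coset_sum[OF M'(1,2)]
        coset_smult[OF M(1,2)] coset_smult[OF M'(1,2)] eq)
qed

section \<open>The index of the powers of an endomorphism\<close>

lemma the_enat_sum:
  fixes n :: nat
  assumes "\<And>j. j < n \<Longrightarrow> f j \<noteq> \<infinity>"
  shows "(\<Sum>j<n. f j) = enat (\<Sum>j<n. the_enat (f j))"
  using assms
proof (induction n)
  case (Suc n)
  then obtain a where "f n = enat a" by blast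
  with Suc show ?case by simp
qed (simp add: zero_enat_def)

locale module_endo =
  fixes R :: "'r ring" and A :: "('r, 'm) module" (structure) and T :: "'m \<Rightarrow> 'm"
  assumes A: "module R A" and T: "T \<in> mod_hom R A A"
begin

interpretation A: module R A by (rule A)

lemma funpow_hom: "T ^^ n \<in> mod_hom R A A"
proof (induction n)
  case (Suc n)
  note 1 = mod_homD[OF Suc] and 2 = mod_homD[OF T]
  show ?case by (auto simp: mod_hom_def 1 2)
qed (auto simp: mod_hom_def)

lemmas funpowD = mod_homD[OF funpow_hom] mod_hom_zero_minus[OF A A funpow_hom]

definition iter_im :: "nat \<Rightarrow> 'm set"
  where "iter_im r = (T ^^ r) ` carrier A"

lemma iter_im_submodule: "submodule (iter_im r) R A"
  unfolding iter_im_def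
  using submodule_image[OF A A submodule_carrier[OF A] _ submodule_carrier[OF A], of "T ^^ r"] funpow_hom
  by simp

lemma iter_im_Suc_subset: "iter_im (Suc r) \<subseteq> iter_im r"
proof -
  have "(T ^^ Suc r) x \<in> iter_im r" if x: "x \<in> carrier A" for x
  proof -
    have "T x \<in> carrier A" using mod_homD(1)[OF T x] .
    then show ?thesis unfolding iter_im_def by (simp add: funpow_Suc_right del: funpow.simps)
  qed
  then show ?thesis by (auto simp: iter_im_def[of "Suc r"])
qed

lemma iter_im_antimono: "r \<le> s \<Longrightarrow> iter_im s \<subseteq> iter_im r"
  by (induction s rule: dec_induct) (use iter_im_Suc_subset in auto)

lemma iter_im_carrier: "iter_im r \<subseteq> carrier A"
  using submoduleD(1)[OF A iter_im_submodule] .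

lemma iter_im_image: "(T ^^ n) ` iter_im r = iter_im (r + n)"
  unfolding iter_im_def image_image by (simp add: add.commute[of r] funpow_add)

definition iter_ker :: "nat \<Rightarrow> nat \<Rightarrow> 'm set"
  where "iter_ker n r = {x \<in> iter_im r. (T ^^ n) x = \<zero>}"

lemma iter_ker_submodule: "submodule (iter_ker n r) R A"
  using submodule_preimage[OF A A iter_im_submodule mod_hom_restrict_full[OF funpow_hom iter_im_carrier]
      submodule_zero[OF A], of r n]
  by (simp add: iter_ker_def)

definition "ker_len r = rlen R A {\<zero>} (iter_ker 1 r)"
definition "coker_len r = rlen R A (iter_im (Suc r)) (iter_im r)"

text \<open>Passing from \<open>T\<^sup>r A\<close> to \<open>T\<^sup>r\<^sup>+\<^sup>1 A\<close>, the kernel and the cokernel of \<open>T\<close> lose the same length, so that the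
  index of \<open>T\<close> on \<open>T\<^sup>r A\<close> does not change.\<close>

lemma ker_coker_len_Suc:
  obtains d where "ker_len r = ker_len (Suc r) + d" "coker_len r = coker_len (Suc r) + d"
proof
  let ?d = "rlen R A (iter_ker 1 (Suc r)) (iter_ker 1 r)"
  have mono: "iter_ker 1 (Suc r) \<subseteq> iter_ker 1 r" using iter_im_Suc_subset by (auto simp: iter_ker_def)
  have "{\<zero>} \<subseteq> iter_ker 1 (Suc r)" using submoduleD(2)[OF A iter_ker_submodule] by simp
  then show "ker_len r = ker_len (Suc r) + ?d" unfolding ker_len_def
    by (intro rlen_add[OF A submodule_zero[OF A]] iter_ker_submodule mono)
  have "coker_len r = rlen R A (T ` iter_im (Suc r)) (T ` iter_im r) + ?d"
    unfolding coker_len_def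
    using rlen_hom[OF A A iter_im_submodule iter_im_submodule iter_im_Suc_subset
        mod_hom_restrict_full[OF T iter_im_carrier]] by (simp add: iter_ker_def)
  then show "coker_len r = coker_len (Suc r) + ?d"
    using iter_im_image[of 1] by (simp add: coker_len_def)
qed

text \<open>
  Filter \<open>ker T\<^sup>n \<inter> T\<^sup>r A\<close> by the \<open>ker T\<^sup>j \<inter> T\<^sup>r A\<close>; the map \<open>T\<^sup>j\<close> identifies the \<open>j\<close>-th subquotient with
  \<open>ker T \<inter> T\<^sup>r\<^sup>+\<^sup>j A\<close>.
\<close>

lemma rlen_iter_ker: "rlen R A {\<zero>} (iter_ker n r) = (\<Sum>j<n. ker_len (r + j))"
proof (induction n)
  case 0
  have "iter_ker 0 r = {\<zero>}" using submoduleD(2)[OF A iter_im_submodule] by (auto simp: iter_ker_def)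
  then show ?case by (simp add: rlen_self)
next
  case (Suc n)
  have T0: "T \<zero> = \<zero>" using funpowD(4)[of 1] by simp
  have sub: "iter_ker n r \<subseteq> iter_ker (Suc n) r" by (auto simp: iter_ker_def T0)
  have z: "{\<zero>} \<subseteq> iter_ker m s" for m s using submoduleD(2)[OF A iter_ker_submodule] by simp
  note c = order_trans[OF _ iter_im_carrier]
  interpret S: subquot_iso R A "iter_ker n r" "iter_ker (Suc n) r" A "{\<zero>}" "iter_ker 1 (r + n)" "T ^^ n"
  proof (intro subquot_iso.intro A iter_ker_submodule sub submodule_zero z)
    show "T ^^ n \<in> mod_hom R (A \<restriction> iter_ker (Suc n) r) A"
      by (rule mod_hom_restrict_full[OF funpow_hom c]) (auto simp: iter_ker_def)
    show "(T ^^ n) x \<in> iter_ker 1 (r + n)" if "x \<in> iter_ker (Suc n) r" for x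
      using that unfolding iter_im_image[symmetric] iter_ker_def by auto
    show "\<exists>x\<in>iter_ker (Suc n) r. \<exists>k\<in>{\<zero>}. y = (T ^^ n) x \<oplus> k" if y: "y \<in> iter_ker 1 (r + n)" for y
    proof -
      obtain x where x: "x \<in> iter_im r" "y = (T ^^ n) x" "T y = \<zero>"
        using y unfolding iter_im_image[symmetric] iter_ker_def by auto
      then have "x \<in> iter_ker (Suc n) r" by (simp add: iter_ker_def)
      moreover have "y \<in> carrier A" using submoduleD(3)[OF A iter_ker_submodule y] .
      ultimately show ?thesis using x(2) A.M.r_zero[of y] by (intro bexI[of _ x] bexI[of _ "\<zero>"]) simp_all
    qed
  qed (auto simp: iter_ker_def)
  show ?case
    using rlen_add[OF A submodule_zero[OF A] iter_ker_submodule iter_ker_submodule z sub] Suc S.rlen_eq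
    by (simp add: ker_len_def)
qed

lemma rlen_iter_im: "rlen R A (iter_im (r + n)) (iter_im r) = (\<Sum>j<n. coker_len (r + j))"
proof (induction n)
  case 0
  then show ?case by (simp add: rlen_self)
next
  case (Suc n)
  then show ?case
    using rlen_add[OF A iter_im_submodule iter_im_submodule iter_im_submodule
        iter_im_antimono[of "r + n" "r + Suc n"] iter_im_antimono[of r "r + n"]]
    by (simp add: coker_len_def add.commute)
qed

text \<open>The cokernel of \<open>ker T\<^sup>r \<rightarrow> coker T\<^sup>r\<close> is \<open>A / (ker T\<^sup>r + T\<^sup>r A)\<close>, which \<open>T\<^sup>r\<close> identifies with \<open>T\<^sup>r A / T\<^sup>2\<^sup>r A\<close>.\<close>

lemma rlen_iter_coker:
  "rlen R A (iter_ker r 0 <+>\<^bsub>A\<^esub> iter_im r) (carrier A) = (\<Sum>j<r. coker_len (r + j))"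
proof -
  have c: "iter_im 0 = carrier A" by (simp add: iter_im_def)
  have s: "submodule (iter_ker r 0 <+>\<^bsub>A\<^esub> iter_im r) R A"
    by (intro submodule_set_add[OF A] iter_ker_submodule iter_im_submodule)
  have sc: "iter_ker r 0 <+>\<^bsub>A\<^esub> iter_im r \<subseteq> carrier A" using submoduleD(1)[OF A s] .
  interpret S: subquot_iso R A "iter_ker r 0 <+>\<^bsub>A\<^esub> iter_im r" "carrier A" A "iter_im (r + r)" "iter_im r" "T ^^ r"
  proof (intro subquot_iso.intro A s sc submodule_carrier iter_im_submodule iter_im_antimono)
    show "T ^^ r \<in> mod_hom R (A \<restriction> carrier A) A" using funpow_hom by simp
    show "(T ^^ r) x \<in> iter_im (r + r) \<longleftrightarrow> x \<in> iter_ker r 0 <+>\<^bsub>A\<^esub> iter_im r" if x: "x \<in> carrier A" for x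
    proof
      assume "(T ^^ r) x \<in> iter_im (r + r)"
      then obtain y where y: "y \<in> iter_im r" "(T ^^ r) x = (T ^^ r) y"
        unfolding iter_im_image[symmetric] by auto
      have yc: "y \<in> carrier A" using y(1) iter_im_carrier by auto
      have "x \<ominus> y \<in> iter_ker r 0"
        using funpowD(6)[OF x yc, of r] y(2) x yc funpowD(1)[OF yc, of r]
        by (simp add: iter_ker_def c a_minus_def A.M.r_neg)
      moreover have "x = (x \<ominus> y) \<oplus> y" using x yc by (simp add: A.M.minus_cancel)
      ultimately show "x \<in> iter_ker r 0 <+>\<^bsub>A\<^esub> iter_im r" using y(1) unfolding mem_set_add by blast
    next
      assume "x \<in> iter_ker r 0 <+>\<^bsub>A\<^esub> iter_im r"
      then obtain k y where ky: "k \<in> carrier A" "(T ^^ r) k = \<zero>" "y \<in> iter_im r" "x = k \<oplus> y"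
        unfolding mem_set_add iter_ker_def c by blast
      have yc: "y \<in> carrier A" using ky iter_im_carrier by auto
      have "(T ^^ r) x = (T ^^ r) y" using ky yc funpowD(1)[OF yc, of r] by (simp add: funpowD(2))
      then show "(T ^^ r) x \<in> iter_im (r + r)" using ky(3) unfolding iter_im_image[symmetric] by simp
    qed
    show "\<exists>x\<in>carrier A. \<exists>k\<in>iter_im (r + r). y = (T ^^ r) x \<oplus> k" if y: "y \<in> iter_im r" for y
    proof -
      have "y \<in> carrier A" using y iter_im_carrier by auto
      moreover have "\<zero> \<in> iter_im (r + r)" using submoduleD(2)[OF A iter_im_submodule] .
      moreover obtain x where "x \<in> carrier A" "y = (T ^^ r) x" using y by (auto simp: iter_im_def)
      ultimately show ?thesis by (metis A.M.r_zero)
    qed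
    show "(T ^^ r) x \<in> iter_im r" if "x \<in> carrier A" for x using that by (simp add: iter_im_def)
  qed simp
  show ?thesis using S.rlen_eq rlen_iter_im[of r r] by simp
qed

text \<open>
  By the formulas above the difference is the sum of the indices of \<open>T\<close> on \<open>T\<^sup>r\<^sup>+\<^sup>j A\<close> for \<open>j < r\<close>, and these
  are all equal.
\<close>

theorem index_of_power:
  assumes fin: "ker_len r\<^sub>0 \<noteq> \<infinity>" "coker_len r\<^sub>0 \<noteq> \<infinity>"
  obtains L :: int where "\<And>r. r \<ge> r\<^sub>0 \<Longrightarrow> rlen R A {\<zero>} (iter_ker r r) \<noteq> \<infinity>"
    "\<And>r. r \<ge> r\<^sub>0 \<Longrightarrow> rlen R A (iter_ker r 0 <+>\<^bsub>A\<^esub> iter_im r) (carrier A) \<noteq> \<infinity>"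
    "\<And>r. r \<ge> r\<^sub>0 \<Longrightarrow> int (the_enat (rlen R A {\<zero>} (iter_ker r r))) -
       int (the_enat (rlen R A (iter_ker r 0 <+>\<^bsub>A\<^esub> iter_im r) (carrier A))) = int r * L"
proof
  define L where "L = int (the_enat (ker_len r\<^sub>0)) - int (the_enat (coker_len r\<^sub>0))"
  have *: "ker_len r \<noteq> \<infinity> \<and> coker_len r \<noteq> \<infinity> \<and> int (the_enat (ker_len r)) - int (the_enat (coker_len r)) = L"
    if "r \<ge> r\<^sub>0" for r
    using that
  proof (induction r rule: dec_induct)
    case base
    show ?case using fin by (simp add: L_def)
  next
    case (step r)
    obtain d where d: "ker_len r = ker_len (Suc r) + d" "coker_len r = coker_len (Suc r) + d"
      by (rule ker_coker_len_Suc)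
    obtain a b c where "ker_len (Suc r) = enat a" "coker_len (Suc r) = enat b" "d = enat c"
      using d step by (metis enat.exhaust plus_enat_simps(2,3))
    with d step show ?case by auto
  qed
  fix r assume r: "r \<ge> r\<^sub>0"
  have k: "rlen R A {\<zero>} (iter_ker r r) = enat (\<Sum>j<r. the_enat (ker_len (r + j)))"
    unfolding rlen_iter_ker using * r by (intro the_enat_sum) auto
  have c: "rlen R A (iter_ker r 0 <+>\<^bsub>A\<^esub> iter_im r) (carrier A) = enat (\<Sum>j<r. the_enat (coker_len (r + j)))"
    unfolding rlen_iter_coker using * r by (intro the_enat_sum) auto
  show "rlen R A {\<zero>} (iter_ker r r) \<noteq> \<infinity>"
    "rlen R A (iter_ker r 0 <+>\<^bsub>A\<^esub> iter_im r) (carrier A) \<noteq> \<infinity>" using k c by auto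
  have "(\<Sum>j<r. int (the_enat (ker_len (r + j))) - int (the_enat (coker_len (r + j)))) = (\<Sum>j<r. L)"
    using * r by (intro sum.cong) auto
  then show "int (the_enat (rlen R A {\<zero>} (iter_ker r r))) -
       int (the_enat (rlen R A (iter_ker r 0 <+>\<^bsub>A\<^esub> iter_im r) (carrier A))) = int r * L"
    unfolding k c by (simp add: sum_subtractf)
qed

end

section \<open>Finitely generated modules\<close>

text \<open>
  Up to units every nonzero element is a power of \<open>s\<close>, as for \<open>s = p\<close> in the \<open>p\<close>-adic integers. The element
  \<open>s = 0\<close> of a field qualifies too, because \<open>0\<^sup>0 = 1\<close>.
\<close>

definition power_associates :: "'r ring \<Rightarrow> 'r \<Rightarrow> bool"
  where "power_associates R s \<longleftrightarrow> s \<in> carrier R \<and>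
    (\<forall>a\<in>carrier R. a \<noteq> \<zero>\<^bsub>R\<^esub> \<longrightarrow>
      (\<exists>v::nat. \<exists>u\<in>carrier R. \<exists>w\<in>carrier R. a = u \<otimes>\<^bsub>R\<^esub> s [^]\<^bsub>R\<^esub> v \<and> s [^]\<^bsub>R\<^esub> v = w \<otimes>\<^bsub>R\<^esub> a))"

lemma smult_power_mem_iff:
  fixes M (structure)
  assumes M: "module R M" and s: "power_associates R s"
    and a: "a \<in> carrier R" "a \<noteq> \<zero>\<^bsub>R\<^esub>"
  obtains v :: nat where "\<And>N x. submodule N R M \<Longrightarrow> x \<in> carrier M \<Longrightarrow>
    a \<odot> x \<in> N \<longleftrightarrow> (s [^]\<^bsub>R\<^esub> v) \<odot> x \<in> N"
proof -
  interpret module R M by (rule M)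
  have sc: "s \<in> carrier R" using s by (simp add: power_associates_def)
  obtain v :: nat and u w where v: "u \<in> carrier R" "w \<in> carrier R" "a = u \<otimes>\<^bsub>R\<^esub> s [^]\<^bsub>R\<^esub> v"
      "s [^]\<^bsub>R\<^esub> v = w \<otimes>\<^bsub>R\<^esub> a"
    using s a unfolding power_associates_def by blast
  show ?thesis
  proof (rule that[of v])
    fix N x assume N: "submodule N R M" and x: "x \<in> carrier M"
    note D = submoduleD[OF M N]
    have p: "s [^]\<^bsub>R\<^esub> v \<in> carrier R" using sc by simp
    have 1: "a \<odot> x = u \<odot> ((s [^]\<^bsub>R\<^esub> v) \<odot> x)"
      by (subst v(3), rule smult_assoc1[OF v(1) p x])
    have 2: "(s [^]\<^bsub>R\<^esub> v) \<odot> x = w \<odot> (a \<odot> x)"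
      by (subst v(4), rule smult_assoc1[OF v(2) a(1) x])
    show "a \<odot> x \<in> N \<longleftrightarrow> (s [^]\<^bsub>R\<^esub> v) \<odot> x \<in> N"
      using D(7)[OF v(1), of "(s [^]\<^bsub>R\<^esub> v) \<odot> x"] D(7)[OF v(2), of "a \<odot> x"] 1 2 by metis
  qed
qed

text \<open>Modulo \<open>X\<close>, a submodule of \<open>X + R x\<close> that contains \<open>X\<close> is known once one knows the least power of \<open>s\<close>
  that moves \<open>x\<close> into it; along a strict chain this exponent decreases.\<close>

lemma rlen_cyclic:
  fixes M (structure)
  assumes M: "module R M" and s: "power_associates R s" and X: "submodule X R M" and x: "x \<in> carrier M"
    and N: "submodule N R M" "submodule N' R M" "X \<subseteq> N" "N \<subseteq> N'"
    and cyc: "\<And>y. y \<in> N' \<Longrightarrow> \<exists>z\<in>X. \<exists>a\<in>carrier R. y = z \<oplus> a \<odot> x"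
    and tor: "torsion_over R s M N N'"
  shows "rlen R M N N' \<noteq> \<infinity>"
proof (cases "N' = X")
  case True
  then have "N = N'" using N by auto
  then show ?thesis by (simp add: rlen_self zero_enat_def)
next
  case False
  interpret module R M by (rule M)
  have sc: "s \<in> carrier R" using s by (simp add: power_associates_def)
  have p: "s [^]\<^bsub>R\<^esub> (v::nat) \<in> carrier R" for v using sc by simp
  (* y = z + a x with z in X; here a is nonzero, hence a power of s up to a unit. *)
  have split: "\<exists>v::nat. \<forall>L. submodule L R M \<and> X \<subseteq> L \<longrightarrow> y \<in> L \<longleftrightarrow> (s [^]\<^bsub>R\<^esub> v) \<odot> x \<in> L"
    if y: "y \<in> N'" "y \<notin> X" for y
  proof -
    obtain z a where za: "z \<in> X" "a \<in> carrier R" "y = z \<oplus> a \<odot> x" using cyc[OF y(1)] by blast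
    have zc: "z \<in> carrier M" using submoduleD(3)[OF M X za(1)] .
    have "a \<noteq> \<zero>\<^bsub>R\<^esub>" using za y(2) x zc by auto
    then obtain v :: nat where v: "\<And>N x. submodule N R M \<Longrightarrow> x \<in> carrier M \<Longrightarrow>
        a \<odot> x \<in> N \<longleftrightarrow> (s [^]\<^bsub>R\<^esub> v) \<odot> x \<in> N"
      using smult_power_mem_iff[OF M s za(2)] by metis
    have "y \<in> L \<longleftrightarrow> (s [^]\<^bsub>R\<^esub> v) \<odot> x \<in> L" if L: "submodule L R M" "X \<subseteq> L" for L
    proof -
      have zL: "z \<in> L" using za L by auto
      have "a \<odot> x = y \<ominus> z" using za zc x by (simp add: M.minus_cancel)
      then have "y \<in> L \<longleftrightarrow> a \<odot> x \<in> L"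
        using submoduleD(4,5)[OF M L(1)] zL za(3) by metis
      then show ?thesis using v[OF L(1) x] by simp
    qed
    then show ?thesis by blast
  qed
  obtain y where y: "y \<in> N'" "y \<notin> X" using False N by auto
  obtain v :: nat where v: "(s [^]\<^bsub>R\<^esub> v) \<odot> x \<in> N'" using split[OF y] y N by blast
  then obtain k :: nat where k: "(s [^]\<^bsub>R\<^esub> k) \<odot> ((s [^]\<^bsub>R\<^esub> v) \<odot> x) \<in> N"
    using tor unfolding torsion_over_def by blast
  have b: "(s [^]\<^bsub>R\<^esub> (k + v)) \<odot> x \<in> N"
    using k smult_assoc1[OF p p x] R.nat_pow_mult[OF sc] by simp
  have "rlen R M N N' \<le> enat (k + v)"
  proof (rule rlen_leI)
    fix n Y assume 1: "\<And>j. j \<le> n \<Longrightarrow> submodule (Y j) R M \<and> N \<subseteq> Y j \<and> Y j \<subseteq> N'"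
      and 2: "\<And>j. j < n \<Longrightarrow> Y j \<subset> Y (Suc j)"
    define \<nu> where "\<nu> j = (LEAST v::nat. (s [^]\<^bsub>R\<^esub> v) \<odot> x \<in> Y j)" for j
    have "j \<le> n \<Longrightarrow> \<nu> j + j \<le> k + v" for j
    proof (induction j)
      case 0
      have "(s [^]\<^bsub>R\<^esub> (k + v)) \<odot> x \<in> Y 0" using b 1[of 0] by auto
      then show ?case unfolding \<nu>_def by (simp add: Least_le)
    next
      case (Suc j)
      have Yj: "submodule (Y j) R M" "N \<subseteq> Y j" "submodule (Y (Suc j)) R M" "N \<subseteq> Y (Suc j)" "Y (Suc j) \<subseteq> N'"
        using 1[of j] 1[of "Suc j"] Suc.prems by auto
      obtain y where y: "y \<in> Y (Suc j)" "y \<notin> Y j" using 2[of j] Suc.prems by auto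
      have "y \<in> N'" "y \<notin> X" using y Yj N by auto
      from split[OF this] obtain w :: nat
        where w: "\<And>L. submodule L R M \<Longrightarrow> X \<subseteq> L \<Longrightarrow> y \<in> L \<longleftrightarrow> (s [^]\<^bsub>R\<^esub> w) \<odot> x \<in> L" by blast
      have "\<nu> (Suc j) \<le> w" unfolding \<nu>_def using w[OF Yj(3)] y N Yj by (intro Least_le) auto
      moreover have "w < \<nu> j"
      proof (rule ccontr)
        assume "\<not> w < \<nu> j"
        then have le: "\<nu> j \<le> w" by simp
        have "(s [^]\<^bsub>R\<^esub> \<nu> j) \<odot> x \<in> Y j"
          unfolding \<nu>_def by (rule LeastI[of _ "k + v"]) (use b Yj in auto)
        then have "(s [^]\<^bsub>R\<^esub> (w - \<nu> j)) \<odot> ((s [^]\<^bsub>R\<^esub> \<nu> j) \<odot> x) \<in> Y j"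
          using submoduleD(7)[OF M Yj(1) p] by blast
        then have "(s [^]\<^bsub>R\<^esub> w) \<odot> x \<in> Y j"
          using smult_assoc1[OF p p x, of "w - \<nu> j" "\<nu> j"] R.nat_pow_mult[OF sc, of "w - \<nu> j" "\<nu> j"] le by simp
        then show False using w[OF Yj(1)] y N Yj by auto
      qed
      moreover have "\<nu> j + j \<le> k + v" using Suc by simp
      ultimately show ?case by simp
    qed
    from this[of n] show "enat n \<le> enat (k + v)" by simp
  qed
  then show ?thesis using enat_ile by force
qed

lemma torsion_over_sum:
  fixes M (structure)
  assumes M: "module R M" and s: "s \<in> carrier R" and N: "submodule N R M" "submodule X R M"
    and N': "submodule N' R M" and t: "torsion_over R s M N N'"
  shows "torsion_over R s M (N <+>\<^bsub>M\<^esub> X) (N' <+>\<^bsub>M\<^esub> X)"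
  unfolding torsion_over_def
proof
  interpret module R M by (rule M)
  fix y assume "y \<in> N' <+>\<^bsub>M\<^esub> X"
  then obtain n x where nx: "n \<in> N'" "x \<in> X" "y = n \<oplus> x" by (auto simp: mem_set_add)
  then obtain k :: nat where k: "(s [^]\<^bsub>R\<^esub> k) \<odot> n \<in> N" using t unfolding torsion_over_def by blast
  have p: "s [^]\<^bsub>R\<^esub> k \<in> carrier R" using s by simp
  have "(s [^]\<^bsub>R\<^esub> k) \<odot> y = (s [^]\<^bsub>R\<^esub> k) \<odot> n \<oplus> (s [^]\<^bsub>R\<^esub> k) \<odot> x"
    unfolding nx(3) by (intro smult_r_distr p submoduleD(3)[OF M N' nx(1)] submoduleD(3)[OF M N(2) nx(2)])
  then show "\<exists>k::nat. (s [^]\<^bsub>R\<^esub> k) \<odot> y \<in> N <+>\<^bsub>M\<^esub> X"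
    using k submoduleD(7)[OF M N(2) p nx(2)] unfolding mem_set_add by blast
qed

text \<open>
  Call the larger module \<open>X + R x\<close>. A subquotient \<open>N' / N\<close> of it is an extension of \<open>(N' + X) / (N + X)\<close>, which
  is cyclic modulo \<open>X\<close>, by \<open>(N' \<inter> X) / (N \<inter> X)\<close>, a subquotient of \<open>X\<close>.
\<close>

lemma torsion_finite_extend:
  fixes M (structure)
  assumes M: "module R M" and s: "power_associates R s" and X: "submodule X R M" and x: "x \<in> carrier M"
    and fin: "torsion_finite R s M {\<zero>} X"
  shows "torsion_finite R s M {\<zero>} (X <+>\<^bsub>M\<^esub> {a \<odot> x | a. a \<in> carrier R})"
  unfolding torsion_finite_def
proof (intro allI impI; elim conjE)
  interpret module R M by (rule M)
  have sc: "s \<in> carrier R" using s by (simp add: power_associates_def)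
  fix N N' assume N: "submodule N R M" "submodule N' R M" "N \<subseteq> N'"
    and N'X: "N' \<subseteq> X <+>\<^bsub>M\<^esub> {a \<odot> x | a. a \<in> carrier R}" and t: "torsion_over R s M N N'"
  have s1: "submodule (N' \<inter> X) R M" "submodule (N \<inter> X) R M" by (intro submodule_Int[OF M] N X)+
  define L where "L = N <+>\<^bsub>M\<^esub> (N' \<inter> X)"
  have L: "submodule L R M" "N \<subseteq> L" "N' \<inter> X \<subseteq> L" "L \<subseteq> N'"
    unfolding L_def using submodule_set_add[OF M N(1) s1(1)] set_add_upper[OF M N(1) s1(1)]
      set_add_least[OF M N(2,3)] by auto
  have c: "N' \<subseteq> carrier M" using submoduleD(1)[OF M N(2)] .
  interpret I: subquot_iso R M "N \<inter> X" "N' \<inter> X" M N L "\<lambda>x. x"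
  proof (intro subquot_iso.intro M s1 N L mod_hom_id)
    show "\<exists>u\<in>N' \<inter> X. \<exists>k\<in>N. y = u \<oplus> k" if y: "y \<in> L" for y
    proof -
      obtain k u where "k \<in> N" "u \<in> N' \<inter> X" "y = k \<oplus> u" using y unfolding L_def mem_set_add by blast
      moreover from this have "k \<oplus> u = u \<oplus> k" using N c by (intro M.a_comm) auto
      ultimately show ?thesis by metis
    qed
    show "x \<in> L" if "x \<in> N' \<inter> X" for x using that L by auto
  qed (use c N in auto)
  have "rlen R M (N \<inter> X) (N' \<inter> X) \<noteq> \<infinity>"
  proof (rule torsion_finiteD[OF fin s1(2,1)])
    show "{\<zero>} \<subseteq> N \<inter> X" using submoduleD(2)[OF M s1(2)] by simp
    show "torsion_over R s M (N \<inter> X) (N' \<inter> X)"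
      using t submoduleD(7)[OF M X] sc unfolding torsion_over_def by blast
  qed (use N in auto)
  then have 1: "rlen R M N L \<noteq> \<infinity>" using I.rlen_eq by simp
  have s2: "submodule (N <+>\<^bsub>M\<^esub> X) R M" "submodule (N' <+>\<^bsub>M\<^esub> X) R M"
    by (intro submodule_set_add[OF M] N X)+
  have up: "N \<subseteq> N <+>\<^bsub>M\<^esub> X" "X \<subseteq> N <+>\<^bsub>M\<^esub> X" "N' \<subseteq> N' <+>\<^bsub>M\<^esub> X" "X \<subseteq> N' <+>\<^bsub>M\<^esub> X"
    using set_add_upper[OF M N(1) X] set_add_upper[OF M N(2) X] by auto
  have mono: "N <+>\<^bsub>M\<^esub> X \<subseteq> N' <+>\<^bsub>M\<^esub> X" using set_add_least[OF M s2(2) order_trans[OF N(3) up(3)] up(4)] .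
  interpret J: subquot_iso R M L N' M "N <+>\<^bsub>M\<^esub> X" "N' <+>\<^bsub>M\<^esub> X" "\<lambda>x. x"
  proof (intro subquot_iso.intro M s2 N L mono mod_hom_id c)
    show "y \<in> N <+>\<^bsub>M\<^esub> X \<longleftrightarrow> y \<in> L" if y: "y \<in> N'" for y
    proof
      assume "y \<in> N <+>\<^bsub>M\<^esub> X"
      then obtain n u where nu: "n \<in> N" "u \<in> X" "y = n \<oplus> u" by (auto simp: mem_set_add)
      have nN': "n \<in> N'" using nu(1) N by auto
      then have "u = y \<ominus> n"
        using c submoduleD(3)[OF M X nu(2)] unfolding nu(3) by (auto simp: M.minus_cancel)
      then have "u \<in> N' \<inter> X" using submoduleD(5)[OF M N(2) y nN'] nu(2) by simp
      then show "y \<in> L" using nu unfolding L_def mem_set_add by blast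
    next
      assume "y \<in> L"
      then show "y \<in> N <+>\<^bsub>M\<^esub> X" unfolding L_def mem_set_add by blast
    qed
    show "\<exists>u\<in>N'. \<exists>k\<in>N <+>\<^bsub>M\<^esub> X. y = u \<oplus> k" if y: "y \<in> N' <+>\<^bsub>M\<^esub> X" for y
      using y up(2) unfolding mem_set_add[of y] by blast
    show "y \<in> N' <+>\<^bsub>M\<^esub> X" if "y \<in> N'" for y using that up by auto
  qed
  have "rlen R M (N <+>\<^bsub>M\<^esub> X) (N' <+>\<^bsub>M\<^esub> X) \<noteq> \<infinity>"
  proof (rule rlen_cyclic[OF M s X x s2 up(2) mono])
    show "torsion_over R s M (N <+>\<^bsub>M\<^esub> X) (N' <+>\<^bsub>M\<^esub> X)" by (rule torsion_over_sum[OF M sc N(1) X N(2) t])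
    fix y assume "y \<in> N' <+>\<^bsub>M\<^esub> X"
    then obtain n u where nu: "n \<in> N'" "u \<in> X" "y = n \<oplus> u" by (auto simp: mem_set_add)
    then obtain z a where za: "z \<in> X" "a \<in> carrier R" "n = z \<oplus> a \<odot> x"
      using N'X unfolding mem_set_add subset_iff by blast
    have "z \<in> carrier M" "u \<in> carrier M" using submoduleD(3)[OF M X] za nu by auto
    then have "y = (z \<oplus> u) \<oplus> a \<odot> x" unfolding nu(3) za(3) using za(2) x by (simp add: M.a_ac)
    then show "\<exists>z\<in>X. \<exists>a\<in>carrier R. y = z \<oplus> a \<odot> x"
      using za(2) submoduleD(4)[OF M X za(1) nu(2)] by blast
  qed
  then have 2: "rlen R M L N' \<noteq> \<infinity>" using J.rlen_eq by simp
  show "rlen R M N N' \<noteq> \<infinity>" using rlen_add[OF M N(1) L(1) N(2) L(2,4)] 1 2 plus_eq_infty_iff_enat by metis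
qed

theorem fin_generated_torsion_finite:
  fixes M (structure)
  assumes M: "module R M" and s: "power_associates R s" and fg: "fin_generated R M"
  shows "torsion_finite R s M {\<zero>} (carrier M)"
proof -
  interpret module R M by (rule M)
  obtain S where S: "finite S" "S \<subseteq> carrier M" "\<And>N. submodule N R M \<Longrightarrow> S \<subseteq> N \<Longrightarrow> N = carrier M"
    using fg unfolding fin_generated_def by auto
  have "\<exists>X. submodule X R M \<and> S \<subseteq> X \<and> torsion_finite R s M {\<zero>} X"
    using S(1,2)
  proof (induction S)
    case empty
    have "torsion_finite R s M {\<zero>} {\<zero>}"
      unfolding torsion_finite_def
    proof (intro allI impI; elim conjE)
      fix N N' assume "{\<zero>} \<subseteq> N" "N \<subseteq> N'" "N' \<subseteq> {\<zero>}"
      then have "N' = N" by auto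
      then show "rlen R M N N' \<noteq> \<infinity>" by (simp add: rlen_self zero_enat_def)
    qed
    then show ?case using submodule_zero[OF M] by blast
  next
    case (insert x S)
    then obtain X where X: "submodule X R M" "S \<subseteq> X" "torsion_finite R s M {\<zero>} X" by auto
    have x: "x \<in> carrier M" using insert by auto
    let ?C = "{a \<odot> x | a. a \<in> carrier R}"
    have C: "submodule ?C R M" unfolding submodule_iff[OF M]
    proof (intro conjI ballI)
      show "?C \<subseteq> carrier M" using x by auto
      show "\<zero> \<in> ?C" using x smult_l_null[OF x] R.zero_closed by force
      fix y assume "y \<in> ?C"
      then obtain a where a: "a \<in> carrier R" "y = a \<odot> x" by auto
      show "y \<oplus> z \<in> ?C" if z: "z \<in> ?C" for z
      proof -
        obtain b where b: "b \<in> carrier R" "z = b \<odot> x" using z by auto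
        have "y \<oplus> z = (a \<oplus>\<^bsub>R\<^esub> b) \<odot> x" using a b smult_l_distr[OF _ _ x] by simp
        then show ?thesis using a b R.a_closed by blast
      qed
      show "r \<odot> y \<in> ?C" if r: "r \<in> carrier R" for r
      proof -
        have "r \<odot> y = (r \<otimes>\<^bsub>R\<^esub> a) \<odot> x" using a r smult_assoc1[OF _ _ x] by simp
        then show ?thesis using a r R.m_closed by blast
      qed
    qed
    have "x \<in> ?C" using smult_one[OF x] R.one_closed by force
    then show ?case
      using submodule_set_add[OF M X(1) C] set_add_upper[OF M X(1) C] X(2) torsion_finite_extend[OF M s X(1) x X(3)]
      by (intro exI[of _ "X <+>\<^bsub>M\<^esub> ?C"]) auto
  qed
  then show ?thesis using S(3) by blast
qed

text \<open>With \<open>s = 0\<close> everything is torsion, so that torsion finiteness is finite length.\<close>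

lemma fin_generated_field_finite_length:
  assumes M: "module R M" and fg: "fin_generated R M"
    and inv: "\<And>a. a \<in> carrier R \<Longrightarrow> a \<noteq> \<zero>\<^bsub>R\<^esub> \<Longrightarrow> \<exists>b\<in>carrier R. b \<otimes>\<^bsub>R\<^esub> a = \<one>\<^bsub>R\<^esub>"
  shows "rlen R M {\<zero>\<^bsub>M\<^esub>} (carrier M) \<noteq> \<infinity>"
proof -
  interpret module R M by (rule M)
  have "power_associates R \<zero>\<^bsub>R\<^esub>"
    unfolding power_associates_def
  proof (intro conjI ballI impI)
    fix a assume a: "a \<in> carrier R" "a \<noteq> \<zero>\<^bsub>R\<^esub>"
    obtain b where b: "b \<in> carrier R" "b \<otimes>\<^bsub>R\<^esub> a = \<one>\<^bsub>R\<^esub>" using inv[OF a] by blast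
    then show "\<exists>v::nat. \<exists>u\<in>carrier R. \<exists>w\<in>carrier R.
        a = u \<otimes>\<^bsub>R\<^esub> \<zero>\<^bsub>R\<^esub> [^]\<^bsub>R\<^esub> v \<and> \<zero>\<^bsub>R\<^esub> [^]\<^bsub>R\<^esub> v = w \<otimes>\<^bsub>R\<^esub> a"
      using a by (intro exI[of _ 0] bexI[of _ a] bexI[of _ b]) simp_all
  qed simp
  moreover have "torsion_over R \<zero>\<^bsub>R\<^esub> M {\<zero>\<^bsub>M\<^esub>} (carrier M)"
    unfolding torsion_over_def by (auto intro!: exI[of _ "1::nat"] simp: smult_l_null)
  ultimately show ?thesis
    using torsion_finiteD[OF fin_generated_torsion_finite[OF M _ fg] submodule_zero[OF M] submodule_carrier[OF M]]
    by simp
qed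

section \<open>Chain conditions\<close>

lemma nat_descending_stationary:
  fixes f :: "nat \<Rightarrow> nat"
  assumes "\<And>r. f (Suc r) \<le> f r"
  shows "\<exists>r\<^sub>0. \<forall>r\<ge>r\<^sub>0. f (Suc r) = f r"
proof -
  define m where "m = (LEAST m. m \<in> range f)"
  have "m \<in> range f" unfolding m_def by (rule LeastI) (rule rangeI[of f 0])
  then obtain r\<^sub>0 where r0: "m = f r\<^sub>0" by blast
  have "f s = m" if "s \<ge> r\<^sub>0" for s
  proof (rule antisym)
    show "f s \<le> m" unfolding r0 using assms that by (rule lift_Suc_antimono_le)
    show "m \<le> f s" unfolding m_def by (rule Least_le) (rule rangeI)
  qed
  then show ?thesis by (metis le_SucI)
qed

context
  fixes R :: "'r ring" and M :: "('r, 'm) module" (structure) and H :: "nat \<Rightarrow> 'm set"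
  assumes M: "module R M" and fin: "rlen R M {\<zero>} (carrier M) \<noteq> \<infinity>"
    and H: "\<And>r. submodule (H r) R M"
begin

lemma rlen_below_finite:
  obtains f b where "\<And>r. rlen R M {\<zero>} (H r) = enat (f r)" "\<And>r. f r \<le> b"
proof -
  obtain b where b: "rlen R M {\<zero>} (carrier M) = enat b" using fin by blast
  have "rlen R M {\<zero>} (H r) \<le> enat b" for r
    unfolding b[symmetric] by (rule rlen_mono[OF order_refl submoduleD(1)[OF M H]])
  then have "\<exists>n. rlen R M {\<zero>} (H r) = enat n \<and> n \<le> b" for r
    by (metis enat_ile enat_ord_simps(1))
  then show ?thesis using that by metis
qed

lemma finite_length_step:
  assumes "H r \<subseteq> H s" "rlen R M {\<zero>} (H r) = enat a" "rlen R M {\<zero>} (H s) = enat b"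
  shows "a \<le> b" "a = b \<Longrightarrow> H r = H s"
proof -
  have z: "{\<zero>} \<subseteq> H r" using submoduleD(2)[OF M H] by simp
  have e: "enat b = enat a + rlen R M (H r) (H s)"
    using rlen_add[OF M submodule_zero[OF M] H H z assms(1)] unfolding assms(2,3) .
  show "a \<le> b" using e by (cases "rlen R M (H r) (H s)") auto
  assume "a = b"
  then have "rlen R M (H r) (H s) = 0" using e
    by (cases "rlen R M (H r) (H s)") (auto simp: zero_enat_def)
  then show "H r = H s" by (rule rlen_eq_0D[OF H H assms(1)])
qed

lemma finite_length_descending:
  assumes le: "\<And>r. H (Suc r) \<subseteq> H r"
  shows "\<exists>r\<^sub>0. \<forall>r\<ge>r\<^sub>0. H (Suc r) = H r"
proof -
  obtain f b where f: "\<And>r. rlen R M {\<zero>} (H r) = enat (f r)" "\<And>r. f r \<le> b"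
    using rlen_below_finite by blast
  have "f (Suc r) \<le> f r" for r by (rule finite_length_step(1)[OF le f(1) f(1)])
  then obtain r\<^sub>0 where "\<forall>r\<ge>r\<^sub>0. f (Suc r) = f r" using nat_descending_stationary[of f] by blast
  then show ?thesis using finite_length_step(2)[OF le f(1) f(1)] by blast
qed

lemma finite_length_ascending:
  assumes le: "\<And>r. H r \<subseteq> H (Suc r)"
  shows "\<exists>r\<^sub>0. \<forall>r\<ge>r\<^sub>0. H (Suc r) = H r"
proof -
  obtain f b where f: "\<And>r. rlen R M {\<zero>} (H r) = enat (f r)" "\<And>r. f r \<le> b"
    using rlen_below_finite by blast
  have fle: "f r \<le> f (Suc r)" for r by (rule finite_length_step(1)[OF le f(1) f(1)])
  then have "b - f (Suc r) \<le> b - f r" for r by (rule diff_le_mono2)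
  then obtain r\<^sub>0 where r0: "\<forall>r\<ge>r\<^sub>0. b - f (Suc r) = b - f r"
    using nat_descending_stationary[of "\<lambda>r. b - f r"] by blast
  have "H r = H (Suc r)" if r: "r \<ge> r\<^sub>0" for r
  proof (rule finite_length_step(2)[OF le f(1) f(1)])
    have "b - f (Suc r) = b - f r" using r0 r by blast
    then show "f r = f (Suc r)" using f(2)[of r] f(2)[of "Suc r"] by linarith
  qed
  then show ?thesis by metis
qed

end

section \<open>Cochain complexes\<close>

context
  fixes R :: "'r ring" and C :: "('r, 'm) cochain"
  assumes C: "cochain_complex R C"
begin

lemma cmodule_module: "module R (cmodule C n)"
  using C by (simp add: cochain_complex_def)

lemma cdiff_hom: "cdiff C n \<in> mod_hom R (cmodule C n) (cmodule C (n + 1))"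
  using C by (simp add: cochain_complex_def)

lemma cdiff_hom': "cdiff C (n - 1) \<in> mod_hom R (cmodule C (n - 1)) (cmodule C n)"
  using cdiff_hom[of "n - 1"] by simp

lemma cdiff_cdiff: "x \<in> carrier (cmodule C n) \<Longrightarrow> cdiff C (n + 1) (cdiff C n x) = \<zero>\<^bsub>cmodule C (n + 1 + 1)\<^esub>"
  using C by (simp add: cochain_complex_def)

lemma cocycles_submodule: "submodule (cocycles C n) R (cmodule C n)"
  using submodule_preimage[OF cmodule_module cmodule_module submodule_carrier[OF cmodule_module] _
      submodule_zero[OF cmodule_module], of "cdiff C n" n "n + 1"] cdiff_hom
  by (simp add: cocycles_def)

lemma coboundaries_submodule: "submodule (coboundaries C n) R (cmodule C n)"
  using submodule_image[OF cmodule_module cmodule_module submodule_carrier[OF cmodule_module] _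
      submodule_carrier[OF cmodule_module], of "cdiff C (n - 1)" "n - 1" n] cdiff_hom'
  by (simp add: coboundaries_def)

lemma coboundaries_cocycles: "coboundaries C n \<subseteq> cocycles C n"
  using cdiff_cdiff[of _ "n - 1"] mod_homD(1)[OF cdiff_hom'] by (auto simp: cocycles_def coboundaries_def)

lemmas cohomology_module = module_quot[OF cmodule_module coboundaries_submodule cocycles_submodule
    coboundaries_cocycles, folded cohomology_def]

lemmas cohomology_iso = quot_iso[OF cmodule_module coboundaries_submodule cocycles_submodule
    coboundaries_cocycles, folded cohomology_def]

end

lemma carrier_cohomology: "carrier (cohomology C n) = (\<lambda>x. coboundaries C n +>\<^bsub>cmodule C n\<^esub> x) ` cocycles C n"
  and zero_cohomology: "zero (cohomology C n) = coboundaries C n"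
  by (simp_all add: cohomology_def quot_restr_simps)

section \<open>Fractions\<close>

locale frac_module =
  fixes R :: "'r ring" and s :: 'r and M :: "('r, 'm) module" (structure)
  assumes M: "module R M" and s: "s \<in> carrier R"
begin

interpretation module R M by (rule M)

abbreviation pw :: "nat \<Rightarrow> 'm \<Rightarrow> 'm"
  where "pw k x \<equiv> (s [^]\<^bsub>R\<^esub> k) \<odot> x"

lemma spow: "s [^]\<^bsub>R\<^esub> (k::nat) \<in> carrier R"
  using s by simp

lemma pw_closed: "x \<in> carrier M \<Longrightarrow> pw k x \<in> carrier M"
  using spow by simp

lemma pw_pw: "x \<in> carrier M \<Longrightarrow> pw k (pw l x) = pw (k + l) x"
  using smult_assoc1[OF spow spow, of x k l] R.nat_pow_mult[OF s, of k l] by simp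

lemma pw_add: "x \<in> carrier M \<Longrightarrow> y \<in> carrier M \<Longrightarrow> pw k (x \<oplus> y) = pw k x \<oplus> pw k y"
  by (rule smult_r_distr[OF spow])

lemma pw_zero: "pw k \<zero> = \<zero>"
  using spow by simp

lemma pw_smult: "a \<in> carrier R \<Longrightarrow> x \<in> carrier M \<Longrightarrow> pw k (a \<odot> x) = a \<odot> pw k x"
  using smult_assoc1[OF spow, of a x k] smult_assoc1[OF _ spow, of a x k] R.m_comm[OF spow, of a k] by simp

lemma frac_rel_iff:
  "((m, k), (m', k')) \<in> frac_rel R s M \<longleftrightarrow>
    m \<in> carrier M \<and> m' \<in> carrier M \<and> (\<exists>j. pw (j + k') m = pw (j + k) m')"
  by (simp add: frac_rel_def)

lemma frac_rel_trans: "trans (frac_rel R s M)"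
proof (rule transI, clarify)
  fix m k m' k' m'' k''
  assume "((m, k), (m', k')) \<in> frac_rel R s M" "((m', k'), (m'', k'')) \<in> frac_rel R s M"
  then obtain i j where c: "m \<in> carrier M" "m' \<in> carrier M" "m'' \<in> carrier M"
    and j: "pw (j + k') m = pw (j + k) m'" and i: "pw (i + k'') m' = pw (i + k') m''"
    unfolding frac_rel_iff by blast
  have "pw (i + k'') (pw (j + k') m) = pw (j + k) (pw (i + k'') m')"
    unfolding j using c by (simp only: pw_pw add.commute)
  also have "\<dots> = pw (j + k) (pw (i + k') m'')" unfolding i ..
  finally have "pw ((i + j + k') + k'') m = pw ((i + j + k') + k) m''"
    using c by (simp add: pw_pw ac_simps)
  then show "((m, k), (m'', k'')) \<in> frac_rel R s M" unfolding frac_rel_iff using c by blast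
qed

lemma frac_rel_equiv: "equiv (carrier M \<times> UNIV) (frac_rel R s M)"
proof (rule equivI)
  show "frac_rel R s M \<subseteq> (carrier M \<times> UNIV) \<times> (carrier M \<times> UNIV)"
    by (auto simp: frac_rel_def)
  show "refl_on (carrier M \<times> UNIV) (frac_rel R s M)"
    by (rule refl_onI) (auto simp: frac_rel_iff)
  show "sym (frac_rel R s M)"
  proof (rule symI, clarify)
    fix m k m' k' assume "((m, k), (m', k')) \<in> frac_rel R s M"
    then obtain j where "m \<in> carrier M" "m' \<in> carrier M" "pw (j + k') m = pw (j + k) m'"
      unfolding frac_rel_iff by blast
    then show "((m', k'), (m, k)) \<in> frac_rel R s M" unfolding frac_rel_iff by (blast intro: sym)
  qed
qed (rule frac_rel_trans)

lemma fraction_eq_iff: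
  "m \<in> carrier M \<Longrightarrow> m' \<in> carrier M \<Longrightarrow>
    fraction R s M m k = fraction R s M m' k' \<longleftrightarrow> (\<exists>j. pw (j + k') m = pw (j + k) m')"
  unfolding fraction_def using eq_equiv_class_iff[OF frac_rel_equiv, of "(m, k)" "(m', k')"]
    frac_rel_iff[of m k m' k'] by simp

lemma mem_fraction:
  assumes "m \<in> carrier M"
  shows "(m', k') \<in> fraction R s M m k \<longleftrightarrow> m' \<in> carrier M \<and> fraction R s M m' k' = fraction R s M m k"
proof -
  have "(m', k') \<in> fraction R s M m k \<longleftrightarrow> ((m, k), (m', k')) \<in> frac_rel R s M"
    by (simp add: fraction_def)
  also have "\<dots> \<longleftrightarrow> m' \<in> carrier M \<and> fraction R s M m k = fraction R s M m' k'"
    unfolding fraction_def using equiv_class_eq_iff[OF frac_rel_equiv, of "(m, k)" "(m', k')"] assms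
    by (simp add: conj_commute)
  finally show ?thesis by (simp add: eq_commute)
qed

text \<open>
  The operations on fractions are defined as unions over all representatives. Such a union is the value at
  any one representative once the value does not depend on the representative.
\<close>

lemma fraction_Union:
  assumes m: "m \<in> carrier M"
    and F: "\<And>m' k'. m' \<in> carrier M \<Longrightarrow> fraction R s M m' k' = fraction R s M m k \<Longrightarrow> F m' k' = F m k"
  shows "(\<Union>(m', k')\<in>fraction R s M m k. F m' k') = F m k"
proof -
  have 1: "(m, k) \<in> fraction R s M m k" using m by (simp add: mem_fraction)
  have "(\<Union>(m', k')\<in>fraction R s M m k. F m' k') = (\<Union>x\<in>fraction R s M m k. F m k)"
  proof (rule SUP_cong[OF refl])
    fix x assume "x \<in> fraction R s M m k"
    moreover obtain m' k' where "x = (m', k')" by (cases x)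
    ultimately show "(case x of (m', k') \<Rightarrow> F m' k') = F m k" using F[of m' k'] m by (simp add: mem_fraction)
  qed
  also have "\<dots> = F m k" using 1 by blast
  finally show ?thesis .
qed

lemma fraction_carrier:
  "m \<in> carrier M \<Longrightarrow> fraction R s M m k \<in> carrier (loc_mod R s M)"
  by (auto simp: loc_mod_def)

lemma carrier_locE:
  assumes "X \<in> carrier (loc_mod R s M)"
  obtains m k where "m \<in> carrier M" "X = fraction R s M m k"
  using assms by (auto simp: loc_mod_def)

lemma loc_zero: "\<zero>\<^bsub>loc_mod R s M\<^esub> = fraction R s M \<zero> 0"
  by (simp add: loc_mod_def)

lemma fraction_cancel: "m \<in> carrier M \<Longrightarrow> fraction R s M (pw l m) (l + k) = fraction R s M m k"
  using pw_closed by (simp add: fraction_eq_iff pw_pw add.commute add.left_commute)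

lemma fraction_zero: "fraction R s M \<zero> k = fraction R s M \<zero> 0"
  using fraction_cancel[of "\<zero>" k 0] by (simp add: pw_zero)

lemma fraction_add_cong:
  assumes c: "m \<in> carrier M" "m' \<in> carrier M" "n \<in> carrier M"
    and eq: "fraction R s M m' k' = fraction R s M m k"
  shows "fraction R s M (pw l m' \<oplus> pw k' n) (k' + l) = fraction R s M (pw l m \<oplus> pw k n) (k + l)"
proof -
  obtain j where j: "pw (j + k) m' = pw (j + k') m" using eq c by (auto simp: fraction_eq_iff)
  have "pw (l + l) (pw (j + k) m') = pw (l + l) (pw (j + k') m)" unfolding j ..
  then have "pw (j + (k + l)) (pw l m') = pw (j + (k' + l)) (pw l m)"
    unfolding pw_pw[OF c(1)] pw_pw[OF c(2)] by (simp only: ac_simps)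
  moreover have "pw (j + (k + l)) (pw k' n) = pw (j + (k' + l)) (pw k n)"
    unfolding pw_pw[OF c(3)] by (simp only: ac_simps)
  ultimately have "pw (j + (k + l)) (pw l m' \<oplus> pw k' n) = pw (j + (k' + l)) (pw l m \<oplus> pw k n)"
    using c by (simp only: pw_add pw_closed)
  moreover have "pw l m' \<oplus> pw k' n \<in> carrier M" "pw l m \<oplus> pw k n \<in> carrier M"
    by (intro M.a_closed pw_closed c)+
  ultimately show ?thesis using fraction_eq_iff by blast
qed

lemma loc_add:
  assumes c: "m \<in> carrier M" "n \<in> carrier M"
  shows "fraction R s M m k \<oplus>\<^bsub>loc_mod R s M\<^esub> fraction R s M n l =
    fraction R s M (pw l m \<oplus> pw k n) (k + l)"
proof -
  have 1: "fraction R s M (pw l' m \<oplus> pw k n') (k + l') = fraction R s M (pw l m \<oplus> pw k n) (k + l)"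
    if "m \<in> carrier M" "n' \<in> carrier M" "fraction R s M n' l' = fraction R s M n l" for n' l' k m
  proof -
    have "pw l' m \<oplus> pw k n' = pw k n' \<oplus> pw l' m" "pw l m \<oplus> pw k n = pw k n \<oplus> pw l m"
      by (intro M.a_comm pw_closed that c)+
    then show ?thesis
      using fraction_add_cong[OF c(2) that(2,1,3), of k] by (simp add: add.commute)
  qed
  have 2: "(\<Union>(n', l')\<in>fraction R s M n l. fraction R s M (pw l' m' \<oplus> pw k' n') (k' + l')) =
      fraction R s M (pw l m' \<oplus> pw k' n) (k' + l)" if "m' \<in> carrier M" for m' k'
    by (rule fraction_Union[OF c(2)]) (rule 1, use that in auto)
  have "fraction R s M m k \<oplus>\<^bsub>loc_mod R s M\<^esub> fraction R s M n l =
    (\<Union>(m', k')\<in>fraction R s M m k. \<Union>(n', l')\<in>fraction R s M n l.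
      fraction R s M (pw l' m' \<oplus> pw k' n') (k' + l'))"
    by (simp add: loc_mod_def)
  also have "\<dots> = fraction R s M (pw l m \<oplus> pw k n) (k + l)"
    using 2[OF c(1)] fraction_add_cong[OF c(1) _ c(2)] 2 by (subst fraction_Union[OF c(1)]) simp_all
  finally show ?thesis .
qed

lemma module_regular: "module R (regular_mod R)"
proof (rule moduleI)
  show "cring R" by (rule R.cring_axioms)
  show "abelian_group (regular_mod R)"
  proof (rule abelian_groupI)
    show "\<exists>y\<in>carrier (regular_mod R). y \<oplus>\<^bsub>regular_mod R\<^esub> x = \<zero>\<^bsub>regular_mod R\<^esub>"
      if "x \<in> carrier (regular_mod R)" for x
      using that R.l_neg by (auto simp: regular_mod_def intro!: bexI[of _ "\<ominus>\<^bsub>R\<^esub> x"])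
  qed (auto simp: regular_mod_def R.a_ac)
qed (auto simp: regular_mod_def R.l_distr R.r_distr R.m_assoc)

end

lemma (in frac_module) frac_module_regular: "frac_module R s (regular_mod R)"
  by (intro frac_module.intro module_regular s)

lemma (in frac_module) regular_fraction_eq_iff:
  assumes "a \<in> carrier R" "b \<in> carrier R"
  shows "fraction R s (regular_mod R) a k = fraction R s (regular_mod R) b l \<longleftrightarrow>
    (\<exists>j. s [^]\<^bsub>R\<^esub> (j + l) \<otimes>\<^bsub>R\<^esub> a = s [^]\<^bsub>R\<^esub> (j + k) \<otimes>\<^bsub>R\<^esub> b)"
proof -
  interpret reg: frac_module R s "regular_mod R" by (rule frac_module_regular)
  show ?thesis using assms reg.fraction_eq_iff[of a b k l] by (simp add: regular_mod_def)
qed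

context frac_module
begin

interpretation module R M by (rule M)
interpretation reg: frac_module R s "regular_mod R" by (rule frac_module_regular)

lemma loc_smult:
  assumes a: "a \<in> carrier R" and m: "m \<in> carrier M"
  shows "fraction R s (regular_mod R) a j \<odot>\<^bsub>loc_mod R s M\<^esub> fraction R s M m k = fraction R s M (a \<odot> m) (j + k)"
proof -
  have 1: "fraction R s M (b \<odot> n) (i + l) = fraction R s M (b \<odot> m) (i + k)"
    if b: "b \<in> carrier R" and n: "n \<in> carrier M" "fraction R s M n l = fraction R s M m k" for b i n l
  proof -
    obtain t where t: "pw (t + k) n = pw (t + l) m" using n m by (auto simp: fraction_eq_iff)
    have "b \<odot> pw i (pw (t + k) n) = b \<odot> pw i (pw (t + l) m)" unfolding t ..
    then have "pw (t + (i + k)) (b \<odot> n) = pw (t + (i + l)) (b \<odot> m)"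
      using b n m by (simp add: pw_pw pw_smult ac_simps)
    then show ?thesis using b n m by (subst fraction_eq_iff) auto
  qed
  have 2: "fraction R s M (b \<odot> m) (i + k) = fraction R s M (a \<odot> m) (j + k)"
    if b: "b \<in> carrier R" "fraction R s (regular_mod R) b i = fraction R s (regular_mod R) a j" for b i
  proof -
    obtain t where t: "s [^]\<^bsub>R\<^esub> (t + j) \<otimes>\<^bsub>R\<^esub> b = s [^]\<^bsub>R\<^esub> (t + i) \<otimes>\<^bsub>R\<^esub> a"
      using b a by (auto simp: regular_fraction_eq_iff)
    have "pw (t + j) (b \<odot> m) = pw (t + i) (a \<odot> m)"
      using smult_assoc1[OF spow b(1) m, of "t + j"] smult_assoc1[OF spow a m, of "t + i"] t by simp
    then have "pw k (pw (t + j) (b \<odot> m)) = pw k (pw (t + i) (a \<odot> m))" by simp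
    then have "pw (t + (j + k)) (b \<odot> m) = pw (t + (i + k)) (a \<odot> m)"
      using b a m by (simp add: pw_pw ac_simps)
    then show ?thesis using b a m by (subst fraction_eq_iff) auto
  qed
  have ar: "a \<in> carrier (regular_mod R)" using a by (simp add: regular_mod_def)
  have cr: "carrier (regular_mod R) = carrier R" by (simp add: regular_mod_def)
  have 3: "(\<Union>(n, l)\<in>fraction R s M m k. fraction R s M (b \<odot> n) (i + l)) = fraction R s M (b \<odot> m) (i + k)"
    if "b \<in> carrier R" for b i
    by (rule fraction_Union[OF m]) (rule 1[OF that])
  have "fraction R s (regular_mod R) a j \<odot>\<^bsub>loc_mod R s M\<^esub> fraction R s M m k =
    (\<Union>(b, i)\<in>fraction R s (regular_mod R) a j. \<Union>(n, l)\<in>fraction R s M m k. fraction R s M (b \<odot> n) (i + l))"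
    by (simp add: loc_mod_def)
  also have "\<dots> = fraction R s M (a \<odot> m) (j + k)"
    using 3[OF a, of j] 2 by (subst reg.fraction_Union[OF ar]) (simp_all add: 3 cr)
  finally show ?thesis .
qed

end

section \<open>The ring of p-adic integers\<close>

lemma Zp_simps:
  "x \<in> carrier (Zp p) \<longleftrightarrow> (\<forall>n. 0 \<le> x n \<and> x n < int p ^ n \<and> x (Suc n) mod int p ^ n = x n)"
  "x \<otimes>\<^bsub>Zp p\<^esub> y = (\<lambda>n. (x n * y n) mod int p ^ n)"
  "\<one>\<^bsub>Zp p\<^esub> = (\<lambda>n. 1 mod int p ^ n)"
  "\<zero>\<^bsub>Zp p\<^esub> = (\<lambda>n. 0)"
  by (auto simp: Zp_def)

lemma Zp_pow: "Zp_p p [^]\<^bsub>Zp p\<^esub> (v::nat) = (\<lambda>n. int p ^ v mod int p ^ n)"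
  by (induction v) (simp_all add: Zp_simps nat_pow_def Zp_p_def mod_mult_eq mult.commute)

lemma Zp_p_carrier:
  assumes "p > 0"
  shows "Zp_p p \<in> carrier (Zp p)"
proof -
  have "int p ^ n dvd int p ^ Suc n" for n by simp
  then show ?thesis using assms by (simp add: Zp_simps Zp_p_def mod_mod_cancel del: power_Suc)
qed

lemma Zp_mod:
  assumes "x \<in> carrier (Zp p)"
  shows "x (n + m) mod int p ^ n = x n"
proof (induction m)
  case 0
  then show ?case using assms by (simp add: Zp_simps)
next
  case (Suc m)
  have "x (n + Suc m) mod int p ^ n = (x (n + Suc m) mod int p ^ (n + m)) mod int p ^ n"
    by (simp add: mod_mod_cancel power_add)
  also have "\<dots> = x n" using assms Suc by (simp add: Zp_simps)
  finally show ?case .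
qed

text \<open>All components of \<open>u\<close> are prime to \<open>p\<close>, and their inverses modulo the powers of \<open>p\<close> are compatible because
  they are unique.\<close>

lemma Zp_unit:
  assumes p: "prime p" and u: "u \<in> carrier (Zp p)" "u 1 \<noteq> 0"
  obtains w where "w \<in> carrier (Zp p)" "\<And>n. (w n * u n) mod int p ^ n = 1 mod int p ^ n"
proof -
  have p0: "int p > 0" using prime_gt_0_nat[OF p] by simp
  have cop: "coprime (u n) (int p ^ n)" for n
  proof (cases n)
    case (Suc m)
    have "u n mod int p = u 1" using Zp_mod[OF u(1), of 1 m] Suc by simp
    then have "\<not> int p dvd u n" using u(2) by (auto simp: dvd_eq_mod_eq_0)
    then have "coprime (int p) (u n)" using p by (intro prime_imp_coprime) auto
    then show ?thesis by (simp add: coprime_commute)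
  qed simp
  have "\<exists>x. [u n * x = 1] (mod int p ^ n)" for n using cong_solve_coprime_int[OF cop] .
  then obtain x where x: "\<And>n. [u n * x n = 1] (mod int p ^ n)" by metis
  define w where "w n = x n mod int p ^ n" for n
  have wu: "[u n * w n = 1] (mod int p ^ n)" for n
    using x[of n] unfolding w_def cong_def by (simp add: mod_mult_right_eq)
  have "w (Suc n) mod int p ^ n = w n" for n
  proof -
    have "[u (Suc n) * w (Suc n) = 1] (mod int p ^ n)"
      using wu[of "Suc n"] by (rule cong_dvd_modulus) simp
    moreover have "[u (Suc n) = u n] (mod int p ^ n)" using u(1) by (simp add: Zp_simps cong_def)
    ultimately have "[u n * w (Suc n) = 1] (mod int p ^ n)"
      by (meson cong_scalar_right cong_sym cong_trans)
    then have "[u n * w (Suc n) = u n * w n] (mod int p ^ n)" using wu[of n] cong_sym cong_trans by blast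
    then have "[w (Suc n) = w n] (mod int p ^ n)" using cong_mult_lcancel[OF cop] by blast
    then show ?thesis by (simp add: cong_def w_def[of n])
  qed
  then have "w \<in> carrier (Zp p)" using p0 by (simp add: Zp_simps) (simp add: w_def)
  moreover have "(w n * u n) mod int p ^ n = 1 mod int p ^ n" for n
    using wu[of n] by (simp add: cong_def mult.commute)
  ultimately show ?thesis by (rule that)
qed

text \<open>If \<open>v + 1\<close> is the first component at which \<open>a\<close> does not vanish, then \<open>a = u p\<^sup>v\<close> with a unit \<open>u\<close>, whose
  \<open>m\<close>-th component is the quotient of the \<open>(v + m)\<close>-th component of \<open>a\<close> by \<open>p\<^sup>v\<close>.\<close>

lemma Zp_power_associates:
  assumes p: "prime p"
  shows "power_associates (Zp p) (Zp_p p)"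
  unfolding power_associates_def
proof (intro conjI ballI impI)
  have p0: "int p > 0" using prime_gt_0_nat[OF p] by simp
  show "Zp_p p \<in> carrier (Zp p)" using Zp_p_carrier prime_gt_0_nat[OF p] .
  fix a assume a: "a \<in> carrier (Zp p)" "a \<noteq> \<zero>\<^bsub>Zp p\<^esub>"
  then have ex: "\<exists>n. a n \<noteq> 0" by (auto simp: Zp_simps)
  define N where "N = (LEAST n. a n \<noteq> 0)"
  have N: "a N \<noteq> 0" unfolding N_def using ex by (rule LeastI_ex)
  have "0 \<le> a 0 \<and> a 0 < 1" using a(1) unfolding Zp_simps by (metis power_0)
  then have "N \<noteq> 0" using N by (metis zless_add1_eq add_0 order_antisym_conv zle_add1_eq_le)
  then obtain v where v: "N = Suc v" by (cases N) auto
  have av: "a v = 0" using not_less_Least[of v "\<lambda>n. a n \<noteq> 0"] v N_def by auto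
  define u where "u m = a (v + m) div int p ^ v" for m
  have ua: "a (v + m) = int p ^ v * u m" for m
    using Zp_mod[OF a(1), of v m] av unfolding u_def by (simp add: dvd_eq_mod_eq_0[symmetric])
  have pv: "int p ^ n > 0" for n using p0 by simp
  have u: "u \<in> carrier (Zp p)" unfolding Zp_simps
  proof (intro allI conjI)
    fix n
    have b: "0 \<le> a (v + n)" "a (v + n) < int p ^ (v + n)" using a(1) by (auto simp: Zp_simps)
    show "0 \<le> u n" using b(1) pv[of v] by (simp add: u_def pos_imp_zdiv_nonneg_iff)
    have "int p ^ v * u n < int p ^ v * int p ^ n" using b(2) unfolding ua power_add .
    then show "u n < int p ^ n" using pv[of v] by simp
    have "a (v + Suc n) mod int p ^ (v + n) = a (v + n)" using a(1) by (simp add: Zp_simps)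
    then have "int p ^ v * (u (Suc n) mod int p ^ n) = int p ^ v * u n"
      unfolding ua power_add mult_mod_right .
    then show "u (Suc n) mod int p ^ n = u n" using p0 by simp
  qed
  have "u 1 \<noteq> 0" using N ua[of 1] v by auto
  then obtain w where w: "w \<in> carrier (Zp p)" "\<And>n. (w n * u n) mod int p ^ n = 1 mod int p ^ n"
    using Zp_unit[OF p u] by blast
  have an: "a n = (int p ^ v * u n) mod int p ^ n" for n
    using Zp_mod[OF a(1), of n v] ua[of n] by (simp add: add.commute)
  have "a = u \<otimes>\<^bsub>Zp p\<^esub> Zp_p p [^]\<^bsub>Zp p\<^esub> v"
    unfolding Zp_pow Zp_simps by (rule ext) (simp add: an mod_mult_right_eq mult.commute)
  moreover have "Zp_p p [^]\<^bsub>Zp p\<^esub> v = w \<otimes>\<^bsub>Zp p\<^esub> a"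
    unfolding Zp_pow Zp_simps
  proof (rule ext)
    fix n
    have "(w n * a n) mod int p ^ n = (int p ^ v * (w n * u n)) mod int p ^ n"
      unfolding an by (simp add: mod_mult_right_eq ac_simps)
    also have "\<dots> = (int p ^ v * ((w n * u n) mod int p ^ n)) mod int p ^ n" by (simp add: mod_mult_right_eq)
    also have "\<dots> = int p ^ v mod int p ^ n" unfolding w(2) by (simp add: mod_mult_right_eq)
    finally show "int p ^ v mod int p ^ n = (w n * a n) mod int p ^ n" ..
  qed
  ultimately show "\<exists>v::nat. \<exists>u\<in>carrier (Zp p). \<exists>w\<in>carrier (Zp p).
      a = u \<otimes>\<^bsub>Zp p\<^esub> Zp_p p [^]\<^bsub>Zp p\<^esub> v \<and> Zp_p p [^]\<^bsub>Zp p\<^esub> v = w \<otimes>\<^bsub>Zp p\<^esub> a"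
    using u w(1) by blast
qed

section \<open>Localization at a uniformizer\<close>

context frac_module
begin

interpretation module R M by (rule M)
interpretation reg: frac_module R s "regular_mod R" by (rule frac_module_regular)

text \<open>If \<open>s\<^sup>v = w b\<close>, then \<open>w s\<^sup>k / s\<^sup>v\<close> is an inverse of \<open>b / s\<^sup>k\<close>.\<close>

lemma loc_ring_inverse:
  assumes pa: "power_associates R s" and a: "a \<in> carrier (loc_ring R s)" "a \<noteq> \<zero>\<^bsub>loc_ring R s\<^esub>"
  shows "\<exists>b\<in>carrier (loc_ring R s). b \<otimes>\<^bsub>loc_ring R s\<^esub> a = \<one>\<^bsub>loc_ring R s\<^esub>"
proof -
  have cr: "carrier (regular_mod R) = carrier R" "smult (regular_mod R) = mult R"
    "\<zero>\<^bsub>regular_mod R\<^esub> = \<zero>\<^bsub>R\<^esub>" by (simp_all add: regular_mod_def)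
  obtain b k where b: "b \<in> carrier R" "a = fraction R s (regular_mod R) b k"
    using a(1) reg.carrier_locE unfolding loc_ring_def Let_def cr by auto
  have "b \<noteq> \<zero>\<^bsub>R\<^esub>"
    using a(2) b reg.loc_zero reg.fraction_zero by (auto simp: loc_ring_def Let_def cr)
  then obtain v :: nat and w where v: "w \<in> carrier R" "s [^]\<^bsub>R\<^esub> v = w \<otimes>\<^bsub>R\<^esub> b"
    using pa b(1) unfolding power_associates_def by blast
  define c where "c = w \<otimes>\<^bsub>R\<^esub> s [^]\<^bsub>R\<^esub> k"
  have c: "c \<in> carrier R" using v(1) spow[of k] by (simp add: c_def)
  have cb: "c \<otimes>\<^bsub>R\<^esub> b = s [^]\<^bsub>R\<^esub> (k + v)"
  proof -
    have "c \<otimes>\<^bsub>R\<^esub> b = s [^]\<^bsub>R\<^esub> k \<otimes>\<^bsub>R\<^esub> (w \<otimes>\<^bsub>R\<^esub> b)"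
      unfolding c_def using v(1) b(1) spow[of k] by (simp add: R.m_ac)
    then show ?thesis unfolding v(2)[symmetric] using R.nat_pow_mult[OF s] by simp
  qed
  have "fraction R s (regular_mod R) c v \<odot>\<^bsub>loc_mod R s (regular_mod R)\<^esub> a =
      fraction R s (regular_mod R) (c \<otimes>\<^bsub>R\<^esub> b) (v + k)"
    using reg.loc_smult[of c b v k] c b by (simp add: cr)
  also have "\<dots> = fraction R s (regular_mod R) \<one>\<^bsub>R\<^esub> 0"
    unfolding cb using spow[of "k + v"] by (subst regular_fraction_eq_iff) (auto simp: add.commute intro!: exI[of _ 0])
  finally show ?thesis
    using reg.fraction_carrier[of c v] c
    by (intro bexI[of _ "fraction R s (regular_mod R) c v"]) (simp_all add: loc_ring_def Let_def cr)
qed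

end

text \<open>
  The localization of \<open>M\<close> is computed by a complex \<open>Q\<close> over the localized ring with finitely generated terms;
  that ring is a field or zero by \<open>loc_ring_inverse\<close>.
\<close>

locale perfect_after_localization =
  fixes R :: "'r ring" and s :: 'r and M :: "('r, 'm) cochain"
    and Q :: "(('r \<times> nat) set, 'q) cochain" and f :: "int \<Rightarrow> 'q \<Rightarrow> ('m \<times> nat) set"
  assumes M: "cochain_complex R M" and s: "power_associates R s"
    and Q: "cochain_complex (loc_ring R s) Q" "\<And>n. fin_generated (loc_ring R s) (cmodule Q n)"
    and f: "quasi_iso (loc_ring R s) Q (loc_cochain R s M) f"
begin

abbreviation "D \<equiv> loc_cochain R s M"
abbreviation "K \<equiv> loc_ring R s"

lemma frac: "frac_module R s (cmodule M n)"
  using s by (intro frac_module.intro cmodule_module[OF M]) (simp add: power_associates_def)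

lemma D_module: "cmodule D n = loc_mod R s (cmodule M n)"
  by (simp add: loc_cochain_def)

lemma D_diff:
  assumes m: "m \<in> carrier (cmodule M n)"
  shows "cdiff D n (fraction R s (cmodule M n) m k) = fraction R s (cmodule M (n + 1)) (cdiff M n m) k"
proof -
  interpret F: frac_module R s "cmodule M n" by (rule frac)
  interpret F': frac_module R s "cmodule M (n + 1)" by (rule frac)
  note d = mod_homD[OF cdiff_hom[OF M, of n]]
  have "cdiff D n (fraction R s (cmodule M n) m k) =
      (\<Union>(m, k)\<in>fraction R s (cmodule M n) m k. fraction R s (cmodule M (n + 1)) (cdiff M n m) k)"
    by (simp add: loc_cochain_def)
  also have "\<dots> = fraction R s (cmodule M (n + 1)) (cdiff M n m) k"
  proof (rule F.fraction_Union[OF m])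
    fix m' k' assume m': "m' \<in> carrier (cmodule M n)"
      and eq: "fraction R s (cmodule M n) m' k' = fraction R s (cmodule M n) m k"
    obtain j where "F.pw (j + k) m' = F.pw (j + k') m" using eq m m' by (auto simp: F.fraction_eq_iff)
    then have "F'.pw (j + k) (cdiff M n m') = F'.pw (j + k') (cdiff M n m)"
      using d(3)[OF F.spow m'] d(3)[OF F.spow m] by metis
    then show "fraction R s (cmodule M (n + 1)) (cdiff M n m') k' = fraction R s (cmodule M (n + 1)) (cdiff M n m) k"
      using d(1)[OF m] d(1)[OF m'] F'.fraction_eq_iff by blast
  qed
  finally show ?thesis .
qed

lemma f_hom: "f n \<in> mod_hom K (cmodule Q n) (loc_mod R s (cmodule M n))"
  using f by (simp add: quasi_iso_def chain_map_def D_module)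

lemma terms_finite_length: "rlen K (cmodule Q n) {\<zero>\<^bsub>cmodule Q n\<^esub>} (carrier (cmodule Q n)) \<noteq> \<infinity>"
  using frac_module.loc_ring_inverse[OF frac s]
  by (intro fin_generated_field_finite_length cmodule_module[OF Q(1)] Q(2)) blast

text \<open>The part of \<open>Q\<^sup>n\<close> that lands in the localization of \<open>N\<close>.\<close>

definition pullback :: "int \<Rightarrow> 'm set \<Rightarrow> 'q set"
  where "pullback n N =
    {q \<in> carrier (cmodule Q n). \<exists>m\<in>N. \<exists>k. f n q = fraction R s (cmodule M n) m k}"

lemma pullback_submodule:
  assumes N: "submodule N R (cmodule M n)"
  shows "submodule (pullback n N) K (cmodule Q n)"
proof -
  interpret F: frac_module R s "cmodule M n" by (rule frac)
  interpret Mn: module R "cmodule M n" by (rule F.M)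
  interpret Qn: module K "cmodule Q n" by (rule cmodule_module[OF Q(1)])
  note DN = submoduleD[OF F.M N] and fD = mod_homD[OF f_hom]
  have smult: "c \<odot>\<^bsub>cmodule Q n\<^esub> q \<in> pullback n N"
    if c: "c \<in> carrier K" and q: "q \<in> carrier (cmodule Q n)" "f n q = fraction R s (cmodule M n) m k"
      and m: "\<And>a. a \<in> carrier R \<Longrightarrow> c = fraction R s (regular_mod R) a j \<Longrightarrow> a \<odot>\<^bsub>cmodule M n\<^esub> m \<in> N"
      and mc: "m \<in> carrier (cmodule M n)" and j: "\<exists>a\<in>carrier R. c = fraction R s (regular_mod R) a j"
    for c q m k j
  proof -
    obtain a where a: "a \<in> carrier R" "c = fraction R s (regular_mod R) a j" using j by blast
    have "f n (c \<odot>\<^bsub>cmodule Q n\<^esub> q) = fraction R s (cmodule M n) (a \<odot>\<^bsub>cmodule M n\<^esub> m) (j + k)"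
      using fD(3)[OF c q(1)] F.loc_smult[OF a(1) mc] a(2) q(2) by simp
    then show ?thesis using m[OF a] Qn.smult_closed[OF c q(1)] unfolding pullback_def by blast
  qed
  have K_elem: "\<exists>j. \<exists>a\<in>carrier R. c = fraction R s (regular_mod R) a j" if "c \<in> carrier K" for c
    using that by (auto simp: loc_ring_def Let_def loc_mod_def regular_mod_def)
  have K_zero: "\<zero>\<^bsub>K\<^esub> = fraction R s (regular_mod R) \<zero>\<^bsub>R\<^esub> 0"
    by (simp add: loc_ring_def Let_def loc_mod_def regular_mod_def)
  show ?thesis unfolding submodule_iff[OF cmodule_module[OF Q(1)]]
  proof (intro conjI ballI)
    show "pullback n N \<subseteq> carrier (cmodule Q n)" by (auto simp: pullback_def)
    obtain m k where mk: "m \<in> carrier (cmodule M n)" "f n \<zero>\<^bsub>cmodule Q n\<^esub> = fraction R s (cmodule M n) m k"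
      using fD(1)[OF Qn.M.zero_closed] F.carrier_locE by blast
    have "f n (\<zero>\<^bsub>K\<^esub> \<odot>\<^bsub>cmodule Q n\<^esub> \<zero>\<^bsub>cmodule Q n\<^esub>) =
        fraction R s (cmodule M n) (\<zero>\<^bsub>R\<^esub> \<odot>\<^bsub>cmodule M n\<^esub> m) (0 + k)"
      unfolding fD(3)[OF Qn.R.zero_closed Qn.M.zero_closed] unfolding mk(2) K_zero
      by (rule F.loc_smult[OF Mn.R.zero_closed mk(1)])
    then have "f n \<zero>\<^bsub>cmodule Q n\<^esub> = fraction R s (cmodule M n) \<zero>\<^bsub>cmodule M n\<^esub> k"
      using mk(1) by simp
    then show "\<zero>\<^bsub>cmodule Q n\<^esub> \<in> pullback n N" using DN(2) unfolding pullback_def by blast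
    fix x assume "x \<in> pullback n N"
    then obtain m k where x: "x \<in> carrier (cmodule Q n)" "m \<in> N" "f n x = fraction R s (cmodule M n) m k"
      unfolding pullback_def by blast
    show "x \<oplus>\<^bsub>cmodule Q n\<^esub> y \<in> pullback n N" if y: "y \<in> pullback n N" for y
    proof -
      obtain m' k' where y: "y \<in> carrier (cmodule Q n)" "m' \<in> N" "f n y = fraction R s (cmodule M n) m' k'"
        using y unfolding pullback_def by blast
      have "f n (x \<oplus>\<^bsub>cmodule Q n\<^esub> y) = fraction R s (cmodule M n) (F.pw k' m \<oplus>\<^bsub>cmodule M n\<^esub> F.pw k m') (k + k')"
        unfolding fD(2)[OF x(1) y(1)] x(3) y(3) by (rule F.loc_add[OF DN(3)[OF x(2)] DN(3)[OF y(2)]])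
      moreover have "F.pw k' m \<oplus>\<^bsub>cmodule M n\<^esub> F.pw k m' \<in> N" by (intro DN(4) DN(7) F.spow x y)
      ultimately show ?thesis using x(1) y(1) unfolding pullback_def by blast
    qed
    show "c \<odot>\<^bsub>cmodule Q n\<^esub> x \<in> pullback n N" if c: "c \<in> carrier K" for c
    proof -
      obtain j where j: "\<exists>a\<in>carrier R. c = fraction R s (regular_mod R) a j" using K_elem[OF c] by blast
      show ?thesis by (rule smult[OF c x(1,3) DN(7)[OF _ x(2)] DN(3)[OF x(2)] j])
    qed
  qed
qed

text \<open>Every class in \<open>H\<^sup>n(M)\<close> becomes, after localization, the class of some cocycle of \<open>Q\<close>. So \<open>pullback n\<close>
  detects the difference of two submodules between \<open>B\<^sup>n\<close> and \<open>Z\<^sup>n\<close> up to torsion.\<close>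

lemma torsion_over_if_pullback:
  assumes N: "submodule N R (cmodule M n)" "submodule N' R (cmodule M n)"
    and B: "coboundaries M n \<subseteq> N" "coboundaries M n \<subseteq> N'" and Z: "N' \<subseteq> cocycles M n"
    and le: "pullback n N' \<subseteq> pullback n N"
  shows "torsion_over R s (cmodule M n) N N'"
  unfolding torsion_over_def
proof
  fix x assume x: "x \<in> N'"
  interpret F: frac_module R s "cmodule M n" by (rule frac)
  interpret F1: frac_module R s "cmodule M (n + 1)" by (rule frac)
  interpret Fm: frac_module R s "cmodule M (n - 1)" by (rule frac)
  interpret Mn: module R "cmodule M n" by (rule F.M)
  interpret Mm: module R "cmodule M (n - 1)" by (rule Fm.M)
  note DN = submoduleD[OF F.M N(1)] and DN' = submoduleD[OF F.M N(2)]
  note dm = mod_homD[OF cdiff_hom'[OF M, of n]]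
  have D_bd: "b \<in> coboundaries D n \<longleftrightarrow>
      (\<exists>m\<in>carrier (cmodule M (n - 1)). \<exists>k. b = fraction R s (cmodule M n) (cdiff M (n - 1) m) k)" for b
  proof
    assume "b \<in> coboundaries D n"
    then obtain X where X: "X \<in> carrier (loc_mod R s (cmodule M (n - 1)))" "b = cdiff D (n - 1) X"
      by (auto simp: coboundaries_def D_module)
    obtain m k where m: "m \<in> carrier (cmodule M (n - 1))" "X = fraction R s (cmodule M (n - 1)) m k"
      using X(1) Fm.carrier_locE by blast
    then show "\<exists>m\<in>carrier (cmodule M (n - 1)). \<exists>k. b = fraction R s (cmodule M n) (cdiff M (n - 1) m) k"
      using D_diff[OF m(1), of k] X(2) by auto
  next
    assume "\<exists>m\<in>carrier (cmodule M (n - 1)). \<exists>k. b = fraction R s (cmodule M n) (cdiff M (n - 1) m) k"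
    then obtain m k where m: "m \<in> carrier (cmodule M (n - 1))" "b = fraction R s (cmodule M n) (cdiff M (n - 1) m) k"
      by blast
    then have "b = cdiff D (n - 1) (fraction R s (cmodule M (n - 1)) m k)" using D_diff[OF m(1), of k] by simp
    then show "b \<in> coboundaries D n"
      using Fm.fraction_carrier[OF m(1)] unfolding coboundaries_def D_module by blast
  qed
  have xc: "x \<in> carrier (cmodule M n)" using DN'(3)[OF x] .
  let ?x = "fraction R s (cmodule M n) x 0"
  have dx: "cdiff M n x = \<zero>\<^bsub>cmodule M (n + 1)\<^esub>" using x Z by (auto simp: cocycles_def)
  have "?x \<in> cocycles D n"
    using F.fraction_carrier[OF xc] D_diff[OF xc, of 0] dx F1.loc_zero
    by (simp add: cocycles_def D_module)
  then have "coboundaries D n +>\<^bsub>cmodule D n\<^esub> ?x \<in> carrier (cohomology D n)"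
    by (simp add: carrier_cohomology)
  also have "carrier (cohomology D n) = coh_map D f n ` carrier (cohomology Q n)"
    using f by (auto simp: quasi_iso_def bij_betw_def)
  finally obtain q where q: "q \<in> cocycles Q n"
    "coboundaries D n +>\<^bsub>cmodule D n\<^esub> ?x = coh_map D f n (coboundaries Q n +>\<^bsub>cmodule Q n\<^esub> q)"
    by (auto simp: carrier_cohomology)
  have qc: "q \<in> carrier (cmodule Q n)" using q(1) by (simp add: cocycles_def)
  have qq: "q \<in> coboundaries Q n +>\<^bsub>cmodule Q n\<^esub> q"
    using coset_self[OF cmodule_module[OF Q(1)] coboundaries_submodule[OF Q(1)] qc] .
  (* The zero fraction is a coboundary, hence f q lies in its own coset and differs from x / 1 by a coboundary. *)
  obtain m k where mk: "m \<in> carrier (cmodule M n)" "f n q = fraction R s (cmodule M n) m k"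
    using mod_homD(1)[OF f_hom qc] F.carrier_locE by blast
  have "fraction R s (cmodule M n) \<zero>\<^bsub>cmodule M n\<^esub> 0 \<in> coboundaries D n"
    unfolding D_bd using Mm.M.zero_closed mod_hom_zero_minus(1)[OF Fm.M F.M cdiff_hom'[OF M]] by metis
  moreover have "fraction R s (cmodule M n) \<zero>\<^bsub>cmodule M n\<^esub> 0 \<oplus>\<^bsub>cmodule D n\<^esub> f n q = f n q"
    unfolding D_module mk(2) using mk(1) F.pw_zero by (simp add: F.loc_add)
  ultimately have "f n q \<in> coboundaries D n +>\<^bsub>cmodule D n\<^esub> f n q" by (force simp: a_r_coset_def')
  then have "f n q \<in> coboundaries D n +>\<^bsub>cmodule D n\<^esub> ?x" unfolding q(2) coh_map_def using qq by blast
  then obtain b where b: "b \<in> coboundaries D n" "f n q = b \<oplus>\<^bsub>cmodule D n\<^esub> ?x" by (auto simp: a_r_coset_def')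
  then obtain m' k' where m': "m' \<in> carrier (cmodule M (n - 1))"
      "b = fraction R s (cmodule M n) (cdiff M (n - 1) m') k'"
    unfolding D_bd by blast
  let ?d = "cdiff M (n - 1) m'"
  have dB: "?d \<in> coboundaries M n" using m'(1) by (simp add: coboundaries_def)
  have dc: "?d \<in> carrier (cmodule M n)" using dm(1)[OF m'(1)] .
  let ?y = "?d \<oplus>\<^bsub>cmodule M n\<^esub> F.pw k' x"
  have fq: "f n q = fraction R s (cmodule M n) ?y k'"
    unfolding b(2) m'(2) D_module using F.loc_add[OF dc xc, of k' 0] dc by simp
  have yc: "?y \<in> carrier (cmodule M n)" using dc xc F.pw_closed by blast
  have "?y \<in> N'" using dB B by (intro DN'(4) DN'(7) F.spow x) auto
  then have "q \<in> pullback n N'" using qc fq unfolding pullback_def by blast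
  then obtain m1 k1 where m1: "m1 \<in> N" "f n q = fraction R s (cmodule M n) m1 k1"
    using le unfolding pullback_def by blast
  obtain j where j: "F.pw (j + k1) ?y = F.pw (j + k') m1"
    using m1(2) fq F.fraction_eq_iff[OF yc DN(3)[OF m1(1)]] by auto
  have "F.pw (j + k1) ?y \<in> N" unfolding j by (intro DN(7) F.spow m1)
  moreover have "F.pw (j + k1) ?y = F.pw (j + k1) ?d \<oplus>\<^bsub>cmodule M n\<^esub> F.pw (j + k1 + k') x"
    using F.pw_add[OF dc F.pw_closed[OF xc]] F.pw_pw[OF xc] by simp
  moreover have "F.pw (j + k1) ?d \<in> N" using dB B by (intro DN(7) F.spow) auto
  moreover have "F.pw (j + k1 + k') x \<in> carrier (cmodule M n)" "F.pw (j + k1) ?d \<in> carrier (cmodule M n)"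
    by (intro F.pw_closed xc dc)+
  ultimately have "F.pw (j + k1 + k') x \<in> N" using DN(5) Mn.M.minus_cancel(4) by metis
  then show "\<exists>k::nat. F.pw k x \<in> N" by blast
qed

end

section \<open>Direct sums and fibres\<close>

lemma dsum_simps:
  "carrier (dsum_mod M N) = carrier M \<times> carrier N"
  "\<zero>\<^bsub>dsum_mod M N\<^esub> = (\<zero>\<^bsub>M\<^esub>, \<zero>\<^bsub>N\<^esub>)"
  "(x, y) \<oplus>\<^bsub>dsum_mod M N\<^esub> (x', y') = (x \<oplus>\<^bsub>M\<^esub> x', y \<oplus>\<^bsub>N\<^esub> y')"
  "r \<odot>\<^bsub>dsum_mod M N\<^esub> (x, y) = (r \<odot>\<^bsub>M\<^esub> x, r \<odot>\<^bsub>N\<^esub> y)"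
  by (simp_all add: dsum_mod_def)

lemma module_dsum:
  assumes M: "module R M" and N: "module R N"
  shows "module R (dsum_mod M N)"
proof -
  interpret M: module R M by (rule M)
  interpret N: module R N by (rule N)
  show ?thesis
  proof (rule moduleI)
    show "cring R" by (rule M.R.cring_axioms)
    show "abelian_group (dsum_mod M N)"
    proof (rule abelian_groupI)
      fix w assume "w \<in> carrier (dsum_mod M N)"
      then obtain x y where w: "x \<in> carrier M" "y \<in> carrier N" "w = (x, y)" by (auto simp: dsum_simps)
      then have "(\<ominus>\<^bsub>M\<^esub> x, \<ominus>\<^bsub>N\<^esub> y) \<oplus>\<^bsub>dsum_mod M N\<^esub> w = \<zero>\<^bsub>dsum_mod M N\<^esub>"
        by (simp add: dsum_simps M.M.l_neg N.M.l_neg)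
      then show "\<exists>v\<in>carrier (dsum_mod M N). v \<oplus>\<^bsub>dsum_mod M N\<^esub> w = \<zero>\<^bsub>dsum_mod M N\<^esub>"
        using w by (intro bexI[of _ "(\<ominus>\<^bsub>M\<^esub> x, \<ominus>\<^bsub>N\<^esub> y)"]) (auto simp: dsum_simps)
    qed (auto simp: dsum_simps M.M.a_ac N.M.a_ac)
  qed (auto simp: dsum_simps M.smult_l_distr N.smult_l_distr M.smult_r_distr N.smult_r_distr
      M.smult_assoc1 N.smult_assoc1)
qed

lemma chain_mapD:
  assumes "chain_map R C D f"
  shows "f n \<in> mod_hom R (cmodule C n) (cmodule D n)"
    and "x \<in> carrier (cmodule C n) \<Longrightarrow> f (n + 1) (cdiff C n x) = cdiff D n (f n x)"
  using assms by (simp_all add: chain_map_def)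

text \<open>The union over representatives in \<^const>\<open>coh_map\<close> is a single coset by \<open>coset_map\<close>.\<close>

lemma coh_map_induced:
  fixes R :: "'r ring" and C :: "('r, 'm) cochain" and D :: "('r, 'n) cochain"
  assumes C: "cochain_complex R C" and D: "cochain_complex R D" and f: "chain_map R C D f"
  shows "coh_map D f n \<in> mod_hom R (cohomology C n) (cohomology D n)"
    and "x \<in> cocycles C n \<Longrightarrow>
      coh_map D f n (coboundaries C n +>\<^bsub>cmodule C n\<^esub> x) = coboundaries D n +>\<^bsub>cmodule D n\<^esub> f n x"
    and "x \<in> cocycles C n \<Longrightarrow> f n x \<in> cocycles D n"
    and "x \<in> coboundaries C n \<Longrightarrow> f n x \<in> coboundaries D n"
proof -
  note fD = mod_homD[OF chain_mapD(1)[OF f]]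
  have Z: "f n x \<in> cocycles D n" if "x \<in> cocycles C n" for x
  proof -
    have x: "x \<in> carrier (cmodule C n)" "cdiff C n x = \<zero>\<^bsub>cmodule C (n + 1)\<^esub>"
      using that by (auto simp: cocycles_def)
    have "cdiff D n (f n x) = \<zero>\<^bsub>cmodule D (n + 1)\<^esub>"
      using chain_mapD(2)[OF f x(1)] x(2)
        mod_hom_zero_minus(1)[OF cmodule_module[OF C] cmodule_module[OF D] chain_mapD(1)[OF f], of "n + 1"]
      by simp
    then show ?thesis using fD(1)[OF x(1)] by (simp add: cocycles_def)
  qed
  have B: "f n x \<in> coboundaries D n" if "x \<in> coboundaries C n" for x
  proof -
    obtain u where u: "u \<in> carrier (cmodule C (n - 1))" "x = cdiff C (n - 1) u"
      using \<open>x \<in> coboundaries C n\<close> by (auto simp: coboundaries_def)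
    have "f n x = cdiff D (n - 1) (f (n - 1) u)" using chain_mapD(2)[OF f u(1)] u(2) by simp
    then show ?thesis using fD(1)[OF u(1)] by (auto simp: coboundaries_def)
  qed
  have h: "f n \<in> mod_hom R (cmodule C n \<restriction> cocycles C n) (cmodule D n)"
    by (rule mod_hom_restrict_full[OF chain_mapD(1)[OF f]]) (auto simp: cocycles_def)
  note ind = induced_hom[OF cmodule_module[OF C] coboundaries_submodule[OF C] cocycles_submodule[OF C]
      coboundaries_cocycles[OF C] cmodule_module[OF D] coboundaries_submodule[OF D] cocycles_submodule[OF D]
      coboundaries_cocycles[OF D] h]
  show "coh_map D f n \<in> mod_hom R (cohomology C n) (cohomology D n)"
    using ind(1) Z B by (auto simp: coh_map_def cohomology_def fun_eq_iff[of "coh_map D f n", symmetric]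
        coh_map_def[abs_def])
  show "coh_map D f n (coboundaries C n +>\<^bsub>cmodule C n\<^esub> x) = coboundaries D n +>\<^bsub>cmodule D n\<^esub> f n x"
    if "x \<in> cocycles C n" using ind(2)[OF _ _ that] Z B unfolding coh_map_def by blast
  show "x \<in> cocycles C n \<Longrightarrow> f n x \<in> cocycles D n" by (rule Z)
  show "x \<in> coboundaries C n \<Longrightarrow> f n x \<in> coboundaries D n" by (rule B)
qed

locale complex_endo =
  fixes R :: "'r ring" and M :: "('r, 'm) cochain" and \<theta> :: "int \<Rightarrow> 'm \<Rightarrow> 'm"
  assumes M: "cochain_complex R M" and \<theta>: "chain_map R M M \<theta>"
begin

abbreviation "C \<equiv> cmodule M"
abbreviation "d \<equiv> cdiff M"
abbreviation "B \<equiv> coboundaries M"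
abbreviation "Z \<equiv> cocycles M"
abbreviation "F \<equiv> fib M M \<theta>"
abbreviation "A \<equiv> cohomology M"
abbreviation "T \<equiv> coh_map M \<theta>"
abbreviation cls :: "int \<Rightarrow> 'm \<Rightarrow> 'm set"
  where "cls n x \<equiv> B n +>\<^bsub>C n\<^esub> x"

lemmas Mmod = cmodule_module[OF M] and Bsub = coboundaries_submodule[OF M]
  and Zsub = cocycles_submodule[OF M] and BZ = coboundaries_cocycles[OF M]
  and Amod = cohomology_module[OF M]
lemmas dD = mod_homD[OF cdiff_hom[OF M]] mod_hom_zero_minus[OF Mmod Mmod cdiff_hom[OF M]]
lemmas dD' = mod_homD[OF cdiff_hom'[OF M]] mod_hom_zero_minus[OF Mmod Mmod cdiff_hom'[OF M]]
lemmas tD = mod_homD[OF chain_mapD(1)[OF \<theta>]] mod_hom_zero_minus[OF Mmod Mmod chain_mapD(1)[OF \<theta>]]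
lemmas \<theta>_coh = coh_map_induced[OF M M \<theta>]
lemmas BD = submoduleD[OF Mmod Bsub] and ZD = submoduleD[OF Mmod Zsub]

lemma cocyclesD: "x \<in> Z n \<Longrightarrow> d n x = \<zero>\<^bsub>C (n + 1)\<^esub>"
  by (simp add: cocycles_def)

lemma d_theta: "x \<in> carrier (C n) \<Longrightarrow> d n (\<theta> n x) = \<theta> (n + 1) (d n x)"
  using chain_mapD(2)[OF \<theta>] by simp

lemma fib_simps: "cmodule F n = dsum_mod (C n) (C (n - 1))"
  "cdiff F n (x, y) = (d n x, \<theta> n x \<ominus>\<^bsub>C n\<^esub> d (n - 1) y)"
  by (simp_all add: fib_def)

lemma fib_complex: "cochain_complex R F"
  unfolding cochain_complex_def
proof (intro conjI allI ballI)
  fix n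
  interpret Mn: module R "C n" by (rule Mmod)
  interpret Mp: module R "C (n + 1)" by (rule Mmod)
  show "module R (cmodule F n)" unfolding fib_simps by (intro module_dsum Mmod)
  show "cdiff F n \<in> mod_hom R (cmodule F n) (cmodule F (n + 1))"
    unfolding mod_hom_def
  proof (intro CollectI conjI ballI funcsetI)
    fix w assume "w \<in> carrier (cmodule F n)"
    then obtain x y where w: "x \<in> carrier (C n)" "y \<in> carrier (C (n - 1))" "w = (x, y)"
      by (auto simp: fib_simps dsum_simps)
    have c: "\<theta> n x \<in> carrier (C n)" "d (n - 1) y \<in> carrier (C n)"
      "d n x \<in> carrier (C (n + 1))"
      using tD(1)[OF w(1)] dD'(1)[OF w(2)] dD(1)[OF w(1)] by auto
    then show "cdiff F n w \<in> carrier (cmodule F (n + 1))"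
      using w(3) by (simp add: fib_simps dsum_simps)
    show "cdiff F n (r \<odot>\<^bsub>cmodule F n\<^esub> w) = r \<odot>\<^bsub>cmodule F (n + 1)\<^esub> cdiff F n w" if r: "r \<in> carrier R" for r
      using w c r by (simp add: fib_simps dsum_simps dD(3) dD'(3) tD(3) a_minus_def Mn.smult_r_distr Mn.smult_r_minus)
    show "cdiff F n (w \<oplus>\<^bsub>cmodule F n\<^esub> w') = cdiff F n w \<oplus>\<^bsub>cmodule F (n + 1)\<^esub> cdiff F n w'"
      if "w' \<in> carrier (cmodule F n)" for w'
    proof -
      obtain x' y' where w': "x' \<in> carrier (C n)" "y' \<in> carrier (C (n - 1))" "w' = (x', y')"
        using \<open>w' \<in> carrier (cmodule F n)\<close> by (auto simp: fib_simps dsum_simps)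
      have c': "\<theta> n x' \<in> carrier (C n)" "d (n - 1) y' \<in> carrier (C n)"
        "d n x' \<in> carrier (C (n + 1))"
        using tD(1)[OF w'(1)] dD'(1)[OF w'(2)] dD(1)[OF w'(1)] by auto
      show ?thesis
        using w w' c c' by (simp add: fib_simps dsum_simps dD(2) dD'(2) tD(2) a_minus_def Mn.M.a_ac Mn.M.minus_add Mp.M.a_comm)
    qed
  qed
  fix w assume "w \<in> carrier (cmodule F n)"
  then obtain x y where w: "x \<in> carrier (C n)" "y \<in> carrier (C (n - 1))" "w = (x, y)"
    by (auto simp: fib_simps dsum_simps)
  have t: "\<theta> (n + 1) (d n x) \<in> carrier (C (n + 1))" using tD(1)[OF dD(1)[OF w(1)]] .
  have "d n (\<theta> n x \<ominus>\<^bsub>C n\<^esub> d (n - 1) y) = \<theta> (n + 1) (d n x)"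
    using cdiff_cdiff[OF M w(2)] dD(6)[OF tD(1)[OF w(1)] dD'(1)[OF w(2)]] d_theta[OF w(1)]
      Mp.M.minus_cancel(3)[OF t Mp.M.zero_closed] t by simp
  then have "cdiff F (n + 1) (cdiff F n w) = (\<zero>\<^bsub>C (n + 1 + 1)\<^esub>, \<zero>\<^bsub>C (n + 1)\<^esub>)"
    using w t cdiff_cdiff[OF M w(1)] by (simp add: fib_simps a_minus_def Mp.M.r_neg)
  then show "cdiff F (n + 1) (cdiff F n w) = \<zero>\<^bsub>cmodule F (n + 1 + 1)\<^esub>"
    by (simp add: fib_simps dsum_simps add.commute)
qed

lemma fib_cocycles: "(x, y) \<in> cocycles F n \<longleftrightarrow>
    x \<in> Z n \<and> y \<in> carrier (C (n - 1)) \<and> \<theta> n x = d (n - 1) y"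
proof -
  interpret Mn: module R "C n" by (rule Mmod)
  have "\<theta> n x \<ominus>\<^bsub>C n\<^esub> d (n - 1) y = \<zero>\<^bsub>C n\<^esub> \<longleftrightarrow> \<theta> n x = d (n - 1) y"
    if "x \<in> carrier (C n)" "y \<in> carrier (C (n - 1))"
  proof -
    have c: "\<theta> n x \<in> carrier (C n)" "d (n - 1) y \<in> carrier (C n)"
      using that tD(1) dD'(1) by auto
    show ?thesis
      using Mn.M.minus_cancel(1)[OF c] c by (auto simp: a_minus_def Mn.M.r_neg)
  qed
  then show ?thesis by (auto simp: cocycles_def fib_simps dsum_simps)
qed

lemma fib_coboundaries: "(x, y) \<in> coboundaries F n \<longleftrightarrow>
    (\<exists>u\<in>carrier (C (n - 1)). \<exists>v\<in>carrier (C (n - 1 - 1)).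
      x = d (n - 1) u \<and> y = \<theta> (n - 1) u \<ominus>\<^bsub>C (n - 1)\<^esub> d (n - 1 - 1) v)"
  by (auto simp: coboundaries_def fib_simps dsum_simps image_iff)

text \<open>The elements \<open>(0, y)\<close> are the image of the complex \<open>M\<close>, shifted by one degree, in the fibre.\<close>

lemma zero_pair_coboundary: "(\<zero>\<^bsub>C n\<^esub>, y) \<in> coboundaries F n \<longleftrightarrow>
    (\<exists>u\<in>Z (n - 1). \<exists>b\<in>B (n - 1). y = \<theta> (n - 1) u \<oplus>\<^bsub>C (n - 1)\<^esub> b)"
proof
  interpret M1: module R "C (n - 1)" by (rule Mmod)
  assume "(\<zero>\<^bsub>C n\<^esub>, y) \<in> coboundaries F n"
  then obtain u v where uv: "u \<in> carrier (C (n - 1))" "v \<in> carrier (C (n - 1 - 1))"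
      "\<zero>\<^bsub>C n\<^esub> = d (n - 1) u" "y = \<theta> (n - 1) u \<ominus>\<^bsub>C (n - 1)\<^esub> d (n - 1 - 1) v"
    unfolding fib_coboundaries by blast
  have "u \<in> Z (n - 1)" using uv by (simp add: cocycles_def)
  moreover have "\<ominus>\<^bsub>C (n - 1)\<^esub> d (n - 1 - 1) v \<in> B (n - 1)"
    using uv(2) by (intro BD(6)) (simp add: coboundaries_def)
  ultimately show "\<exists>u\<in>Z (n - 1). \<exists>b\<in>B (n - 1). y = \<theta> (n - 1) u \<oplus>\<^bsub>C (n - 1)\<^esub> b"
    using uv(4) unfolding a_minus_def by blast
next
  interpret M1: module R "C (n - 1)" by (rule Mmod)
  assume "\<exists>u\<in>Z (n - 1). \<exists>b\<in>B (n - 1). y = \<theta> (n - 1) u \<oplus>\<^bsub>C (n - 1)\<^esub> b"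
  then obtain u b where u: "u \<in> Z (n - 1)" "b \<in> B (n - 1)"
      "y = \<theta> (n - 1) u \<oplus>\<^bsub>C (n - 1)\<^esub> b" by blast
  have "\<ominus>\<^bsub>C (n - 1)\<^esub> b \<in> B (n - 1)" using BD(6)[OF u(2)] .
  then obtain v where v: "v \<in> carrier (C (n - 1 - 1))"
      "\<ominus>\<^bsub>C (n - 1)\<^esub> b = d (n - 1 - 1) v" by (auto simp: coboundaries_def)
  have "y = \<theta> (n - 1) u \<ominus>\<^bsub>C (n - 1)\<^esub> d (n - 1 - 1) v"
    using u(3) BD(3)[OF u(2)] unfolding a_minus_def v(2)[symmetric] by simp
  moreover have "\<zero>\<^bsub>C n\<^esub> = d (n - 1) u" "u \<in> carrier (C (n - 1))"
    using cocyclesD[OF u(1)] ZD(3)[OF u(1)] by simp_all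
  ultimately show "(\<zero>\<^bsub>C n\<^esub>, y) \<in> coboundaries F n" unfolding fib_coboundaries using v(1) by blast
qed

lemma zero_pair_cocycle: "(\<zero>\<^bsub>C n\<^esub>, y) \<in> cocycles F n \<longleftrightarrow> y \<in> Z (n - 1)"
  unfolding fib_cocycles using ZD(2)[of n] tD(4)[of n] by (auto simp: cocycles_def)

section \<open>The Bockstein complex\<close>

lemma bockstein_eq: "bockstein_map M n (x, y) = (\<zero>\<^bsub>C (n + 1)\<^esub>, x)"
proof -
  interpret Mp: module R "C (n + 1)" by (rule Mmod)
  show ?thesis
    by (simp add: bockstein_map_def chain_comp_def fib_to_source_def target_to_cofib_def cofib_to_shift_fib_def)
qed

text \<open>The sign of the differential of the shift does not affect its image.\<close>

lemma shift_coboundaries: "coboundaries (shift F) n = coboundaries F (n + 1)"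
proof -
  interpret E: module R "cmodule F (n + 1)" by (rule cmodule_module[OF fib_complex])
  note B = submoduleD[OF cmodule_module[OF fib_complex] coboundaries_submodule[OF fib_complex, of "n + 1"]]
  have "coboundaries (shift F) n = (\<lambda>w. \<ominus>\<^bsub>cmodule F (n + 1)\<^esub> w) ` coboundaries F (n + 1)"
    by (simp add: coboundaries_def shift_def image_image add.commute)
  also have "\<dots> = coboundaries F (n + 1)"
  proof (intro equalityI subsetI)
    fix w assume "w \<in> coboundaries F (n + 1)"
    then show "w \<in> (\<lambda>w. \<ominus>\<^bsub>cmodule F (n + 1)\<^esub> w) ` coboundaries F (n + 1)"
      using B(6) B(3) by (intro rev_image_eqI[of "\<ominus>\<^bsub>cmodule F (n + 1)\<^esub> w"]) simp_all
  qed (use B(6) in auto)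
  finally show ?thesis .
qed

text \<open>On pairs the Bockstein map is \<open>(x, y) \<mapsto> (0, x)\<close>.\<close>

lemma Bock_diff:
  "cdiff (Bock M \<theta>) n \<in> mod_hom R (cohomology F n) (cohomology F (n + 1))"
  "(x, y) \<in> cocycles F n \<Longrightarrow> cdiff (Bock M \<theta>) n (coboundaries F n +>\<^bsub>cmodule F n\<^esub> (x, y)) =
    coboundaries F (n + 1) +>\<^bsub>cmodule F (n + 1)\<^esub> (\<zero>\<^bsub>C (n + 1)\<^esub>, x)"
proof -
  interpret Mp: module R "C (n + 1)" by (rule Mmod)
  interpret Mn: module R "C n" by (rule Mmod)
  let ?\<beta> = "\<lambda>w. (\<zero>\<^bsub>C (n + 1)\<^esub>, fst w)"
  have \<beta>: "bockstein_map M n = ?\<beta>" using bockstein_eq by auto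
  have h: "?\<beta> \<in> mod_hom R (cmodule F n \<restriction> cocycles F n) (cmodule F (n + 1))"
    by (rule mod_hom_restrict_full) (auto simp: mod_hom_def fib_simps dsum_simps cocycles_def)
  have Z: "?\<beta> ` cocycles F n \<subseteq> cocycles F (n + 1)"
  proof clarify
    fix x y assume "(x, y) \<in> cocycles F n"
    then have "x \<in> Z n" by (simp add: fib_cocycles)
    then show "(\<zero>\<^bsub>C (n + 1)\<^esub>, fst (x, y)) \<in> cocycles F (n + 1)" by (simp add: zero_pair_cocycle)
  qed
  have B: "?\<beta> ` coboundaries F n \<subseteq> coboundaries F (n + 1)"
  proof clarify
    fix x y assume "(x, y) \<in> coboundaries F n"
    then have x: "x \<in> B n" unfolding fib_coboundaries by (auto simp: coboundaries_def)
    have "x = \<theta> n \<zero>\<^bsub>C n\<^esub> \<oplus>\<^bsub>C n\<^esub> x" using BD(3)[OF x] tD(4)[of n] by simp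
    then show "(\<zero>\<^bsub>C (n + 1)\<^esub>, fst (x, y)) \<in> coboundaries F (n + 1)"
      using x ZD(2)[of n] zero_pair_coboundary[of "n + 1" x] by auto
  qed
  note F = fib_complex
  note ind = induced_hom[OF cmodule_module[OF F] coboundaries_submodule[OF F] cocycles_submodule[OF F]
      coboundaries_cocycles[OF F] cmodule_module[OF F] coboundaries_submodule[OF F] cocycles_submodule[OF F]
      coboundaries_cocycles[OF F] h Z B]
  have d: "cdiff (Bock M \<theta>) n = (\<lambda>X. \<Union>w\<in>X. coboundaries F (n + 1) +>\<^bsub>cmodule F (n + 1)\<^esub> ?\<beta> w)"
    by (rule ext) (simp add: Bock_def coh_map_def shift_coboundaries \<beta>, simp add: shift_def)
  show "cdiff (Bock M \<theta>) n \<in> mod_hom R (cohomology F n) (cohomology F (n + 1))"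
    unfolding d cohomology_def by (rule ind(1))
  show "(x, y) \<in> cocycles F n \<Longrightarrow> cdiff (Bock M \<theta>) n (coboundaries F n +>\<^bsub>cmodule F n\<^esub> (x, y)) =
    coboundaries F (n + 1) +>\<^bsub>cmodule F (n + 1)\<^esub> (\<zero>\<^bsub>C (n + 1)\<^esub>, x)"
    unfolding d using ind(2)[of "(x, y)"] by simp
qed

lemma Bock_module: "cmodule (Bock M \<theta>) n = cohomology F n"
  by (simp add: Bock_def)

lemma Bock_complex: "cochain_complex R (Bock M \<theta>)"
  unfolding cochain_complex_def Bock_module
proof (intro conjI allI ballI)
  fix n
  show "module R (cohomology F n)" by (rule cohomology_module[OF fib_complex])
  show "cdiff (Bock M \<theta>) n \<in> mod_hom R (cohomology F n) (cohomology F (n + 1))" by (rule Bock_diff)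
  interpret Mp: module R "C (n + 1)" by (rule Mmod)
  fix X assume "X \<in> carrier (cohomology F n)"
  then obtain x y where w: "(x, y) \<in> cocycles F n" "X = coboundaries F n +>\<^bsub>cmodule F n\<^esub> (x, y)"
    by (auto simp: carrier_cohomology)
  have "x \<in> Z n" using w(1) by (simp add: fib_cocycles)
  then have "(\<zero>\<^bsub>C (n + 1)\<^esub>, x) \<in> cocycles F (n + 1)" using zero_pair_cocycle[of "n + 1" x] by simp
  then have "cdiff (Bock M \<theta>) (n + 1) (cdiff (Bock M \<theta>) n X) = coboundaries F (n + 1 + 1) +>\<^bsub>cmodule F (n + 1 + 1)\<^esub>
      (\<zero>\<^bsub>C (n + 1 + 1)\<^esub>, \<zero>\<^bsub>C (n + 1)\<^esub>)"
    unfolding w(2) Bock_diff(2)[OF w(1)] by (rule Bock_diff(2))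
  also have "\<dots> = coboundaries F (n + 1 + 1)"
  proof -
    interpret E: module R "cmodule F (n + 1 + 1)" by (rule cmodule_module[OF fib_complex])
    have "(\<zero>\<^bsub>C (n + 1 + 1)\<^esub>, \<zero>\<^bsub>C (n + 1)\<^esub>) = \<zero>\<^bsub>cmodule F (n + 1 + 1)\<^esub>"
      by (simp add: fib_simps dsum_simps add.commute)
    then show ?thesis
      using coset_zero_iff[OF E.module_axioms coboundaries_submodule[OF fib_complex] E.M.zero_closed]
        submoduleD(2)[OF E.module_axioms coboundaries_submodule[OF fib_complex]] by simp
  qed
  finally show "cdiff (Bock M \<theta>) (n + 1) (cdiff (Bock M \<theta>) n X) = \<zero>\<^bsub>cohomology F (n + 1 + 1)\<^esub>"
    by (simp add: zero_cohomology)
qed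

end

section \<open>The cohomology of the Bockstein complex\<close>

lemma coset_eq_iff_add:
  fixes R :: "'r ring" and M :: "('r, 'm) module"
  assumes M: "module R M" and K: "submodule K R M" and xy: "x \<in> carrier M" "y \<in> carrier M"
  shows "K +>\<^bsub>M\<^esub> x = K +>\<^bsub>M\<^esub> y \<longleftrightarrow> (\<exists>k\<in>K. x = k \<oplus>\<^bsub>M\<^esub> y)"
proof -
  interpret module R M by (rule M)
  have "x = k \<oplus>\<^bsub>M\<^esub> y \<longleftrightarrow> x \<ominus>\<^bsub>M\<^esub> y = k" if "k \<in> K" for k
  proof
    have k: "k \<in> carrier M" by (rule submoduleD(3)[OF M K that])
    show "x \<ominus>\<^bsub>M\<^esub> y = k" if "x = k \<oplus>\<^bsub>M\<^esub> y" using M.minus_cancel(3)[OF k xy(2)] that by simp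
    show "x = k \<oplus>\<^bsub>M\<^esub> y" if "x \<ominus>\<^bsub>M\<^esub> y = k" using M.minus_cancel(1)[OF xy] that by simp
  qed
  then have "(\<exists>k\<in>K. x = k \<oplus>\<^bsub>M\<^esub> y) \<longleftrightarrow> (\<exists>k\<in>K. x \<ominus>\<^bsub>M\<^esub> y = k)" by (rule bex_cong[OF refl])
  then show ?thesis using coset_eq_iff[OF M K xy] by simp
qed

context complex_endo
begin

lemma carrier_A: "X \<in> carrier (A n) \<longleftrightarrow> (\<exists>x\<in>Z n. X = cls n x)"
  by (auto simp: carrier_cohomology)

lemma T_cls: "x \<in> Z n \<Longrightarrow> T n (cls n x) = cls n (\<theta> n x)"
  by (rule \<theta>_coh(2))

lemma cls_zero_iff: "x \<in> Z n \<Longrightarrow> cls n x = \<zero>\<^bsub>A n\<^esub> \<longleftrightarrow> x \<in> B n"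
  using coset_zero_iff[OF Mmod Bsub ZD(3)] by (simp add: zero_cohomology)

lemma cls_eq_iff: "x \<in> Z n \<Longrightarrow> y \<in> Z n \<Longrightarrow>
    cls n x = cls n y \<longleftrightarrow> (\<exists>b\<in>B n. x = b \<oplus>\<^bsub>C n\<^esub> y)"
  by (rule coset_eq_iff_add[OF Mmod Bsub ZD(3) ZD(3)])

lemma cls_iso: "subquot_iso R (C n) (B n) (Z n) (A n) {\<zero>\<^bsub>A n\<^esub>} (carrier (A n)) (cls n)"
  by (rule cohomology_iso[OF M])

lemma cls_add: "x \<in> Z n \<Longrightarrow> y \<in> Z n \<Longrightarrow>
    cls n (x \<oplus>\<^bsub>C n\<^esub> y) = cls n x \<oplus>\<^bsub>A n\<^esub> cls n y"
  using mod_hom_on(2)[OF Mmod Amod Zsub subquot_iso.hom[OF cls_iso]] .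

lemma endo: "module_endo R (A n) (T n)"
  by (intro module_endo.intro Amod \<theta>_coh(1))

definition ker_T :: "int \<Rightarrow> 'm set set"
  where "ker_T n = {X \<in> carrier (A n). T n X = \<zero>\<^bsub>A n\<^esub>}"

definition im_T :: "int \<Rightarrow> 'm set set"
  where "im_T n = T n ` carrier (A n)"

lemma ker_T_submodule: "submodule (ker_T n) R (A n)"
  using module_endo.iter_ker_submodule[OF endo, of n 1 0]
  by (simp add: ker_T_def module_endo.iter_ker_def[OF endo] module_endo.iter_im_def[OF endo])

lemma im_T_submodule: "submodule (im_T n) R (A n)"
  using module_endo.iter_im_submodule[OF endo, of n 1]
  by (simp add: im_T_def module_endo.iter_im_def[OF endo])

lemma cls_ker_T: "x \<in> Z n \<Longrightarrow> cls n x \<in> ker_T n \<longleftrightarrow> \<theta> n x \<in> B n"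
  using cls_zero_iff[OF \<theta>_coh(3)] T_cls[of x n] by (auto simp: ker_T_def carrier_A)

lemma im_T_iff: "X \<in> im_T n \<longleftrightarrow> (\<exists>u\<in>Z n. X = cls n (\<theta> n u))"
proof -
  have "X \<in> im_T n \<longleftrightarrow> (\<exists>u\<in>Z n. X = T n (cls n u))"
    by (simp add: im_T_def carrier_cohomology image_iff)
  also have "\<dots> \<longleftrightarrow> (\<exists>u\<in>Z n. X = cls n (\<theta> n u))" by (rule bex_cong) (simp_all add: T_cls)
  finally show ?thesis .
qed

lemma cls_im_T:
  assumes x: "x \<in> Z n"
  shows "cls n x \<in> im_T n \<longleftrightarrow> (\<exists>u\<in>Z n. \<exists>b\<in>B n. x = \<theta> n u \<oplus>\<^bsub>C n\<^esub> b)"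
proof -
  interpret Mn: module R "C n" by (rule Mmod)
  have "cls n x = cls n (\<theta> n u) \<longleftrightarrow> (\<exists>b\<in>B n. x = \<theta> n u \<oplus>\<^bsub>C n\<^esub> b)"
    if u: "u \<in> Z n" for u
    unfolding cls_eq_iff[OF x \<theta>_coh(3)[OF u]]
    by (rule bex_cong[OF refl]) (simp only: Mn.M.a_comm[OF BD(3) ZD(3)[OF \<theta>_coh(3)[OF u]]])
  then show ?thesis unfolding im_T_iff by blast
qed

lemma fst_hom: "fst \<in> mod_hom R (cmodule F n) (C n)"
  by (auto simp: mod_hom_def fib_simps dsum_simps)

lemmas Fmod = cmodule_module[OF fib_complex] and FB = coboundaries_submodule[OF fib_complex]
  and FZ = cocycles_submodule[OF fib_complex] and FBZ = coboundaries_cocycles[OF fib_complex]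

lemma FZ_carrier: "cocycles F n \<subseteq> carrier (cmodule F n)"
  by (auto simp: cocycles_def)

text \<open>
  The preimages in \<open>M\<^sup>n \<times> M\<^sup>n\<^sup>-\<^sup>1\<close> of the cocycles and the coboundaries of the Bockstein complex. The class of \<open>(x, y)\<close>
  is a cocycle if \<open>(0, x)\<close> bounds in the fibre, that is, if \<open>[x]\<close> is in the image of \<open>T\<close>. The coboundaries are the
  classes of \<open>(0, u)\<close> with \<open>T [u] = 0\<close>, as these \<open>u\<close> are the first components of the cocycles one degree lower.
\<close>

definition Bock_Z :: "int \<Rightarrow> ('m \<times> 'm) set"
  where "Bock_Z n = {(x, y). (x, y) \<in> cocycles F n \<and> cls n x \<in> im_T n}"

definition Bock_B :: "int \<Rightarrow> ('m \<times> 'm) set"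
  where "Bock_B n = {(x, y). (x, y) \<in> cocycles F n \<and>
    (\<exists>u\<in>Z (n - 1). \<theta> (n - 1) u \<in> B (n - 1) \<and>
      (\<exists>y'. (x, y') \<in> coboundaries F n \<and> y = y' \<oplus>\<^bsub>C (n - 1)\<^esub> u))}"

lemma Bock_cohomology_rlen:
  "submodule (Bock_B n) R (cmodule F n)" "submodule (Bock_Z n) R (cmodule F n)" "Bock_B n \<subseteq> Bock_Z n"
  "mod_length R (cohomology (Bock M \<theta>) n) = rlen R (cmodule F n) (Bock_B n) (Bock_Z n)"
proof -
  let ?\<pi> = "\<lambda>w. coboundaries F n +>\<^bsub>cmodule F n\<^esub> w"
  interpret P: subquot_iso R "cmodule F n" "coboundaries F n" "cocycles F n" "cohomology F n"
    "{\<zero>\<^bsub>cohomology F n\<^esub>}" "carrier (cohomology F n)" ?\<pi>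
    by (rule cohomology_iso[OF fib_complex])
  note H = cmodule_module[OF Bock_complex, of n, unfolded Bock_module]
  note B = coboundaries_submodule[OF Bock_complex, of n, unfolded Bock_module]
  note Z = cocycles_submodule[OF Bock_complex, of n, unfolded Bock_module]
  note BZ' = coboundaries_cocycles[OF Bock_complex, of n]
  have z: "{\<zero>\<^bsub>cohomology F n\<^esub>} \<subseteq> coboundaries (Bock M \<theta>) n" using submoduleD(2)[OF H B] by simp
  interpret Q: subquot_iso R "cmodule F n" "P.pull (coboundaries (Bock M \<theta>) n)" "P.pull (cocycles (Bock M \<theta>) n)"
    "cohomology F n" "coboundaries (Bock M \<theta>) n" "cocycles (Bock M \<theta>) n" ?\<pi>
    by (rule P.iso_pull[OF B Z z BZ' submoduleD(1)[OF H Z]])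
  have Zeq: "P.pull (cocycles (Bock M \<theta>) n) = Bock_Z n"
  proof (rule Set.set_eqI)
    fix w :: "'m \<times> 'm"
    obtain x y where w: "w = (x, y)" by (cases w)
    have "?\<pi> (x, y) \<in> cocycles (Bock M \<theta>) n \<longleftrightarrow> cls n x \<in> im_T n" if c: "(x, y) \<in> cocycles F n"
    proof -
      have x: "x \<in> Z n" using c by (simp add: fib_cocycles)
      have c0: "(\<zero>\<^bsub>C (n + 1)\<^esub>, x) \<in> cocycles F (n + 1)" using x zero_pair_cocycle[of "n + 1" x] by simp
      have "?\<pi> (x, y) \<in> cocycles (Bock M \<theta>) n \<longleftrightarrow> cdiff (Bock M \<theta>) n (?\<pi> (x, y)) = \<zero>\<^bsub>cohomology F (n + 1)\<^esub>"
        using c by (auto simp: cocycles_def[of "Bock M \<theta>"] Bock_module carrier_cohomology)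
      also have "\<dots> \<longleftrightarrow> (\<zero>\<^bsub>C (n + 1)\<^esub>, x) \<in> coboundaries F (n + 1)"
        unfolding Bock_diff(2)[OF c] zero_cohomology
        using coset_zero_iff[OF Fmod FB] FZ_carrier c0 by blast
      also have "\<dots> \<longleftrightarrow> cls n x \<in> im_T n" using zero_pair_coboundary[of "n + 1" x] cls_im_T[OF x] by simp
      finally show ?thesis .
    qed
    then show "w \<in> P.pull (cocycles (Bock M \<theta>) n) \<longleftrightarrow> w \<in> Bock_Z n"
      unfolding P.pull_def Bock_Z_def w by auto
  qed
  have Beq: "P.pull (coboundaries (Bock M \<theta>) n) = Bock_B n"
  proof (rule Set.set_eqI)
    fix w :: "'m \<times> 'm"
    obtain x y where w: "w = (x, y)" by (cases w)
    interpret Mn: module R "C n" by (rule Mmod)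
    have "?\<pi> (x, y) \<in> coboundaries (Bock M \<theta>) n \<longleftrightarrow>
        (\<exists>u\<in>Z (n - 1). \<theta> (n - 1) u \<in> B (n - 1) \<and>
          (\<exists>y'. (x, y') \<in> coboundaries F n \<and> y = y' \<oplus>\<^bsub>C (n - 1)\<^esub> u))"
      (is "?l \<longleftrightarrow> ?r") if c: "(x, y) \<in> cocycles F n"
    proof -
      have u_iff: "(\<exists>v. (u, v) \<in> cocycles F (n - 1)) \<longleftrightarrow>
          u \<in> Z (n - 1) \<and> \<theta> (n - 1) u \<in> B (n - 1)" for u
        unfolding fib_cocycles by (auto simp: coboundaries_def)
      have "?l \<longleftrightarrow> (\<exists>u v. (u, v) \<in> cocycles F (n - 1) \<and>
          ?\<pi> (x, y) = cdiff (Bock M \<theta>) (n - 1) (coboundaries F (n - 1) +>\<^bsub>cmodule F (n - 1)\<^esub> (u, v)))"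
        unfolding coboundaries_def[of "Bock M \<theta>"] Bock_module carrier_cohomology by auto
      also have "\<dots> \<longleftrightarrow> (\<exists>u v. (u, v) \<in> cocycles F (n - 1) \<and> ?\<pi> (x, y) = ?\<pi> (\<zero>\<^bsub>C n\<^esub>, u))"
        by (intro ex_cong1 conj_cong refl) (use Bock_diff(2)[of _ _ "n - 1"] in simp)
      also have "\<dots> \<longleftrightarrow> (\<exists>u\<in>Z (n - 1). \<theta> (n - 1) u \<in> B (n - 1) \<and>
          ?\<pi> (x, y) = ?\<pi> (\<zero>\<^bsub>C n\<^esub>, u))"
        using u_iff by blast
      also have "\<dots> \<longleftrightarrow> ?r"
      proof (rule bex_cong[OF refl], rule conj_cong[OF refl])
        fix u assume u: "u \<in> Z (n - 1)"
        have u0: "(\<zero>\<^bsub>C n\<^esub>, u) \<in> carrier (cmodule F n)"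
          using FZ_carrier u zero_pair_cocycle[of n u] by blast
        have xc: "(x, y) \<in> carrier (cmodule F n)" using c FZ_carrier by blast
        have "?\<pi> (x, y) = ?\<pi> (\<zero>\<^bsub>C n\<^esub>, u) \<longleftrightarrow>
            (\<exists>k\<in>coboundaries F n. (x, y) = k \<oplus>\<^bsub>cmodule F n\<^esub> (\<zero>\<^bsub>C n\<^esub>, u))"
          by (rule coset_eq_iff_add[OF Fmod FB xc u0])
        also have "\<dots> \<longleftrightarrow> (\<exists>x' y'. (x', y') \<in> coboundaries F n \<and> x = x' \<oplus>\<^bsub>C n\<^esub> \<zero>\<^bsub>C n\<^esub> \<and>
            y = y' \<oplus>\<^bsub>C (n - 1)\<^esub> u)"
          unfolding Bex_def split_paired_Ex by (simp add: fib_simps dsum_simps conj_assoc)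
        also have "\<dots> \<longleftrightarrow> (\<exists>y'. (x, y') \<in> coboundaries F n \<and> y = y' \<oplus>\<^bsub>C (n - 1)\<^esub> u)"
        proof -
          have "x' \<in> carrier (C n)" if "(x', y') \<in> coboundaries F n" for x' y'
            using submoduleD(3)[OF Fmod FB that] by (simp add: fib_simps dsum_simps)
          then show ?thesis using Mn.M.r_zero by metis
        qed
        finally show "?\<pi> (x, y) = ?\<pi> (\<zero>\<^bsub>C n\<^esub>, u) \<longleftrightarrow>
          (\<exists>y'. (x, y') \<in> coboundaries F n \<and> y = y' \<oplus>\<^bsub>C (n - 1)\<^esub> u)" .
      qed
      finally show ?thesis .
    qed
    then show "w \<in> P.pull (coboundaries (Bock M \<theta>) n) \<longleftrightarrow> w \<in> Bock_B n"
      unfolding P.pull_def Bock_B_def w by auto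
  qed
  show "submodule (Bock_B n) R (cmodule F n)" "submodule (Bock_Z n) R (cmodule F n)" "Bock_B n \<subseteq> Bock_Z n"
    using Q.sK Q.sZ Q.KZ unfolding Zeq Beq by auto
  have "mod_length R (cohomology (Bock M \<theta>) n) =
      rlen R (cohomology F n) (coboundaries (Bock M \<theta>) n) (cocycles (Bock M \<theta>) n)"
    unfolding cohomology_def[of "Bock M \<theta>"] Bock_module by (rule mod_length_quot[OF H B Z BZ'])
  then show "mod_length R (cohomology (Bock M \<theta>) n) = rlen R (cmodule F n) (Bock_B n) (Bock_Z n)"
    using Q.rlen_eq unfolding Zeq Beq by simp
qed

text \<open>
  Project the pairs \<open>(x, y)\<close> to \<open>x\<close>. Modulo coboundaries of \<open>M\<close> the possible \<open>x\<close> are those with \<open>[x]\<close> in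
  \<open>im T \<inter> ker T\<close>. What remains are the pairs \<open>(0, y)\<close> with a cocycle \<open>y\<close>; such a pair is a Bockstein coboundary if \<open>[y]\<close>
  is in \<open>ker T + im T\<close>, where \<open>im T\<close> accounts for the coboundaries of the fibre.
\<close>

lemma Bock_length:
  "mod_length R (cohomology (Bock M \<theta>) n) =
    rlen R (A n) {\<zero>\<^bsub>A n\<^esub>} (im_T n \<inter> ker_T n) +
    rlen R (A (n - 1)) (ker_T (n - 1) <+>\<^bsub>A (n - 1)\<^esub> im_T (n - 1)) (carrier (A (n - 1)))"
proof -
  interpret Mn: module R "C n" by (rule Mmod)
  interpret Mm: module R "C (n - 1)" by (rule Mmod)
  note s = Bock_cohomology_rlen(1,2)[of n]
  have h: "fst \<in> mod_hom R (cmodule F n \<restriction> Bock_Z n) (C n)"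
    by (rule mod_hom_restrict_full[OF fst_hom submoduleD(1)[OF Fmod s(2)]])
  let ?W = "{x \<in> Z n. cls n x \<in> im_T n \<inter> ker_T n}"
  let ?K0 = "{w \<in> Bock_B n. fst w = \<zero>\<^bsub>C n\<^esub>}" and ?Z0 = "{w \<in> Bock_Z n. fst w = \<zero>\<^bsub>C n\<^esub>}"
  have fZ: "fst ` Bock_Z n = ?W"
  proof (intro equalityI subsetI)
    fix x assume "x \<in> fst ` Bock_Z n"
    then obtain y where xy: "(x, y) \<in> cocycles F n" "cls n x \<in> im_T n" by (auto simp: Bock_Z_def)
    then have "x \<in> Z n" "\<theta> n x \<in> B n" by (auto simp: fib_cocycles coboundaries_def)
    then show "x \<in> ?W" using xy(2) cls_ker_T by simp
  next
    fix x assume x: "x \<in> ?W"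
    then have "\<theta> n x \<in> B n" using cls_ker_T by blast
    then obtain y where "y \<in> carrier (C (n - 1))" "\<theta> n x = d (n - 1) y"
      by (auto simp: coboundaries_def)
    then have "(x, y) \<in> Bock_Z n" using x by (simp add: Bock_Z_def fib_cocycles)
    then show "x \<in> fst ` Bock_Z n" by force
  qed
  have fB: "fst ` Bock_B n = B n"
  proof (intro equalityI subsetI)
    fix x assume "x \<in> fst ` Bock_B n"
    then obtain y' where "(x, y') \<in> coboundaries F n" by (auto simp: Bock_B_def)
    then show "x \<in> B n" unfolding fib_coboundaries coboundaries_def[of M] by blast
  next
    fix x assume "x \<in> B n"
    then obtain a where a: "a \<in> carrier (C (n - 1))" "x = d (n - 1) a"
      by (auto simp: coboundaries_def)
    (* The coboundary of (a, 0) in the fibre has first component x. *)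
  define y where "y = snd (cdiff F (n - 1) (a, \<zero>\<^bsub>C (n - 1 - 1)\<^esub>))"
    have "\<zero>\<^bsub>C (n - 1 - 1)\<^esub> \<in> carrier (C (n - 1 - 1))"
      using submoduleD(2)[OF Mmod Zsub] by (auto simp: cocycles_def)
    then have B: "(x, y) \<in> coboundaries F n"
      unfolding fib_coboundaries y_def fib_simps a(2) using a(1) by auto
    have Z: "(x, y) \<in> cocycles F n" using FBZ B by blast
    have yc: "y \<in> carrier (C (n - 1))" using Z by (simp add: fib_cocycles)
    have "\<theta> (n - 1) \<zero>\<^bsub>C (n - 1)\<^esub> \<in> B (n - 1)" using BD(2) tD(4)[of "n - 1"] by simp
    then have "(x, y) \<in> Bock_B n" unfolding Bock_B_def
      using B Z ZD(2)[of "n - 1"] Mm.M.r_zero[OF yc] by (simp, metis)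
    then show "x \<in> fst ` Bock_B n" by force
  qed
  have 1: "rlen R (C n) (B n) ?W = rlen R (A n) {\<zero>\<^bsub>A n\<^esub>} (im_T n \<inter> ker_T n)"
  proof -
    interpret P: subquot_iso R "C n" "B n" "Z n" "A n" "{\<zero>\<^bsub>A n\<^esub>}" "carrier (A n)" "cls n"
      by (rule cls_iso)
    have sS: "submodule (im_T n \<inter> ker_T n) R (A n)" by (intro submodule_Int Amod im_T_submodule ker_T_submodule)
    interpret Q: subquot_iso R "C n" "P.pull {\<zero>\<^bsub>A n\<^esub>}" "P.pull (im_T n \<inter> ker_T n)" "A n"
      "{\<zero>\<^bsub>A n\<^esub>}" "im_T n \<inter> ker_T n" "cls n"
      using submoduleD(1,2)[OF Amod sS] by (intro P.iso_pull submodule_zero Amod sS) auto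
    have "P.pull {\<zero>\<^bsub>A n\<^esub>} = B n" using P.ker P.KZ by (auto simp: P.pull_def)
    then show ?thesis using Q.rlen_eq by (simp add: P.pull_def)
  qed
  have Z0: "?Z0 = {\<zero>\<^bsub>C n\<^esub>} \<times> Z (n - 1)"
  proof -
    have "cls n \<zero>\<^bsub>C n\<^esub> \<in> im_T n"
      unfolding cls_im_T[OF ZD(2)] using ZD(2) BD(2) tD(4)[of n] Mn.M.r_zero[OF Mn.M.zero_closed] by metis
    then show ?thesis by (auto simp: Bock_Z_def zero_pair_cocycle)
  qed
  have K0: "(\<zero>\<^bsub>C n\<^esub>, y) \<in> Bock_B n \<longleftrightarrow> cls (n - 1) y \<in> ker_T (n - 1) <+>\<^bsub>A (n - 1)\<^esub> im_T (n - 1)"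
    if y: "y \<in> Z (n - 1)" for y
  proof
    assume "(\<zero>\<^bsub>C n\<^esub>, y) \<in> Bock_B n"
    then obtain u y' where u: "u \<in> Z (n - 1)" "\<theta> (n - 1) u \<in> B (n - 1)"
      "(\<zero>\<^bsub>C n\<^esub>, y') \<in> coboundaries F n" "y = y' \<oplus>\<^bsub>C (n - 1)\<^esub> u"
      by (auto simp: Bock_B_def)
    then have y': "y' \<in> Z (n - 1)" using FBZ zero_pair_cocycle by blast
    have "cls (n - 1) y' \<in> im_T (n - 1)" using u(3) cls_im_T[OF y'] zero_pair_coboundary by simp
    moreover have "cls (n - 1) u \<in> ker_T (n - 1)" using u(2) cls_ker_T[OF u(1)] by simp
    moreover have "cls (n - 1) y = cls (n - 1) u \<oplus>\<^bsub>A (n - 1)\<^esub> cls (n - 1) y'"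
      unfolding u(4) using cls_add[OF u(1) y'] Mm.M.a_comm[OF ZD(3)[OF y'] ZD(3)[OF u(1)]] by simp
    ultimately show "cls (n - 1) y \<in> ker_T (n - 1) <+>\<^bsub>A (n - 1)\<^esub> im_T (n - 1)" unfolding mem_set_add by blast
  next
    assume "cls (n - 1) y \<in> ker_T (n - 1) <+>\<^bsub>A (n - 1)\<^esub> im_T (n - 1)"
    then obtain X Y where XY: "X \<in> ker_T (n - 1)" "Y \<in> im_T (n - 1)" "cls (n - 1) y = X \<oplus>\<^bsub>A (n - 1)\<^esub> Y"
      unfolding mem_set_add by blast
    have "X \<in> carrier (A (n - 1))" using XY(1) by (simp add: ker_T_def)
    then obtain u where u: "u \<in> Z (n - 1)" "X = cls (n - 1) u" unfolding carrier_A by blast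
    obtain a where a: "a \<in> Z (n - 1)" "Y = cls (n - 1) (\<theta> (n - 1) a)" using XY(2) unfolding im_T_iff by blast
    note ta = \<theta>_coh(3)[OF a(1)]
    have "cls (n - 1) y = cls (n - 1) (u \<oplus>\<^bsub>C (n - 1)\<^esub> \<theta> (n - 1) a)"
      unfolding XY(3) u(2) a(2) using cls_add[OF u(1) ta] by simp
    then obtain b where b: "b \<in> B (n - 1)"
        "y = b \<oplus>\<^bsub>C (n - 1)\<^esub> (u \<oplus>\<^bsub>C (n - 1)\<^esub> \<theta> (n - 1) a)"
      using cls_eq_iff[OF y ZD(4)[OF u(1) ta]] by blast
    have y_eq: "y = (\<theta> (n - 1) a \<oplus>\<^bsub>C (n - 1)\<^esub> b) \<oplus>\<^bsub>C (n - 1)\<^esub> u"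
      using b(2) BD(3)[OF b(1)] ZD(3)[OF u(1)] ZD(3)[OF ta] by (simp add: Mm.M.a_ac)
    have "(\<zero>\<^bsub>C n\<^esub>, \<theta> (n - 1) a \<oplus>\<^bsub>C (n - 1)\<^esub> b) \<in> coboundaries F n"
      unfolding zero_pair_coboundary using a(1) b(1) by blast
    moreover have "\<theta> (n - 1) u \<in> B (n - 1)" using XY(1) u cls_ker_T by simp
    ultimately show "(\<zero>\<^bsub>C n\<^esub>, y) \<in> Bock_B n"
      unfolding Bock_B_def using u(1) y y_eq zero_pair_cocycle by blast
  qed
  have K0Z0: "?K0 \<subseteq> ?Z0" using Bock_cohomology_rlen(3)[of n] by auto
  have sZ0: "submodule ?Z0 R (cmodule F n)"
    using submodule_preimage[OF Fmod Mmod s(2) h submodule_zero[OF Mmod]] by simp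
  have sK0: "submodule ?K0 R (cmodule F n)"
    using submodule_preimage[OF Fmod Mmod s(1) mod_hom_restrict[OF h Bock_cohomology_rlen(3)] submodule_zero[OF Mmod]]
    by simp
  let ?L = "ker_T (n - 1) <+>\<^bsub>A (n - 1)\<^esub> im_T (n - 1)"
  have sL: "submodule ?L R (A (n - 1))" by (intro submodule_set_add Amod ker_T_submodule im_T_submodule)
  interpret Am: module R "A (n - 1)" by (rule Amod)
  interpret S: subquot_iso R "cmodule F n" ?K0 ?Z0 "A (n - 1)" ?L "carrier (A (n - 1))" "\<lambda>w. cls (n - 1) (snd w)"
  proof (intro subquot_iso.intro Fmod Amod sK0 sZ0 K0Z0 sL submodule_carrier submoduleD(1)[OF Amod sL])
    have "(\<lambda>w. cls (n - 1) (snd w)) \<in> mod_hom R (cmodule F n \<restriction> ({\<zero>\<^bsub>C n\<^esub>} \<times> Z (n - 1))) (A (n - 1))"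
      using mod_hom_on[OF Mmod Amod Zsub subquot_iso.hom[OF cls_iso[of "n - 1"]]]
      by (auto simp: mod_hom_def fib_simps dsum_simps)
    then show "(\<lambda>w. cls (n - 1) (snd w)) \<in> mod_hom R (cmodule F n \<restriction> ?Z0) (A (n - 1))" unfolding Z0 .
    show "cls (n - 1) (snd w) \<in> carrier (A (n - 1))" if "w \<in> ?Z0" for w
      using that unfolding Z0 by (auto simp: carrier_cohomology)
    show "cls (n - 1) (snd w) \<in> ?L \<longleftrightarrow> w \<in> ?K0" if "w \<in> ?Z0" for w
      using that K0 unfolding Z0 by auto
    show "\<exists>w\<in>?Z0. \<exists>k\<in>?L. Y = cls (n - 1) (snd w) \<oplus>\<^bsub>A (n - 1)\<^esub> k" if Y: "Y \<in> carrier (A (n - 1))" for Y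
    proof -
      obtain y where "y \<in> Z (n - 1)" "Y = cls (n - 1) y" using Y unfolding carrier_A by blast
      moreover have "Y = Y \<oplus>\<^bsub>A (n - 1)\<^esub> \<zero>\<^bsub>A (n - 1)\<^esub>" using Am.M.r_zero[OF Y] by simp
      ultimately show ?thesis unfolding Z0 using submoduleD(2)[OF Amod sL] by fastforce
    qed
  qed
  show ?thesis
    using rlen_hom[OF Fmod Mmod s Bock_cohomology_rlen(3) h] S.rlen_eq 1
    unfolding fZ fB Bock_cohomology_rlen(4) by simp
qed

end

section \<open>Finiteness of the kernels and cokernels\<close>

context module_endo
begin

interpretation A: module R A by (rule A)

text \<open>\<open>T\<^sup>r\<close> makes \<open>T\<^sup>r A / T\<^sup>r\<^sup>+\<^sup>1 A\<close> a quotient of \<open>A / T A\<close>.\<close>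

lemma coker_len_finite:
  assumes s: "s \<in> carrier R" and fin: "torsion_finite R s A (iter_im 1) (carrier A)"
    and tor: "torsion_over R s A (iter_im (Suc r)) (iter_im r)"
  shows "coker_len r \<noteq> \<infinity>"
proof -
  let ?P = "{x \<in> carrier A. (T ^^ r) x \<in> iter_im (Suc r)}"
  have hom: "T ^^ r \<in> mod_hom R (A \<restriction> carrier A) A" using funpow_hom by simp
  have sP: "submodule ?P R A"
    by (rule submodule_preimage[OF A A submodule_carrier[OF A] hom iter_im_submodule])
  interpret S: subquot_iso R A ?P "carrier A" A "iter_im (Suc r)" "iter_im r" "T ^^ r"
  proof (intro subquot_iso.intro A sP submodule_carrier iter_im_submodule iter_im_Suc_subset hom)
    show "\<exists>x\<in>carrier A. \<exists>k\<in>iter_im (Suc r). y = (T ^^ r) x \<oplus> k" if y: "y \<in> iter_im r" for y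
    proof -
      obtain x where x: "x \<in> carrier A" "y = (T ^^ r) x" using y by (auto simp: iter_im_def)
      have "y \<in> carrier A" using y iter_im_carrier by auto
      then have "y = (T ^^ r) x \<oplus> \<zero>" using x(2) by simp
      then show ?thesis using x(1) submoduleD(2)[OF A iter_im_submodule] by blast
    qed
  qed (auto simp: iter_im_def)
  have "iter_im 1 \<subseteq> ?P"
  proof
    fix x assume x: "x \<in> iter_im 1"
    then have "(T ^^ r) x \<in> iter_im (1 + r)" unfolding iter_im_image[symmetric] by simp
    then show "x \<in> ?P" using x iter_im_carrier by auto
  qed
  then have "torsion_finite R s A (iter_im (Suc r)) (iter_im r)"
    using torsion_finite_mono[OF fin _ order_refl] S.torsion_finite_iff[OF s] by simp
  then show ?thesis unfolding coker_len_def
    by (rule torsion_finiteD)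
      (rule iter_im_submodule iter_im_Suc_subset tor order_refl)+
qed

text \<open>\<open>T\<^sup>r\<close> maps \<open>ker T\<^sup>r\<^sup>+\<^sup>1\<close> onto \<open>ker T \<inter> T\<^sup>r A\<close> and kills \<open>ker T\<^sup>r\<close>.\<close>

lemma ker_len_finite:
  assumes s: "s \<in> carrier R" and fin: "torsion_finite R s A {\<zero>} (iter_ker 1 0)"
    and tor: "torsion_over R s A (iter_ker r 0) (iter_ker (Suc r) 0)"
  shows "ker_len r \<noteq> \<infinity>"
  unfolding ker_len_def
proof (rule torsion_finiteD[OF fin])
  show "submodule {\<zero>} R A" by (rule submodule_zero[OF A])
  show "{\<zero>} \<subseteq> iter_ker 1 r" using submoduleD(2)[OF A iter_ker_submodule] by simp
  show "iter_ker 1 r \<subseteq> iter_ker 1 0" using iter_im_antimono[of 0 r] by (auto simp: iter_ker_def)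
  show "torsion_over R s A {\<zero>} (iter_ker 1 r)" unfolding torsion_over_def
  proof
    fix y assume "y \<in> iter_ker 1 r"
    then obtain x where x: "x \<in> carrier A" "y = (T ^^ r) x" "T y = \<zero>"
      by (auto simp: iter_ker_def iter_im_def)
    then have "x \<in> iter_ker (Suc r) 0" by (simp add: iter_ker_def iter_im_def)
    then obtain k :: nat where "(s [^]\<^bsub>R\<^esub> k) \<odot> x \<in> iter_ker r 0" using tor unfolding torsion_over_def by blast
    then have "(T ^^ r) ((s [^]\<^bsub>R\<^esub> k) \<odot> x) = \<zero>" by (simp add: iter_ker_def)
    then have "(s [^]\<^bsub>R\<^esub> k) \<odot> y = \<zero>" using funpowD(3)[of "s [^]\<^bsub>R\<^esub> k" x r] s x by simp
    then show "\<exists>k::nat. (s [^]\<^bsub>R\<^esub> k) \<odot> y \<in> {\<zero>}" by blast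
  qed
qed (rule iter_ker_submodule order_refl)+

end

text \<open>Via \<open>f\<close> the cohomology of \<open>C\<close> is a subquotient of \<open>P\<^sup>n\<close>.\<close>

lemma quasi_iso_torsion_finite:
  fixes R :: "'r ring" and P :: "('r, 'q) cochain" and C :: "('r, 'm) cochain"
  assumes P: "cochain_complex R P" and C: "cochain_complex R C" and f: "quasi_iso R P C f"
    and s: "s \<in> carrier R" and fin: "torsion_finite R s (cmodule P n) {\<zero>\<^bsub>cmodule P n\<^esub>} (carrier (cmodule P n))"
  shows "torsion_finite R s (cmodule C n) (coboundaries C n) (cocycles C n)"
proof -
  have fc: "chain_map R P C f" using f by (simp add: quasi_iso_def)
  note ind = coh_map_induced[OF P C fc]
  note H = cohomology_module[OF C, of n] and HP = cohomology_module[OF P, of n]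
  note hom = ind(1)[of n]
  interpret HP: module R "cohomology P n" by (rule HP)
  interpret H: module R "cohomology C n" by (rule H)
  have bij: "bij_betw (coh_map C f n) (carrier (cohomology P n)) (carrier (cohomology C n))"
    using f by (simp add: quasi_iso_def)
  have z: "coh_map C f n \<zero>\<^bsub>cohomology P n\<^esub> = \<zero>\<^bsub>cohomology C n\<^esub>" using mod_hom_zero_minus(1)[OF HP H hom] .
  interpret I: subquot_iso R "cohomology P n" "{\<zero>\<^bsub>cohomology P n\<^esub>}" "carrier (cohomology P n)"
    "cohomology C n" "{\<zero>\<^bsub>cohomology C n\<^esub>}" "carrier (cohomology C n)" "coh_map C f n"
  proof (intro subquot_iso.intro H HP submodule_zero submodule_carrier)
    show "coh_map C f n \<in> mod_hom R (cohomology P n \<restriction> carrier (cohomology P n)) (cohomology C n)"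
      using hom by simp
    show "coh_map C f n X \<in> carrier (cohomology C n)" if "X \<in> carrier (cohomology P n)" for X
      using mod_homD(1)[OF hom that] .
    show "coh_map C f n X \<in> {\<zero>\<^bsub>cohomology C n\<^esub>} \<longleftrightarrow> X \<in> {\<zero>\<^bsub>cohomology P n\<^esub>}"
      if X: "X \<in> carrier (cohomology P n)" for X
      using inj_onD[OF bij_betw_imp_inj_on[OF bij] _ X HP.M.zero_closed] z by auto
    show "\<exists>X\<in>carrier (cohomology P n). \<exists>k\<in>{\<zero>\<^bsub>cohomology C n\<^esub>}. Y = coh_map C f n X \<oplus>\<^bsub>cohomology C n\<^esub> k"
      if Y: "Y \<in> carrier (cohomology C n)" for Y
    proof -
      obtain X where "X \<in> carrier (cohomology P n)" "Y = coh_map C f n X"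
        using Y bij_betw_imp_surj_on[OF bij] by blast
      then show ?thesis using H.M.r_zero[OF Y] by auto
    qed
  qed auto
  have "torsion_finite R s (cmodule P n) (coboundaries P n) (cocycles P n)"
    using submoduleD(2)[OF cmodule_module[OF P] coboundaries_submodule[OF P]]
    by (intro torsion_finite_mono[OF fin]) (auto simp: cocycles_def)
  then show ?thesis
    using subquot_iso.torsion_finite_iff[OF cohomology_iso[OF P] s] I.torsion_finite_iff[OF s]
      subquot_iso.torsion_finite_iff[OF cohomology_iso[OF C] s] by simp
qed

context complex_endo
begin

text \<open>The kernel of \<open>T\<close> is the image of \<open>H\<^sup>n\<close> of the fibre under the projection to \<open>H\<^sup>n(M)\<close>.\<close>

lemma ker_torsion_finite:
  assumes s: "s \<in> carrier R" and fin: "torsion_finite R s (cmodule F n) (coboundaries F n) (cocycles F n)"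
  shows "torsion_finite R s (A n) {\<zero>\<^bsub>A n\<^esub>} (ker_T n)"
proof -
  let ?K = "{w \<in> cocycles F n. fst w \<in> B n}"
  interpret An: module R "A n" by (rule Amod)
  have h: "fst \<in> mod_hom R (cmodule F n \<restriction> cocycles F n) (C n)"
    by (rule mod_hom_restrict_full[OF fst_hom FZ_carrier])
  have sK: "submodule ?K R (cmodule F n)" by (rule submodule_preimage[OF Fmod Mmod FZ h Bsub])
  have fZ: "fst w \<in> Z n" if "w \<in> cocycles F n" for w
    using that fib_cocycles[of "fst w" "snd w" n] by simp
  interpret S: subquot_iso R "cmodule F n" ?K "cocycles F n" "A n" "{\<zero>\<^bsub>A n\<^esub>}" "ker_T n" "\<lambda>w. cls n (fst w)"
  proof (intro subquot_iso.intro Fmod Amod sK FZ submodule_zero ker_T_submodule)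
    show "{\<zero>\<^bsub>A n\<^esub>} \<subseteq> ker_T n" using submoduleD(2)[OF Amod ker_T_submodule] by simp
    show "(\<lambda>w. cls n (fst w)) \<in> mod_hom R (cmodule F n \<restriction> cocycles F n) (A n)"
    proof -
      note c = mod_hom_on[OF Mmod Amod Zsub subquot_iso.hom[OF cls_iso[of n]]]
      note f = mod_hom_on[OF Fmod Mmod FZ h]
      show ?thesis using c(1-3) f(1-3) fZ by (auto simp: mod_hom_def)
    qed
    show "cls n (fst w) \<in> ker_T n" if w: "w \<in> cocycles F n" for w
      using w fib_cocycles[of "fst w" "snd w" n] cls_ker_T[OF fZ[OF w]] by (auto simp: coboundaries_def)
    show "cls n (fst w) \<in> {\<zero>\<^bsub>A n\<^esub>} \<longleftrightarrow> w \<in> ?K" if w: "w \<in> cocycles F n" for w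
      using w cls_zero_iff[OF fZ[OF w]] by simp
    show "\<exists>w\<in>cocycles F n. \<exists>k\<in>{\<zero>\<^bsub>A n\<^esub>}. X = cls n (fst w) \<oplus>\<^bsub>A n\<^esub> k" if X: "X \<in> ker_T n" for X
    proof -
      have Xc: "X \<in> carrier (A n)" using X by (simp add: ker_T_def)
      then obtain x where x: "x \<in> Z n" "X = cls n x" unfolding carrier_A by blast
      then have "\<theta> n x \<in> B n" using X cls_ker_T by simp
      then obtain y where "y \<in> carrier (C (n - 1))" "\<theta> n x = d (n - 1) y"
        by (auto simp: coboundaries_def)
      then have "(x, y) \<in> cocycles F n" using x(1) by (simp add: fib_cocycles)
      moreover have "X = cls n (fst (x, y)) \<oplus>\<^bsub>A n\<^esub> \<zero>\<^bsub>A n\<^esub>" using An.M.r_zero[OF Xc] x(2) by simp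
      ultimately show ?thesis by blast
    qed
  qed auto
  have "coboundaries F n \<subseteq> ?K"
  proof
    fix w assume w: "w \<in> coboundaries F n"
    then have "fst w \<in> B n"
      using fib_coboundaries[of "fst w" "snd w" n] by (auto simp: coboundaries_def[of M])
    then show "w \<in> ?K" using w FBZ by blast
  qed
  then show ?thesis using torsion_finite_mono[OF fin _ order_refl] S.torsion_finite_iff[OF s] by simp
qed

text \<open>By \<open>x \<mapsto> (0, x)\<close> the cokernel of \<open>T\<close> on \<open>H\<^sup>n(M)\<close> embeds into \<open>H\<^sup>n\<^sup>+\<^sup>1\<close> of the fibre.\<close>

lemma coker_torsion_finite:
  assumes s: "s \<in> carrier R"
    and fin: "torsion_finite R s (cmodule F (n + 1)) (coboundaries F (n + 1)) (cocycles F (n + 1))"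
  shows "torsion_finite R s (A n) (im_T n) (carrier (A n))"
proof -
  let ?E = "cmodule F (n + 1)" and ?B = "coboundaries F (n + 1)"
  define j where "j x = (\<zero>\<^bsub>C (n + 1)\<^esub>, x)" for x :: 'm
  interpret Mp: module R "C (n + 1)" by (rule Mmod)
  have j: "j \<in> mod_hom R (C n \<restriction> Z n) ?E"
    by (rule mod_hom_restrict_full) (auto simp: j_def mod_hom_def fib_simps dsum_simps cocycles_def)
  have jZ: "j x \<in> cocycles F (n + 1)" if "x \<in> Z n" for x
    using that zero_pair_cocycle[of "n + 1" x] by (simp add: j_def)
  interpret P: subquot_iso R "C n" "B n" "Z n" "A n" "{\<zero>\<^bsub>A n\<^esub>}" "carrier (A n)" "cls n"
    by (rule cls_iso)
  interpret Q: subquot_iso R "C n" "P.pull (im_T n)" "P.pull (carrier (A n))" "A n"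
    "im_T n" "carrier (A n)" "cls n"
    using submoduleD(1,2)[OF Amod im_T_submodule] by (intro P.iso_pull submodule_carrier Amod im_T_submodule) auto
  have Z: "P.pull (carrier (A n)) = Z n" by (auto simp: P.pull_def P.into)
  have sI: "submodule (j ` Z n) R ?E" by (rule submodule_image[OF Mmod Fmod Zsub j Zsub order_refl])
  have sZ: "submodule (j ` Z n <+>\<^bsub>?E\<^esub> ?B) R ?E" by (intro submodule_set_add Fmod sI FB)
  interpret S: subquot_iso R "C n" "P.pull (im_T n)" "Z n" ?E ?B "j ` Z n <+>\<^bsub>?E\<^esub> ?B" j
  proof (intro subquot_iso.intro Mmod Fmod Zsub Q.sK FB sZ j)
    show "P.pull (im_T n) \<subseteq> Z n" by (auto simp: P.pull_def)
    show "?B \<subseteq> j ` Z n <+>\<^bsub>?E\<^esub> ?B" by (rule set_add_upper(2)[OF Fmod sI FB])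
    show "j x \<in> j ` Z n <+>\<^bsub>?E\<^esub> ?B" if "x \<in> Z n" for x
      using that set_add_upper(1)[OF Fmod sI FB] by blast
    show "j x \<in> ?B \<longleftrightarrow> x \<in> P.pull (im_T n)" if x: "x \<in> Z n" for x
      using zero_pair_coboundary[of "n + 1" x] cls_im_T[OF x] x by (simp add: j_def P.pull_def)
    show "\<exists>x\<in>Z n. \<exists>k\<in>?B. y = j x \<oplus>\<^bsub>?E\<^esub> k" if "y \<in> j ` Z n <+>\<^bsub>?E\<^esub> ?B" for y
      using that unfolding mem_set_add by blast
  qed
  have "j ` Z n <+>\<^bsub>?E\<^esub> ?B \<subseteq> cocycles F (n + 1)"
    using jZ by (intro set_add_least[OF Fmod FZ _ FBZ]) auto
  then show ?thesis
    using torsion_finite_mono[OF fin order_refl] S.torsion_finite_iff[OF s] Q.torsion_finite_iff[OF s]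
    unfolding Z by simp
qed

end

context perfect_after_localization
begin

lemma s_carrier: "s \<in> carrier R"
  using s by (simp add: power_associates_def)

abbreviation cls :: "int \<Rightarrow> 'm \<Rightarrow> 'm set"
  where "cls n x \<equiv> coboundaries M n +>\<^bsub>cmodule M n\<^esub> x"

lemma cls_iso: "subquot_iso R (cmodule M n) (coboundaries M n) (cocycles M n)
    (cohomology M n) {\<zero>\<^bsub>cohomology M n\<^esub>} (carrier (cohomology M n)) (cls n)"
  by (rule cohomology_iso[OF M])

text \<open>
  Submodules of \<open>Q\<^sup>n\<close> satisfy both chain conditions, so a monotone sequence of submodules of \<open>H\<^sup>n(M)\<close> is followed
  through its traces in \<open>Q\<^sup>n\<close>.
\<close>

definition trace :: "int \<Rightarrow> 'm set set \<Rightarrow> 'q set"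
  where "trace n N = pullback n {x \<in> cocycles M n. cls n x \<in> N}"

lemma preimage_cls:
  "{x \<in> cocycles M n. cls n x \<in> N} =
    subquot_iso.pull (cocycles M n) (cls n) N"
  by (simp add: subquot_iso.pull_def[OF cls_iso])

lemma trace_submodule: "submodule N R (cohomology M n) \<Longrightarrow> submodule (trace n N) K (cmodule Q n)"
  unfolding trace_def preimage_cls by (intro pullback_submodule subquot_iso.pull_submodule[OF cls_iso])

lemma trace_mono: "N \<subseteq> N' \<Longrightarrow> trace n N \<subseteq> trace n N'"
  by (auto simp: trace_def pullback_def)

lemma torsion_over_if_trace:
  assumes N: "submodule N R (cohomology M n)" "submodule N' R (cohomology M n)" "N \<subseteq> N'"
    and le: "trace n N' \<subseteq> trace n N"
  shows "torsion_over R s (cohomology M n) N N'"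
proof -
  interpret P: subquot_iso R "cmodule M n" "coboundaries M n" "cocycles M n" "cohomology M n"
    "{\<zero>\<^bsub>cohomology M n\<^esub>}" "carrier (cohomology M n)" "cls n"
    by (rule cls_iso)
  have z: "{\<zero>\<^bsub>cohomology M n\<^esub>} \<subseteq> N" "{\<zero>\<^bsub>cohomology M n\<^esub>} \<subseteq> N'" "N' \<subseteq> carrier (cohomology M n)"
    using submoduleD(1,2)[OF P.M' N(1)] submoduleD(1,2)[OF P.M' N(2)] by auto
  have "torsion_over R s (cmodule M n) (P.pull N) (P.pull N')"
    by (rule torsion_over_if_pullback[OF P.pull_submodule[OF N(1)] P.pull_submodule[OF N(2)]
        P.pull_bounds(1)[OF z(1)] P.pull_bounds(1)[OF z(2)] P.pull_bounds(2) le[unfolded trace_def preimage_cls]])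
  then show ?thesis
    using subquot_iso.torsion_over_iff[OF P.iso_pull[OF N(1,2) z(1) N(3) z(3)] s_carrier] by simp
qed

lemma descending_torsion:
  assumes N: "\<And>r::nat. submodule (N r) R (cohomology M n)" "\<And>r. N (Suc r) \<subseteq> N r"
  shows "\<exists>r\<^sub>0. \<forall>r\<ge>r\<^sub>0. torsion_over R s (cohomology M n) (N (Suc r)) (N r)"
proof -
  obtain r\<^sub>0 where eq: "\<forall>r\<ge>r\<^sub>0. trace n (N (Suc r)) = trace n (N r)"
    using finite_length_descending[where H = "\<lambda>r. trace n (N r)",
        OF cmodule_module[OF Q(1)] terms_finite_length trace_submodule[OF N(1)] trace_mono[OF N(2)]] ..
  have "torsion_over R s (cohomology M n) (N (Suc r)) (N r)" if "r \<ge> r\<^sub>0" for r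
    using eq that by (intro torsion_over_if_trace N) simp
  then show ?thesis by blast
qed

lemma ascending_torsion:
  assumes N: "\<And>r::nat. submodule (N r) R (cohomology M n)" "\<And>r. N r \<subseteq> N (Suc r)"
  shows "\<exists>r\<^sub>0. \<forall>r\<ge>r\<^sub>0. torsion_over R s (cohomology M n) (N r) (N (Suc r))"
proof -
  obtain r\<^sub>0 where eq: "\<forall>r\<ge>r\<^sub>0. trace n (N (Suc r)) = trace n (N r)"
    using finite_length_ascending[where H = "\<lambda>r. trace n (N r)",
        OF cmodule_module[OF Q(1)] terms_finite_length trace_submodule[OF N(1)] trace_mono[OF N(2)]] ..
  have "torsion_over R s (cohomology M n) (N r) (N (Suc r))" if "r \<ge> r\<^sub>0" for r
    using eq that by (intro torsion_over_if_trace N) simp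
  then show ?thesis by blast
qed

end

section \<open>Powers of the endomorphism\<close>

context complex_endo
begin

lemma chain_pow_map: "chain_map R M M (chain_pow \<theta> r)"
proof (induction r)
  case 0
  show ?case by (auto simp: chain_map_def mod_hom_def)
next
  case (Suc r)
  note f = chain_mapD[OF Suc]
  note g = mod_homD[OF f(1)]
  show ?case unfolding chain_map_def
  proof (intro conjI allI ballI)
    fix n
    show "chain_pow \<theta> (Suc r) n \<in> mod_hom R (C n) (C n)"
      using g tD(1-3) by (auto simp: mod_hom_def chain_comp_def)
    show "chain_pow \<theta> (Suc r) (n + 1) (d n x) = d n (chain_pow \<theta> (Suc r) n x)"
      if x: "x \<in> carrier (C n)" for x
      using f(2)[OF x] d_theta[OF g(1)[OF x]] by (simp add: chain_comp_def)
  qed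
qed

lemma power_endo: "complex_endo R M (chain_pow \<theta> r)"
  by (intro complex_endo.intro M chain_pow_map)

lemma coh_map_chain_pow:
  assumes "X \<in> carrier (A n)"
  shows "coh_map M (chain_pow \<theta> r) n X = (T n ^^ r) X"
proof -
  obtain x where x: "x \<in> Z n" "X = cls n x" using assms unfolding carrier_A by blast
  have "(T n ^^ r) (cls n x) = cls n (chain_pow \<theta> r n x)"
  proof (induction r)
    case (Suc r)
    have "chain_pow \<theta> r n x \<in> Z n" by (rule coh_map_induced(3)[OF M M chain_pow_map x(1)])
    then show ?case using Suc T_cls by (simp add: chain_comp_def)
  qed simp
  then show ?thesis using complex_endo.T_cls[OF power_endo x(1)] x(2) by simp
qed

definition ker_length :: "int \<Rightarrow> nat \<Rightarrow> enat"
  where "ker_length n r = rlen R (A n) {\<zero>\<^bsub>A n\<^esub>} (module_endo.iter_ker (A n) (T n) r r)"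

definition coker_length :: "int \<Rightarrow> nat \<Rightarrow> enat"
  where "coker_length n r = rlen R (A n)
    (module_endo.iter_ker (A n) (T n) r 0 <+>\<^bsub>A n\<^esub> module_endo.iter_im (A n) (T n) r) (carrier (A n))"

lemma Bock_power_length:
  "mod_length R (cohomology (Bock M (chain_pow \<theta> r)) n) = ker_length n r + coker_length (n - 1) r"
proof -
  interpret P: complex_endo R M "chain_pow \<theta> r" by (rule power_endo)
  have im: "P.im_T m = module_endo.iter_im (A m) (T m) r" for m
    unfolding P.im_T_def module_endo.iter_im_def[OF endo] using coh_map_chain_pow by (intro image_cong) auto
  have ker: "P.ker_T m = module_endo.iter_ker (A m) (T m) r 0" for m
    unfolding P.ker_T_def module_endo.iter_ker_def[OF endo] module_endo.iter_im_def[OF endo]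
    using coh_map_chain_pow by auto
  have "module_endo.iter_im (A n) (T n) r \<subseteq> carrier (A n)" by (rule module_endo.iter_im_carrier[OF endo])
  then have "P.im_T n \<inter> P.ker_T n = module_endo.iter_ker (A n) (T n) r r"
    unfolding im ker module_endo.iter_ker_def[OF endo] by (auto simp: module_endo.iter_im_def[OF endo])
  then show ?thesis
    unfolding P.Bock_length ker_length_def coker_length_def by (simp add: im ker)
qed

lemma lengths_zero:
  assumes "carrier (A n) = {\<zero>\<^bsub>A n\<^esub>}"
  shows "ker_length n r = 0" "coker_length n r = 0"
proof -
  note K = module_endo.iter_ker_submodule[OF endo, of n] and I = module_endo.iter_im_submodule[OF endo, of n]
  have *: "N = {\<zero>\<^bsub>A n\<^esub>}" if "submodule N R (A n)" for N
    using submoduleD(1,2)[OF Amod that] assms by auto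
  show "ker_length n r = 0" unfolding ker_length_def *[OF K] by (rule rlen_self)
  show "coker_length n r = 0" unfolding coker_length_def assms *[OF submodule_set_add[OF Amod K I]]
    by (rule rlen_self)
qed

end

text \<open>
  From some \<open>r\<close> on the steps of the chains \<open>T\<^sup>r A\<close> and \<open>ker T\<^sup>r\<close> are torsion, because \<open>M\<close> is perfect after inverting
  \<open>s\<close>. Then \<open>ker T \<inter> T\<^sup>r A\<close> and \<open>T\<^sup>r A / T\<^sup>r\<^sup>+\<^sup>1 A\<close> have finite length, because torsion subquotients of the
  cohomology of the fibre do.
\<close>

lemma ker_coker_length_eventually_linear:
  fixes R :: "'r ring" and M :: "('r, 'm) cochain" and P :: "('r, 'q) cochain"
    and Q :: "(('r \<times> nat) set, 'k) cochain"
  assumes E: "complex_endo R M \<theta>" and L: "perfect_after_localization R s M Q f"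
    and P: "cochain_complex R P" "\<And>n. fin_generated R (cmodule P n)" "quasi_iso R P (fib M M \<theta>) g"
  shows "\<exists>r\<^sub>0. \<exists>l::int. \<forall>r\<ge>r\<^sub>0. complex_endo.ker_length R M \<theta> n r \<noteq> \<infinity> \<and> complex_endo.coker_length R M \<theta> n r \<noteq> \<infinity> \<and>
    int (the_enat (complex_endo.ker_length R M \<theta> n r)) - int (the_enat (complex_endo.coker_length R M \<theta> n r)) = int r * l"
proof -
  interpret complex_endo R M \<theta> by (rule E)
  interpret L: perfect_after_localization R s M Q f by (rule L)
  interpret T: module_endo R "A n" "T n" by (rule endo)
  note s = L.s_carrier
  have tf: "torsion_finite R s (cmodule F m) (coboundaries F m) (cocycles F m)" for m
    by (rule quasi_iso_torsion_finite[OF P(1) fib_complex P(3) s])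
      (rule fin_generated_torsion_finite[OF cmodule_module[OF P(1)] L.s P(2)])
  have k: "T.iter_ker 1 0 = ker_T n" by (simp add: T.iter_ker_def T.iter_im_def ker_T_def)
  have i: "T.iter_im 1 = im_T n" by (simp add: T.iter_im_def im_T_def)
  have mono: "T.iter_ker r 0 \<subseteq> T.iter_ker (Suc r) 0" for r
    using T.funpowD(4)[of 1] by (auto simp: T.iter_ker_def)
  obtain r\<^sub>1 where r1: "\<forall>r\<ge>r\<^sub>1. torsion_over R s (A n) (T.iter_im (Suc r)) (T.iter_im r)"
    using L.descending_torsion[of T.iter_im n, OF T.iter_im_submodule T.iter_im_Suc_subset] ..
  obtain r\<^sub>2 where r2: "\<forall>r\<ge>r\<^sub>2. torsion_over R s (A n) (T.iter_ker r 0) (T.iter_ker (Suc r) 0)"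
    using L.ascending_torsion[of "\<lambda>r. T.iter_ker r 0" n, OF T.iter_ker_submodule mono] ..
  have "T.coker_len (max r\<^sub>1 r\<^sub>2) \<noteq> \<infinity>"
    using T.coker_len_finite[OF s coker_torsion_finite[OF s tf, of n, folded i]] r1 by simp
  moreover have "T.ker_len (max r\<^sub>1 r\<^sub>2) \<noteq> \<infinity>"
    using T.ker_len_finite[OF s ker_torsion_finite[OF s tf, of n, folded k]] r2 by simp
  ultimately obtain l :: int where
    "\<And>r. r \<ge> max r\<^sub>1 r\<^sub>2 \<Longrightarrow> rlen R (A n) {\<zero>\<^bsub>A n\<^esub>} (T.iter_ker r r) \<noteq> \<infinity>"
    "\<And>r. r \<ge> max r\<^sub>1 r\<^sub>2 \<Longrightarrow> rlen R (A n) (T.iter_ker r 0 <+>\<^bsub>A n\<^esub> T.iter_im r) (carrier (A n)) \<noteq> \<infinity>"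
    "\<And>r. r \<ge> max r\<^sub>1 r\<^sub>2 \<Longrightarrow> int (the_enat (rlen R (A n) {\<zero>\<^bsub>A n\<^esub>} (T.iter_ker r r))) -
       int (the_enat (rlen R (A n) (T.iter_ker r 0 <+>\<^bsub>A n\<^esub> T.iter_im r) (carrier (A n)))) = int r * l"
    using T.index_of_power by blast
  then show ?thesis unfolding ker_length_def coker_length_def by blast
qed

section \<open>The Euler characteristic\<close>

text \<open>
  A cokernel in degree \<open>i - 1\<close> contributes to the cohomology in degree \<open>i\<close>, with the sign opposite to that of
  the kernel in degree \<open>i - 1\<close>.
\<close>

lemma alternating_sum_shift:
  fixes k c :: "int \<Rightarrow> nat"
  assumes z: "\<And>i. i < a \<or> i > b \<Longrightarrow> k i = 0 \<and> c i = 0"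
  shows "(\<Sum>i | k i + c (i - 1) \<noteq> 0. (if even i then 1 else - 1) * int (k i + c (i - 1))) =
    (\<Sum>i\<in>{a..b}. (if even i then 1 else - 1) * (int (k i) - int (c i)))"
proof -
  let ?s = "\<lambda>i::int. if even i then 1 else - 1 :: int"
  have "(\<Sum>i | k i + c (i - 1) \<noteq> 0. ?s i * int (k i + c (i - 1))) =
      (\<Sum>i\<in>{a..b + 1}. ?s i * int (k i + c (i - 1)))"
  proof (rule sum.mono_neutral_left)
    show "{i. k i + c (i - 1) \<noteq> 0} \<subseteq> {a..b + 1}"
    proof
      fix i assume i: "i \<in> {i. k i + c (i - 1) \<noteq> 0}"
      show "i \<in> {a..b + 1}"
      proof (rule ccontr)
        assume "i \<notin> {a..b + 1}"
        then have "k i = 0" "c (i - 1) = 0" using z[of i] z[of "i - 1"] by auto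
        then show False using i by simp
      qed
    qed
  qed auto
  also have "\<dots> = (\<Sum>i\<in>{a..b + 1}. ?s i * int (k i)) + (\<Sum>i\<in>{a..b + 1}. ?s i * int (c (i - 1)))"
    by (simp add: sum.distrib[symmetric] distrib_left)
  also have "(\<Sum>i\<in>{a..b + 1}. ?s i * int (k i)) = (\<Sum>i\<in>{a..b}. ?s i * int (k i))"
    using z by (intro sum.mono_neutral_right) auto
  also have "(\<Sum>i\<in>{a..b + 1}. ?s i * int (c (i - 1))) = (\<Sum>i\<in>{a - 1..b}. ?s (i + 1) * int (c i))"
    by (rule sum.reindex_bij_witness[of _ "\<lambda>i. i + 1" "\<lambda>i. i - 1"]) auto
  also have "\<dots> = (\<Sum>i\<in>{a..b}. ?s (i + 1) * int (c i))"
    using z by (intro sum.mono_neutral_right) auto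
  also have "(\<Sum>i\<in>{a..b}. ?s i * int (k i)) + \<dots> = (\<Sum>i\<in>{a..b}. ?s i * (int (k i) - int (c i)))"
    unfolding sum.distrib[symmetric] by (intro sum.cong) (auto simp: right_diff_distrib)
  finally show ?thesis .
qed

lemma perfectE:
  fixes C :: "('r, 'm) cochain"
  assumes "perfect R C"
  obtains Q :: "('r, nat \<Rightarrow> 'r) cochain" and f where "cochain_complex R Q"
    "\<And>n. fin_generated R (cmodule Q n)" "quasi_iso R Q C f"
  using assms unfolding perfect_def
proof (elim exE conjE)
  fix Q :: "('r, nat \<Rightarrow> 'r) cochain" and f
  assume "cochain_complex R Q" "\<forall>n. projective R (cmodule Q n) \<and> fin_generated R (cmodule Q n)"
    "quasi_iso R Q C f"
  then show thesis by (intro that[of Q f]) simp_all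
qed

theorem proposition5p1:
  fixes p :: nat
    and M :: "(nat \<Rightarrow> int, 'm) cochain"
    and \<theta> :: "int \<Rightarrow> 'm \<Rightarrow> 'm"
  assumes "prime p"
    and "in_Db (Zp p) M"
    and "perfect (Qp p) (invert_p p M)"
    and "chain_map (Zp p) M M \<theta>"
    and "perfect (Zp p) (fib M M \<theta>)"
  shows "(\<forall>\<^sub>F r in sequentially. chi_l_exists (Zp p) (Bock M (chain_pow \<theta> r))) \<and>
    (\<exists>L :: int. (\<lambda>r. real_of_int (chi_l (Zp p) (Bock M (chain_pow \<theta> r))) / real r)
       \<longlonglongrightarrow> real_of_int L)"
proof -
  let ?R = "Zp p"
  have M: "cochain_complex ?R M" using assms(2) by (simp add: in_Db_def)
  interpret complex_endo ?R M \<theta> by (intro complex_endo.intro M assms(4))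
  obtain Q :: "(((nat \<Rightarrow> int) \<times> nat) set, nat \<Rightarrow> ((nat \<Rightarrow> int) \<times> nat) set) cochain" and f
    where Q: "cochain_complex (loc_ring ?R (Zp_p p)) Q"
      "\<And>n. fin_generated (loc_ring ?R (Zp_p p)) (cmodule Q n)"
      "quasi_iso (loc_ring ?R (Zp_p p)) Q (loc_cochain ?R (Zp_p p) M) f"
    using assms(3)[unfolded Qp_def invert_p_def] by (rule perfectE) (rule that)
  have loc: "perfect_after_localization ?R (Zp_p p) M Q f"
    by (intro perfect_after_localization.intro M Zp_power_associates assms(1) Q)
  obtain P :: "(nat \<Rightarrow> int, nat \<Rightarrow> nat \<Rightarrow> int) cochain" and g where P: "cochain_complex ?R P" "\<And>n. fin_generated ?R (cmodule P n)" "quasi_iso ?R P F g"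
    using assms(5) by (rule perfectE) (rule that)
  have "\<forall>n. \<exists>r\<^sub>0. \<exists>l::int. \<forall>r\<ge>r\<^sub>0. ker_length n r \<noteq> \<infinity> \<and> coker_length n r \<noteq> \<infinity> \<and>
      int (the_enat (ker_length n r)) - int (the_enat (coker_length n r)) = int r * l"
    by (rule allI, rule ker_coker_length_eventually_linear[OF complex_endo_axioms loc P])
  from choice[OF this] obtain r0 where "\<forall>n. \<exists>l::int. \<forall>r\<ge>r0 n. ker_length n r \<noteq> \<infinity> \<and> coker_length n r \<noteq> \<infinity> \<and>
      int (the_enat (ker_length n r)) - int (the_enat (coker_length n r)) = int r * l" ..
  from choice[OF this] obtain l where l: "\<forall>n. \<forall>r\<ge>r0 n. ker_length n r \<noteq> \<infinity> \<and> coker_length n r \<noteq> \<infinity> \<and>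
      int (the_enat (ker_length n r)) - int (the_enat (coker_length n r)) = int r * l n" ..
  have lin: "ker_length n r \<noteq> \<infinity>" "coker_length n r \<noteq> \<infinity>"
    "int (the_enat (ker_length n r)) - int (the_enat (coker_length n r)) = int r * l n" if "r \<ge> r0 n" for n r
    using l that by simp_all
  have "\<exists>b. \<forall>n>b. carrier (cmodule M n) = {\<zero>\<^bsub>cmodule M n\<^esub>}" and "\<exists>a. \<forall>n<a. carrier (A n) = {\<zero>\<^bsub>A n\<^esub>}"
    using assms(2)[unfolded in_Db_def] by blast+
  then obtain a b where b: "\<forall>n>b. carrier (cmodule M n) = {\<zero>\<^bsub>cmodule M n\<^esub>}"
    and a: "\<forall>n<a. carrier (A n) = {\<zero>\<^bsub>A n\<^esub>}" by (elim exE) (rule that)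
  have "carrier (A n) = {\<zero>\<^bsub>A n\<^esub>}" if n: "n < a \<or> n > b" for n
  proof (cases "n > b")
    case True
    have "cocycles M n = {\<zero>\<^bsub>cmodule M n\<^esub>}"
      using b True submoduleD(1,2)[OF Mmod Zsub, of n] by auto
    then have "carrier (A n) = {cls n \<zero>\<^bsub>cmodule M n\<^esub>}" by (simp add: carrier_cohomology)
    then show ?thesis using cls_zero_iff[OF ZD(2), of n] BD(2)[of n] by simp
  next
    case False
    then show ?thesis using n a by simp
  qed
  note zero = lengths_zero[OF this]
  (* The 1 keeps r1 positive, so that the quotient by r below is not the default value at r = 0. *)
  define r1 where "r1 = Max (r0 ` {a..b} \<union> {1})"
  define L where "L = (\<Sum>i\<in>{a..b}. (if even i then 1 else - 1) * l i)"
  have fin: "ker_length n r \<noteq> \<infinity>" "coker_length n r \<noteq> \<infinity>" if "r \<ge> r1" for n r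
  proof -
    have "ker_length n r \<noteq> \<infinity> \<and> coker_length n r \<noteq> \<infinity>"
    proof (cases "n < a \<or> n > b")
      case True
      then show ?thesis using zero by (simp add: zero_enat_def)
    next
      case False
      then have "r0 n \<le> r1" unfolding r1_def by (intro Max_ge) auto
      then show ?thesis using lin(1,2)[of n r] that by simp
    qed
    then show "ker_length n r \<noteq> \<infinity>" "coker_length n r \<noteq> \<infinity>" by auto
  qed
  have len: "mod_length ?R (cohomology (Bock M (chain_pow \<theta> r)) i) =
      enat (the_enat (ker_length i r) + the_enat (coker_length (i - 1) r))" if "r \<ge> r1" for r i
    unfolding Bock_power_length using fin(1)[OF that, of i] fin(2)[OF that, of "i - 1"] by auto
  have chi: "chi_l ?R (Bock M (chain_pow \<theta> r)) = int r * L" if r: "r \<ge> r1" for r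
  proof -
    have z: "i < a \<or> i > b \<Longrightarrow> the_enat (ker_length i r) = 0 \<and> the_enat (coker_length i r) = 0" for i
      using zero by (simp add: zero_enat_def)
    have ne: "(enat m \<noteq> 0) = (m \<noteq> 0)" for m by (simp add: zero_enat_def)
    have "chi_l ?R (Bock M (chain_pow \<theta> r)) = (\<Sum>i\<in>{a..b}. (if even i then 1 else - 1) *
        (int (the_enat (ker_length i r)) - int (the_enat (coker_length i r))))"
      unfolding chi_l_def len[OF r] ne the_enat.simps by (rule alternating_sum_shift[OF z])
    also have "\<dots> = (\<Sum>i\<in>{a..b}. (if even i then 1 else - 1) * (int r * l i))"
    proof (intro sum.cong refl arg_cong2[of _ _ _ _ "(*)"])
      fix i assume "i \<in> {a..b}"
      then have "r0 i \<le> r1" unfolding r1_def by (intro Max_ge) auto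
      then show "int (the_enat (ker_length i r)) - int (the_enat (coker_length i r)) = int r * l i"
        using lin(3)[of i r] r by simp
    qed
    also have "\<dots> = int r * L" unfolding L_def sum_distrib_left by (intro sum.cong) auto
    finally show ?thesis .
  qed
  have "\<forall>\<^sub>F r in sequentially. chi_l_exists ?R (Bock M (chain_pow \<theta> r))"
    unfolding chi_l_exists_def eventually_sequentially using len by (intro exI[of _ r1]) simp
  moreover have "(\<lambda>r. real_of_int (chi_l ?R (Bock M (chain_pow \<theta> r))) / real r) \<longlonglongrightarrow> real_of_int L"
  proof (rule tendsto_eventually)
    have "1 \<le> r1" unfolding r1_def by (intro Max_ge) auto
    then have "real_of_int (chi_l ?R (Bock M (chain_pow \<theta> r))) / real r = real_of_int L" if "r \<ge> r1" for r
      using chi[OF that] that by simp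
    then show "\<forall>\<^sub>F r in sequentially. real_of_int (chi_l ?R (Bock M (chain_pow \<theta> r))) / real r = real_of_int L"
      unfolding eventually_sequentially by blast
  qed
  ultimately show ?thesis by blast
qed

end
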